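(* Let $N\ge2$, $k\ge1$. The bilinear product $\cdot$ (defined in the context by means of the orbit product and the Jacobi–Trudi determinant) makes $\mathcal{A}(\mathcal{O}(N,k))$, the $\mathbb{Q}$-vector space with basis the set $\mathcal{O}(N,k)$ of $S_k$-orbits of $\mathbb{Z}_N^k$, into an associative algebra, and this algebra is isomorphic to $\Lambda_N/I^{(N,k)}\cong\mathcal{F}(A_{N-1},k)$, via the linear map sending the orbit $[((N-1)^{a_{N-1}},\dots,1^{a_1},0^{a_0})]$ to the class of the Schur polynomial $S_{(\lambda)}$ with $(\lambda)=\left(\sum_{i=1}^{N-1}a_i,\sum_{i=2}^{N-1}a_i,\dots,a_{N-1}\right)$.
   Context: Orbits: $S_k$ acts on $\mathbb{Z}_N^k$ ($\mathbb{Z}_N=\mathbb{Z}/N\mathbb{Z}$) by permuting coordinates; $[x]$ is the orbit of $x$ and $\mathcal{O}(N,k)$ is the set of orbits. Each orbit has a unique representative in standard form $((N-1)^{a_{N-1}},\dots,1^{a_1},0^{a_0})$, $\sum_{i=0}^{N-1}a_i=k$ (exponents denote repetitions); the standard form of $[b]$ is written $\hat b$. For orbits $[a],[b],[c]$ let $T([a],[b],[c])=\{(x,y,z)\in[a]\times[b]\times[c] : x+y=z\}$, on which $S_k$ acts diagonally, and let $M_{[a],[b]}^{(k)[c]}$ be the number of $S_k$-orbits of $T([a],[b],[c])$. Put $[a]\times[b]=\sum_{[c]}M_{[a],[b]}^{(k)[c]}[c]$, extended bilinearly. Special orbits: these are the orbits $[((t+1)^m,t^{k-m})]$ with $0\le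 t\le N-2$, $0\le m\le k$, and $[((N-1)^{k-m},0^m)]$ with $0\le m\le k$. The new product $\cdot$: for an integer $m$ set $[h_m]=[(1^m,0^{k-m})]$ if $0\le m\le k$ and $[h_m]=0$ otherwise. For orbits $[a],[b]$: if $[b]$ is a special orbit, $[a]\cdot[b]=[a]\times[b]$. Otherwise, let $\tilde b=(\tilde b_1,\dots,\tilde b_{N-1})$ be the conjugate of $\hat b$ regarded as a partition (i.e. for $\hat b=((N-1)^{b_{N-1}},\dots,0^{b_0})$, $\tilde b_i=\sum_{j\ge i}b_j$), put $[h_{i,j}]=[h_{\tilde b_i-i+j}]$ for $1\le i,j\le N-1$, and $$[a]\cdot[b]=\sum_{\sigma\in S_{N-1}}\mathrm{sign}(\sigma)\,\big(\cdots(([a]\cdot[h_{1,\sigma(1)}])\cdot[h_{2,\sigma(2)}])\cdots\big)\cdot[h_{N-1,\sigma(N-1)}].$$ Each $[h_{i,j}]$ is zero or a special orbit, so this is well defined; the product is extended bilinearly. Fusion algebra: $\Lambda_N=\mathbb{Q}[x_1,\dots,x_N]^{S_N}$; $h_m$ are the complete homogeneous symmetric polynomials ($h_0=1$, $h_m=0$ for $m<0$); for a partition $(\mu)=(\mu_1,\dots,\mu_N)$ of length at most $N$, $S_{(\mu)}=\det(h_{\mu_i-i+j})_{i,j=1}^N$; $I^{(N,k)}$ is the ideal generated by $S_{(1^N)}-1$ and all $S_{(\mu)}$ with $\mu_1-\mu_N=k+1$. The fusion algebra $\mathcal{F}(A_{N-1},k)$ of type $A_{N-1}$ and level $k$ is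 $\Lambda_N/I^{(N,k)}$ (Goodman–Wenzl), with $\mathbb{Q}$-basis the classes of $S_{(\lambda)}$ for partitions $(\lambda)$ with at most $N-1$ parts and largest part at most $k$. *)

theory Defs
  imports
    "HOL-Library.Poly_Mapping"
    "HOL-Combinatorics.Permutations"
    "HOL-Algebra.Module"
    "HOL-Algebra.QuotRing"
    "HOL-Algebra.Algebraic_Closure_Type"
    "Jordan_Normal_Form.Determinant"
begin

section \<open>Orbits\<close>

text \<open>The elements of Z/N are represented by the residues 0, ..., N-1, and those of its k-th power by
  lists of length k.\<close>

definition vectors :: "nat \<Rightarrow> nat \<Rightarrow> nat list set" where
  "vectors N k = {x. length x = k \<and> set x \<subseteq> {..<N}}"

definition vec_plus :: "nat \<Rightarrow> nat list \<Rightarrow> nat list \<Rightarrow> nat list" where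
  "vec_plus N x y = map2 (\<lambda>i j. (i + j) mod N) x y"

definition perm_orbit :: "nat list \<Rightarrow> nat list set" where
  "perm_orbit x = {permute_list p x | p. p permutes {..<length x}}"

definition orbits :: "nat \<Rightarrow> nat \<Rightarrow> nat list set set" where
  "orbits N k = perm_orbit ` vectors N k"

text \<open>The list (N-1)^(e (N-1)), ..., 1^(e 1), 0^(e 0), exponents denoting repetitions.\<close>

definition standard_form :: "nat \<Rightarrow> (nat \<Rightarrow> nat) \<Rightarrow> nat list" where
  "standard_form N e = concat (map (\<lambda>i. replicate (e i) i) (rev [0..<N]))"

definition orbit_rep :: "nat \<Rightarrow> nat list set \<Rightarrow> nat list" where
  "orbit_rep N b = (THE x. x \<in> b \<and> (\<exists>e. x = standard_form N e))"

definition conj_part :: "nat \<Rightarrow> nat list set \<Rightarrow> nat \<Rightarrow> nat" where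
  "conj_part N b i = (\<Sum>j\<in>{i..<N}. count_list (orbit_rep N b) j)"

definition special_orbits :: "nat \<Rightarrow> nat \<Rightarrow> nat list set set" where
  "special_orbits N k =
     {perm_orbit (replicate m (t + 1) @ replicate (k - m) t) | t m. t + 2 \<le> N \<and> m \<le> k} \<union>
     {perm_orbit (replicate (k - m) (N - 1) @ replicate m 0) | m. m \<le> k}"


section \<open>The algebra on the orbits\<close>

text \<open>A vector of the space with basis the set of orbits is a finitely supported function
  on sets of lists, the support consisting of orbits.\<close>

type_synonym orbit_vec = "nat list set \<Rightarrow>\<^sub>0 rat"

abbreviation orbit_basis :: "nat list set \<Rightarrow> orbit_vec" where
  "orbit_basis a \<equiv> Poly_Mapping.single a 1"

definition orbit_scale :: "rat \<Rightarrow> orbit_vec \<Rightarrow> orbit_vec" where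
  "orbit_scale r v = Poly_Mapping.map ((*) r) v"

definition bilinear_ext ::
    "(nat list set \<Rightarrow> nat list set \<Rightarrow> orbit_vec) \<Rightarrow> orbit_vec \<Rightarrow> orbit_vec \<Rightarrow> orbit_vec" where
  "bilinear_ext f u v =
     (\<Sum>a\<in>Poly_Mapping.keys u. \<Sum>b\<in>Poly_Mapping.keys v.
        orbit_scale (Poly_Mapping.lookup u a * Poly_Mapping.lookup v b) (f a b))"

definition sum_triples ::
    "nat \<Rightarrow> nat list set \<Rightarrow> nat list set \<Rightarrow> nat list set \<Rightarrow> (nat list \<times> nat list \<times> nat list) set" where
  "sum_triples N a b c = {(x, y, z). x \<in> a \<and> y \<in> b \<and> z \<in> c \<and> vec_plus N x y = z}"

definition triple_orbit ::
    "nat \<Rightarrow> nat list \<times> nat list \<times> nat list \<Rightarrow> (nat list \<times> nat list \<times> nat list) set" where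
  "triple_orbit k = (\<lambda>(x, y, z).
     {(permute_list p x, permute_list p y, permute_list p z) | p. p permutes {..<k}})"

definition struct_const ::
    "nat \<Rightarrow> nat \<Rightarrow> nat list set \<Rightarrow> nat list set \<Rightarrow> nat list set \<Rightarrow> nat" where
  "struct_const N k a b c = card (triple_orbit k ` sum_triples N a b c)"

definition cross_basis :: "nat \<Rightarrow> nat \<Rightarrow> nat list set \<Rightarrow> nat list set \<Rightarrow> orbit_vec" where
  "cross_basis N k a b =
     (\<Sum>c\<in>orbits N k. orbit_scale (of_nat (struct_const N k a b c)) (orbit_basis c))"

definition cross :: "nat \<Rightarrow> nat \<Rightarrow> orbit_vec \<Rightarrow> orbit_vec \<Rightarrow> orbit_vec" where
  "cross N k = bilinear_ext (cross_basis N k)"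

definition h_orbit :: "nat \<Rightarrow> int \<Rightarrow> orbit_vec" where
  "h_orbit k m =
     (if 0 \<le> m \<and> m \<le> int k
      then orbit_basis (perm_orbit (replicate (nat m) 1 @ replicate (k - nat m) 0)) else 0)"

text \<open>In the alternating sum every factor on the right is zero or a special orbit, so multiplication by
  it in the new product is multiplication in \<^const>\<open>cross\<close>; this resolves the recursion.\<close>

definition dot_basis :: "nat \<Rightarrow> nat \<Rightarrow> nat list set \<Rightarrow> nat list set \<Rightarrow> orbit_vec" where
  "dot_basis N k a b =
     (if b \<in> special_orbits N k then cross_basis N k a b
      else \<Sum>\<sigma> | \<sigma> permutes {1..N - 1}.
        orbit_scale (of_int (sign \<sigma>))
          (foldl (\<lambda>u i. cross N k u (h_orbit k (int (conj_part N b i) - int i + int (\<sigma> i))))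
             (orbit_basis a) [1..<N]))"

definition dot :: "nat \<Rightarrow> nat \<Rightarrow> orbit_vec \<Rightarrow> orbit_vec \<Rightarrow> orbit_vec" where
  "dot N k = bilinear_ext (dot_basis N k)"

definition orbit_algebra :: "nat \<Rightarrow> nat \<Rightarrow> (rat, orbit_vec) module" where
  "orbit_algebra N k =
     \<lparr>carrier = {v. Poly_Mapping.keys v \<subseteq> orbits N k},
      monoid.mult = dot N k, one = orbit_basis (perm_orbit (replicate k 0)),
      ring.zero = 0, add = (+), module.smult = orbit_scale\<rparr>"


section \<open>The fusion algebra\<close>

text \<open>Polynomials are finitely supported functions on exponent vectors; the variables are indexed
  by 1, ..., N.\<close>

type_synonym rat_mpoly = "(nat \<Rightarrow>\<^sub>0 nat) \<Rightarrow>\<^sub>0 rat"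

definition symmetric_polys :: "nat \<Rightarrow> rat_mpoly set" where
  "symmetric_polys N =
     {p. (\<forall>m\<in>Poly_Mapping.keys p. Poly_Mapping.keys m \<subseteq> {1..N}) \<and>
         (\<forall>\<sigma>. \<sigma> permutes {1..N} \<longrightarrow>
            (\<forall>m. Poly_Mapping.lookup p (Poly_Mapping.map_key \<sigma> m) = Poly_Mapping.lookup p m))}"

definition sym_ring :: "nat \<Rightarrow> (rat, rat_mpoly) module" where
  "sym_ring N =
     \<lparr>carrier = symmetric_polys N, monoid.mult = (*), one = 1, ring.zero = 0, add = (+),
      module.smult = (\<lambda>r p. Poly_Mapping.single 0 r * p)\<rparr>"

definition complete_hom :: "nat \<Rightarrow> int \<Rightarrow> rat_mpoly" where
  "complete_hom N n =
     (\<Sum>m | Poly_Mapping.keys m \<subseteq> {1..N} \<and> int (\<Sum>i\<in>{1..N}. Poly_Mapping.lookup m i) = n.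
        Poly_Mapping.single m 1)"

text \<open>Partitions of length at most N are weakly decreasing lists of length exactly N, padded by zeros.
  The indices of \<^const>\<open>mat\<close> and of lists start from 0, which leaves the differences j - i
  in the Jacobi--Trudi matrix unchanged.\<close>

definition schur :: "nat \<Rightarrow> nat list \<Rightarrow> rat_mpoly" where
  "schur N \<mu> = det (mat N N (\<lambda>(i, j). complete_hom N (int (\<mu> ! i) - int i + int j)))"

definition fusion_ideal :: "nat \<Rightarrow> nat \<Rightarrow> rat_mpoly set" where
  "fusion_ideal N k =
     Idl\<^bsub>sym_ring N\<^esub> (insert (schur N (replicate N 1) - 1)
       {schur N \<mu> | \<mu>. length \<mu> = N \<and> sorted_wrt (\<ge>) \<mu> \<and> \<mu> ! 0 = \<mu> ! (N - 1) + (k + 1)})"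

definition fusion_class :: "nat \<Rightarrow> nat \<Rightarrow> rat_mpoly \<Rightarrow> rat_mpoly set" where
  "fusion_class N k p = fusion_ideal N k +>\<^bsub>sym_ring N\<^esub> p"

definition fusion_algebra :: "nat \<Rightarrow> nat \<Rightarrow> (rat, rat_mpoly set) module" where
  "fusion_algebra N k =
     ring.extend (sym_ring N Quot fusion_ideal N k)
       (module.fields (\<lambda>r C. \<Union>p\<in>C. fusion_class N k (r \<odot>\<^bsub>sym_ring N\<^esub> p)))"

end

theory Submission
  imports Defs "HOL-Computational_Algebra.Formal_Power_Series"
begin

text \<open>
  An orbit is the same thing as a multiset \<open>A\<close> of \<open>k\<close> residues below \<open>N\<close>, and hence as a partition \<open>\<lambda>\<close>
  in an \<open>(N - 1) \<times> k\<close> box: \<open>\<lambda>\<^sub>i\<close> counts the elements of \<open>A\<close> that are at least \<open>i\<close>. The linear map of the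
  theorem sends \<open>A\<close> to the class of the Schur polynomial of \<open>\<lambda>\<close>, here \<open>box_schur A\<close>. It is enough to show
  that this map is bijective and multiplicative; associativity of the new product then comes
  from the quotient ring.

  Everything about Schur polynomials follows from one identity. For a symmetric polynomial \<open>p\<close> and an
  arbitrary exponent vector \<open>g\<close>, let \<open>T g\<close> be the Jacobi--Trudi determinant of \<open>g - \<rho>\<close>. Then
  \<open>p * T g\<close> is the sum of \<open>p\<^sub>b * T (g + b)\<close> over the monomials \<open>x\<^sup>b\<close> of \<open>p\<close>
  (\<open>symmetric_mult_jacobi_trudi\<close>): \<open>T g\<close> is a quotient of alternants, and for alternants
  the identity is immediate from the symmetry of \<open>p\<close>.

  Multiplicativity. Applied to an elementary symmetric polynomial the identity has no cancellation:
  modulo the fusion ideal, multiplication by \<open>e\<^sub>r\<close> raises \<open>r\<close> coordinates with distinct values by one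
  (\<open>elementary_pieri\<close>). The rule for complete symmetric polynomials does involve cancellation, but
  it is forced by \<open>\<Sum> (-1)\<^sup>r e\<^sub>r h\<^sub>m\<^sub>-\<^sub>r = 0\<close>. The corresponding alternating sum
  over orbits vanishes for \<open>0 < m < N + k\<close>, since for a prescribed number of raised coordinates in
  each class the signs cancel class by class (\<open>alternating_moves_cancel\<close>). Hence multiplication by
  \<open>h\<^sub>m\<close> is the orbit product with \<open>[1\<^sup>m 0\<^sup>k\<^sup>-\<^sup>m]\<close> (\<open>complete_pieri\<close>), in particular \<open>h\<^sub>m\<close> lies in the ideal
  for \<open>k < m < N + k\<close>, and \<open>h\<^sub>k\<close> acts by adding \<open>1\<close> to all coordinates, which gives the remaining special
  orbits. For all other orbits the new product is the Jacobi--Trudi determinant by definition.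

  Surjectivity. By the identity with \<open>g = \<rho>\<close> the symmetric polynomials are generated by the \<open>h\<^sub>m\<close>,
  hence by the \<open>e\<^sub>r\<close>, and \<open>elementary_pieri\<close> shows that the span of the \<open>box_schur A\<close> is stable under
  the \<open>e\<^sub>r\<close> modulo the ideal.

  Injectivity. Exponent vectors are considered up to the affine Weyl group of level \<open>N + k\<close> and up to
  the diagonal translation; antisymmetrising the indicator function of one class gives a linear
  functional on alternants. It kills the fusion ideal (\<open>J_annihilated\<close>), and these functionals are
  dual to the polynomials \<open>box_schur A\<close> (\<open>chi_shifted\<close>).
\<close>

section \<open>Alternants and Jacobi--Trudi determinants\<close>

text \<open>Variables and parts of partitions are numbered from 1 but rows and columns of matrices
  from 0; conjugation with \<^const>\<open>Suc\<close> translates the Leibniz formula.\<close>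

lemma det_eq_sum_permutations_from_1:
  fixes f :: "nat \<Rightarrow> nat \<Rightarrow> 'a :: comm_ring_1"
  shows "det (mat n n (\<lambda>(i, j). f (i + 1) (j + 1))) =
    (\<Sum>w | w permutes {1..n}. of_int (sign w) * (\<Prod>i\<in>{1..n}. f i (w i)))"
proof -
  define F where "F = (\<lambda>p. map_permutation {0..<n} Suc p)"
  define G where "G = (\<lambda>p. map_permutation {1..n} (\<lambda>i. i - 1) p)"
  have b1: "bij_betw Suc {0..<n} {1..n}"
    by (auto simp: bij_betw_def image_Suc_atLeastLessThan)
  have b2: "bij_betw (\<lambda>i. i - 1) {1..n} {0..<n}"
    by (rule bij_betw_byWitness[where f' = Suc]) auto
  have "det (mat n n (\<lambda>(i, j). f (i + 1) (j + 1))) =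
      (\<Sum>p | p permutes {0..<n}. of_int (sign p) * (\<Prod>i = 0..<n. f (i + 1) (p i + 1)))"
  proof -
    have "mat n n (\<lambda>(i, j). f (i + 1) (j + 1)) $$ (i, p i) = f (i + 1) (p i + 1)"
      if "p permutes {0..<n}" "i \<in> {0..<n}" for p i
      using that permutes_in_image[OF that(1), of i] by simp
    then show ?thesis unfolding det_def by (auto intro!: sum.cong prod.cong)
  qed
  also have "\<dots> = (\<Sum>w | w permutes {1..n}. of_int (sign w) * (\<Prod>i\<in>{1..n}. f i (w i)))"
  proof (rule sum.reindex_bij_witness[where i = G and j = F])
    fix p assume p: "p \<in> {p. p permutes {0..<n}}"
    then have p: "p permutes {0..<n}" by simp
    show "G (F p) = p" unfolding F_def G_def
      by (rule map_permutation_compose_inv[OF b1 p]) simp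
    show "F p \<in> {w. w permutes {1..n}}"
      using map_permutation_permutes[OF b1 p] by (simp add: F_def)
    have s: "sign (F p) = sign p" unfolding F_def by (rule sign_map_permutation) (use p in auto)
    have "(\<Prod>i\<in>{1..n}. f i (F p i)) = (\<Prod>i = 0..<n. f (Suc i) (F p (Suc i)))"
      by (rule prod.reindex_bij_betw[OF b1, symmetric])
    also have "\<dots> = (\<Prod>i = 0..<n. f (i + 1) (p i + 1))"
      by (rule prod.cong) (auto simp: F_def map_permutation_apply)
    finally show "of_int (sign (F p)) * (\<Prod>i\<in>{1..n}. f i (F p i)) =
        of_int (sign p) * (\<Prod>i = 0..<n. f (i + 1) (p i + 1))" using s by simp
  next
    fix w assume "w \<in> {w. w permutes {1..n}}"
    then have w: "w permutes {1..n}" by simp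
    show "F (G w) = w" unfolding F_def G_def
      by (rule map_permutation_compose_inv[OF b2 w]) simp
    show "G w \<in> {p. p permutes {0..<n}}"
      using map_permutation_permutes[OF b2 w] by (simp add: G_def)
  qed
  finally show ?thesis .
qed

abbreviation xpow :: "(nat \<Rightarrow>\<^sub>0 nat) \<Rightarrow> rat_mpoly" where
  "xpow m \<equiv> Poly_Mapping.single m 1"

definition expo :: "nat \<Rightarrow> (nat \<Rightarrow> nat) \<Rightarrow> (nat \<Rightarrow>\<^sub>0 nat)" where
  "expo N g = (\<Sum>i\<in>{1..N}. Poly_Mapping.single i (g i))"

abbreviation xvar :: "nat \<Rightarrow> rat_mpoly" where
  "xvar i \<equiv> xpow (Poly_Mapping.single i (Suc 0))"

lemma lookup_expo: "Poly_Mapping.lookup (expo N g) i = (if i \<in> {1..N} then g i else 0)"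
  unfolding expo_def lookup_sum lookup_single when_def by (subst sum.delta) auto

lemma lookup_expo_inside [simp]: "i \<in> {1..N} \<Longrightarrow> Poly_Mapping.lookup (expo N g) i = g i"
  by (simp add: lookup_expo)

lemma expo_cong: "(\<And>i. i \<in> {1..N} \<Longrightarrow> g i = g' i) \<Longrightarrow> expo N g = expo N g'"
  by (rule poly_mapping_eqI) (auto simp: lookup_expo)

lemma expo_lookup: "Poly_Mapping.keys m \<subseteq> {1..N} \<Longrightarrow> expo N (Poly_Mapping.lookup m) = m"
  by (rule poly_mapping_eqI) (auto simp: lookup_expo in_keys_iff subset_iff)

lemma expo_add: "expo N g + expo N g' = expo N (\<lambda>i. g i + g' i)"
  by (rule poly_mapping_eqI) (auto simp: lookup_expo lookup_add)

lemma keys_expo: "Poly_Mapping.keys (expo N g) \<subseteq> {1..N}"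
  by (auto simp: in_keys_iff lookup_expo split: if_splits)

lemma lookup_map_key: "inj f \<Longrightarrow> Poly_Mapping.lookup (Poly_Mapping.map_key f p) i = Poly_Mapping.lookup p (f i)"
  by (simp add: map_key.rep_eq)

lemma map_key_expo:
  assumes "w permutes {1..N}"
  shows "Poly_Mapping.map_key w (expo N g) = expo N (g \<circ> w)"
  by (rule poly_mapping_eqI)
    (simp add: lookup_map_key permutes_inj[OF assms] lookup_expo permutes_in_image[OF assms]
      del: atLeastAtMost_iff One_nat_def)

lemma monom_mult: "xpow a * xpow b = xpow (a + b)"
  by (simp add: mult_single)

lemma var_power: "xvar i ^ n = xpow (Poly_Mapping.single i n)"
  by (induction n) (simp_all add: monom_mult single_add[symmetric])

lemma prod_monom: "finite A \<Longrightarrow> (\<Prod>i\<in>A. xpow (f i)) = xpow (\<Sum>i\<in>A. f i)"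
  by (induction rule: finite_induct) (simp_all add: monom_mult)

lemma prod_var_power: "(\<Prod>i\<in>{1..N}. xvar i ^ g i) = xpow (expo N g)"
  by (simp add: var_power prod_monom expo_def)

definition alternant :: "nat \<Rightarrow> (nat \<Rightarrow> nat) \<Rightarrow> rat_mpoly" where
  "alternant N g = (\<Sum>w | w permutes {1..N}. of_int (sign w) * xpow (expo N (g \<circ> w)))"

lemma alternant_det:
  "alternant N g = det (mat N N (\<lambda>(l, i). xvar (l + 1) ^ g (i + 1)))"
  unfolding alternant_def det_eq_sum_permutations_from_1[where f = "\<lambda>l i. xvar l ^ g i"]
  using prod_var_power[of _ N] by (simp add: o_def)

text \<open>Complete symmetric polynomials over an arbitrary finite set of variables, so that variables can be
  removed one at a time.\<close>

definition exponents :: "nat set \<Rightarrow> nat \<Rightarrow> (nat \<Rightarrow>\<^sub>0 nat) set" where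
  "exponents S n = {m. Poly_Mapping.keys m \<subseteq> S \<and> (\<Sum>i\<in>S. Poly_Mapping.lookup m i) = n}"

definition complete :: "nat set \<Rightarrow> nat \<Rightarrow> rat_mpoly" where
  "complete S n = (\<Sum>m\<in>exponents S n. xpow m)"

lemma exponents_empty: "exponents {} n = (if n = 0 then {0} else {})"
  by (auto simp: exponents_def)

lemma exponents_insert:
  assumes "finite S" "l \<notin> S"
  shows "exponents (insert l S) n = (\<Union>j\<in>{0..n}. (\<lambda>m. Poly_Mapping.single l j + m) ` exponents S (n - j))"
    (is "?L = ?R")
proof (intro equalityI subsetI)
  fix m assume m: "m \<in> ?L"
  define m' where "m' = Poly_Mapping.update l 0 m"
  have look: "Poly_Mapping.lookup m' i = (if i = l then 0 else Poly_Mapping.lookup m i)" for i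
    by (simp add: m'_def lookup_update)
  have tot: "Poly_Mapping.lookup m l + (\<Sum>i\<in>S. Poly_Mapping.lookup m i) = n"
    using m assms by (simp add: exponents_def)
  have s: "(\<Sum>i\<in>S. Poly_Mapping.lookup m' i) = (\<Sum>i\<in>S. Poly_Mapping.lookup m i)"
    using assms by (intro sum.cong) (auto simp: look)
  have "m' \<in> exponents S (n - Poly_Mapping.lookup m l)"
    using m tot s by (auto simp: exponents_def m'_def keys_update)
  moreover have "m = Poly_Mapping.single l (Poly_Mapping.lookup m l) + m'"
    by (rule poly_mapping_eqI) (auto simp: lookup_add lookup_single look when_def)
  ultimately show "m \<in> ?R" using tot by (intro UN_I[of "Poly_Mapping.lookup m l"]) auto
next
  fix m assume "m \<in> ?R"
  then obtain j m' where j: "j \<le> n" and m': "m' \<in> exponents S (n - j)"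
    and m: "m = Poly_Mapping.single l j + m'" by auto
  have l: "Poly_Mapping.lookup m' l = 0" using m' assms by (auto simp: exponents_def in_keys_iff)
  have "Poly_Mapping.keys m \<subseteq> insert l S"
    using keys_add[of "Poly_Mapping.single l j" m'] m' by (auto simp: m exponents_def split: if_splits)
  moreover have "(\<Sum>i\<in>S. Poly_Mapping.lookup m i) = (\<Sum>i\<in>S. Poly_Mapping.lookup m' i)"
    using assms by (intro sum.cong) (auto simp: m lookup_add lookup_single when_def)
  ultimately show "m \<in> ?L" using m' j assms l
    by (auto simp: exponents_def m lookup_add)
qed

lemma finite_exponents: "finite S \<Longrightarrow> finite (exponents S n)"
proof (induction arbitrary: n rule: finite_induct)
  case empty show ?case by (simp add: exponents_empty)
next
  case (insert l S) then show ?case by (simp add: exponents_insert)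
qed

lemma complete_insert:
  assumes "finite S" "l \<notin> S"
  shows "complete (insert l S) n = (\<Sum>j=0..n. xvar l ^ j * complete S (n - j))"
proof -
  have l: "Poly_Mapping.lookup m l = 0" if "m \<in> exponents S k" for m k
    using that assms by (auto simp: exponents_def in_keys_iff)
  have inj: "inj_on (\<lambda>m. Poly_Mapping.single l j + m) A" for j :: nat and A
    by (rule inj_onI) simp
  have disj: "(\<lambda>m. Poly_Mapping.single l i + m) ` exponents S (n - i) \<inter>
      (\<lambda>m. Poly_Mapping.single l j + m) ` exponents S (n - j) = {}" if "i \<noteq> j" for i j
  proof (rule ccontr)
    assume "\<not> ?thesis"
    then obtain a b where ab: "a \<in> exponents S (n - i)" "b \<in> exponents S (n - j)"
      "Poly_Mapping.single l i + a = Poly_Mapping.single l j + b" by auto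
    then have "Poly_Mapping.lookup (Poly_Mapping.single l i + a) l = Poly_Mapping.lookup (Poly_Mapping.single l j + b) l" by simp
    then show False using l[OF ab(1)] l[OF ab(2)] that by (simp add: lookup_add)
  qed
  have "complete (insert l S) n = (\<Sum>j=0..n. \<Sum>m\<in>(\<lambda>m. Poly_Mapping.single l j + m) ` exponents S (n - j). xpow m)"
    unfolding complete_def exponents_insert[OF assms]
    by (rule sum.UNION_disjoint) (use disj finite_exponents[OF assms(1)] in auto)
  also have "\<dots> = (\<Sum>j=0..n. xvar l ^ j * complete S (n - j))"
    by (intro sum.cong refl)
      (simp add: sum.reindex[OF inj] complete_def sum_distrib_left var_power monom_mult)
  finally show ?thesis .
qed

definition geom :: "'a::comm_ring_1 \<Rightarrow> 'a fps" where
  "geom x = Abs_fps (\<lambda>j. x ^ j)"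

lemma geom_inverse: "geom x * (1 - fps_const x * fps_X) = 1"
proof -
  have "geom x * (1 - fps_const x * fps_X) = geom x - fps_const x * (fps_X * geom x)"
    by (simp add: algebra_simps)
  also have "\<dots> = 1"
  proof (rule fps_ext)
    fix n show "fps_nth (geom x - fps_const x * (fps_X * geom x)) n = fps_nth 1 n"
      by (cases n) (simp_all add: geom_def)
  qed
  finally show ?thesis .
qed

definition complete_gf :: "nat set \<Rightarrow> rat_mpoly fps" where
  "complete_gf S = Abs_fps (complete S)"

definition elem_gf :: "nat set \<Rightarrow> rat_mpoly fps" where
  "elem_gf S = (\<Prod>i\<in>S. 1 - fps_const (xvar i) * fps_X)"

lemma complete_gf_insert: "finite S \<Longrightarrow> l \<notin> S \<Longrightarrow> complete_gf (insert l S) = geom (xvar l) * complete_gf S"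
  by (rule fps_ext) (simp add: complete_gf_def geom_def fps_mult_nth complete_insert)

lemma complete_gf_elem_gf: "finite S \<Longrightarrow> complete_gf S * elem_gf S = 1"
proof (induction rule: finite_induct)
  case empty
  have "complete_gf {} = 1" by (rule fps_ext) (simp add: complete_gf_def complete_def exponents_empty)
  then show ?case by (simp add: elem_gf_def)
next
  case (insert l S)
  have "complete_gf (insert l S) * elem_gf (insert l S) =
     (geom (xvar l) * (1 - fps_const (xvar l) * fps_X)) * (complete_gf S * elem_gf S)"
    using insert by (simp add: complete_gf_insert elem_gf_def mult_ac)
  then show ?case using insert by (simp add: geom_inverse)
qed

definition elem_sym :: "nat set \<Rightarrow> nat \<Rightarrow> rat_mpoly" where
  "elem_sym S r = (\<Sum>R | R \<subseteq> S \<and> card R = r. xpow (\<Sum>i\<in>R. Poly_Mapping.single i (Suc 0)))"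

lemma elem_gf_nth:
  assumes "finite S"
  shows "fps_nth (elem_gf S) r = (- 1) ^ r * elem_sym S r"
proof -
  have "elem_gf S = (\<Prod>i\<in>S. (- (fps_const (xvar i) * fps_X)) + 1)"
    by (simp add: elem_gf_def)
  also have "\<dots> = (\<Sum>R\<in>Pow S. (\<Prod>i\<in>R. - (fps_const (xvar i) * fps_X)) * (\<Prod>i\<in>S - R. 1))"
    by (rule prod_add[OF assms])
  also have "\<dots> = (\<Sum>R\<in>Pow S. fps_const ((- 1) ^ card R * xpow (\<Sum>i\<in>R. Poly_Mapping.single i (Suc 0))) * fps_X ^ card R)"
  proof (intro sum.cong refl)
    fix R assume "R \<in> Pow S"
    then have fin: "finite R" using assms finite_subset by auto
    have "(\<Prod>i\<in>R. - (fps_const (xvar i) * fps_X)) = (\<Prod>i\<in>R. fps_const (- xvar i) * fps_X)"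
      by (intro prod.cong refl) (metis fps_const_neg mult_minus_left)
    also have "\<dots> = (\<Prod>i\<in>R. fps_const (- xvar i)) * fps_X ^ card R"
      by (simp add: prod.distrib)
    also have "(\<Prod>i\<in>R. fps_const (- xvar i)) = fps_const (\<Prod>i\<in>R. - xvar i)"
      using fin by (induction rule: finite_induct) simp_all
    also have "(\<Prod>i\<in>R. - xvar i) = (- 1) ^ card R * xpow (\<Sum>i\<in>R. Poly_Mapping.single i (Suc 0))"
      using fin by (simp add: prod_uminus prod_monom)
    finally show "(\<Prod>i\<in>R. - (fps_const (xvar i) * fps_X)) * (\<Prod>i\<in>S - R. 1) =
      fps_const ((- 1) ^ card R * xpow (\<Sum>i\<in>R. Poly_Mapping.single i (Suc 0))) * fps_X ^ card R" by simp
  qed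
  finally have "fps_nth (elem_gf S) r = (\<Sum>R\<in>Pow S. if card R = r then (- 1) ^ r * xpow (\<Sum>i\<in>R. Poly_Mapping.single i (Suc 0)) else 0)"
    by (auto simp: fps_sum_nth fps_X_power_iff intro!: sum.cong)
  also have "\<dots> = (\<Sum>R\<in>{R\<in>Pow S. card R = r}. (- 1) ^ r * xpow (\<Sum>i\<in>R. Poly_Mapping.single i (Suc 0)))"
    by (rule sum.inter_filter[symmetric]) (use assms in auto)
  also have "{R\<in>Pow S. card R = r} = {R. R \<subseteq> S \<and> card R = r}" by auto
  finally show ?thesis by (simp add: elem_sym_def sum_distrib_left)
qed

lemma elem_sym_0: "finite S \<Longrightarrow> elem_sym S 0 = 1"
proof -
  assume "finite S"
  then have "{R. R \<subseteq> S \<and> card R = 0} = {{}}" using finite_subset by fastforce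
  then show ?thesis unfolding elem_sym_def by simp
qed

lemma elem_sym_eq_0: "finite S \<Longrightarrow> r > card S \<Longrightarrow> elem_sym S r = 0"
  unfolding elem_sym_def by (rule sum.neutral) (use card_mono leD in blast)

lemma complete_hom_nat: "complete_hom N (int n) = complete {1..N} n"
  unfolding complete_hom_def complete_def exponents_def by (simp only: of_nat_eq_iff)

lemma complete_hom_diff: "s \<le> g \<Longrightarrow> complete_hom N (int g - int s) = complete {1..N} (g - s)"
  using complete_hom_nat[of N "g - s"] by (simp add: of_nat_diff)

lemma complete_hom_neg: "n < 0 \<Longrightarrow> complete_hom N n = 0"
  unfolding complete_hom_def
  by (rule sum.neutral) (metis (mono_tags, lifting) mem_Collect_eq negative_zless_0 not_less of_nat_0_le_iff)

lemma complete_hom_0: "complete_hom N 0 = 1"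
proof -
  have "fps_nth (complete_gf {1..N} * elem_gf {1..N}) 0 = 1" by (simp add: complete_gf_elem_gf)
  then have "complete {1..N} 0 * elem_sym {1..N} 0 = 1" by (simp add: complete_gf_def elem_gf_nth)
  then show ?thesis using complete_hom_nat[of N 0] by (simp add: elem_sym_0)
qed

lemma elem_complete_alternating:
  assumes "m > 0"
  shows "(\<Sum>r=0..m. (- 1) ^ r * elem_sym {1..N} r * complete_hom N (int m - int r)) = 0"
proof -
  have "fps_nth (elem_gf {1..N} * complete_gf {1..N}) m = 0"
    using assms by (subst mult.commute) (simp add: complete_gf_elem_gf)
  then show ?thesis
    by (simp add: fps_mult_nth elem_gf_nth complete_gf_def complete_hom_diff del: One_nat_def)
qed

text \<open>Leaving the factor of one variable out of the product of all \<open>1 - x\<^sub>i t\<close> turns the inverse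
  relation between the two generating functions into the geometric series in \<open>x\<^sub>l t\<close>. The coefficients
  of the shortened product do not depend on \<open>g\<close>, so this is one row of a matrix factorisation of the
  alternant.\<close>

lemma var_power_via_complete:
  assumes "l \<in> {1..N}"
  shows "xvar l ^ g = (\<Sum>j\<in>{0..<N}. fps_nth (elem_gf ({1..N} - {l})) (N - 1 - j) * complete_hom N (int g - int N + 1 + int j))"
proof -
  let ?P = "elem_gf ({1..N} - {l})"
  have "complete_gf {1..N} = geom (xvar l) * complete_gf ({1..N} - {l})"
    using complete_gf_insert[of "{1..N} - {l}" l] assms by (simp add: insert_absorb)
  then have "?P * complete_gf {1..N} = geom (xvar l)"
    using complete_gf_elem_gf[of "{1..N} - {l}"] by (simp add: mult_ac)
  then have "xvar l ^ g = fps_nth (?P * complete_gf {1..N}) g" by (simp add: geom_def)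
  also have "\<dots> = (\<Sum>s=0..g. fps_nth ?P s * complete_hom N (int g - int s))"
    by (simp add: fps_mult_nth complete_gf_def complete_hom_diff del: One_nat_def)
  also have "\<dots> = (\<Sum>s\<in>{0..g + N}. fps_nth ?P s * complete_hom N (int g - int s))"
    by (rule sum.mono_neutral_left) (auto simp: complete_hom_neg)
  also have "\<dots> = (\<Sum>s\<in>{0..<N}. fps_nth ?P s * complete_hom N (int g - int s))"
  proof (rule sum.mono_neutral_right, goal_cases)
    case 3
    have "card ({1..N} - {l}) < N" using assms by (simp add: card_Diff_singleton)
    then show ?case by (auto simp: elem_gf_nth elem_sym_eq_0)
  qed auto
  also have "\<dots> = (\<Sum>j\<in>{0..<N}. fps_nth ?P (N - 1 - j) * complete_hom N (int g - int N + 1 + int j))"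
    by (rule sum.reindex_bij_witness[where i = "\<lambda>j. N - 1 - j" and j = "\<lambda>j. N - 1 - j"])
      (auto simp: of_nat_diff algebra_simps)
  finally show ?thesis .
qed

text \<open>The argument is the exponent vector \<open>\<mu> + \<rho>\<close> and not the partition: permuting it
  only changes the sign, and it need neither be decreasing nor come from a partition.\<close>

definition jacobi_trudi :: "nat \<Rightarrow> (nat \<Rightarrow> nat) \<Rightarrow> rat_mpoly" where
  "jacobi_trudi N g = det (mat N N (\<lambda>(i, j). complete_hom N (int (g (i + 1)) - int N + 1 + int j)))"

definition rho :: "nat \<Rightarrow> nat \<Rightarrow> nat" where
  "rho N i = N - i"

lemma jacobi_trudi_cong: "(\<And>i. i \<in> {1..N} \<Longrightarrow> g i = g' i) \<Longrightarrow> jacobi_trudi N g = jacobi_trudi N g'"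
  unfolding jacobi_trudi_def by (intro arg_cong[where f = det] cong_mat) auto

lemma schur_jacobi_trudi: "schur N \<mu> = jacobi_trudi N (\<lambda>i. \<mu> ! (i - 1) + rho N i)"
  unfolding schur_def jacobi_trudi_def rho_def
  by (intro arg_cong[where f = det] cong_mat) (auto simp: of_nat_diff algebra_simps)

lemma jacobi_trudi_rho: "jacobi_trudi N (rho N) = 1"
proof -
  let ?A = "mat N N (\<lambda>(i, j). complete_hom N (int (rho N (i + 1)) - int N + 1 + int j))"
  have "det ?A = prod_list (diag_mat ?A)"
    by (rule det_upper_triangular) (auto simp: upper_triangular_def rho_def of_nat_diff complete_hom_neg)
  also have "diag_mat ?A = map (\<lambda>i. 1) [0..<N]"
    unfolding diag_mat_def by (auto simp: rho_def of_nat_diff complete_hom_0)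
  also have "prod_list \<dots> = 1" by (simp add: map_replicate_const)
  finally show ?thesis by (simp add: jacobi_trudi_def)
qed

lemma jacobi_trudi_repeated:
  assumes "i \<in> {1..N}" "j \<in> {1..N}" "i \<noteq> j" "g i = g j"
  shows "jacobi_trudi N g = 0"
  unfolding jacobi_trudi_def
  by (rule det_identical_rows[of _ N "i - 1" "j - 1"]) (use assms in \<open>auto simp: row_def intro!: eq_vecI\<close>)

text \<open>By \<open>var_power_via_complete\<close> the matrix of the alternant is a matrix independent of \<open>g\<close> times the
  transposed Jacobi--Trudi matrix. For \<open>g = \<rho>\<close> the latter is unitriangular, so the determinant of the
  first factor is the Vandermonde alternant.\<close>

lemma jacobi_trudi_alternant: "jacobi_trudi N g * alternant N (rho N) = alternant N g"
proof -
  define M where "M = mat N N (\<lambda>(l, j). fps_nth (elem_gf ({1..N} - {l + 1})) (N - 1 - j))"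
  define A where "A = (\<lambda>g :: nat \<Rightarrow> nat. mat N N (\<lambda>(i, j). complete_hom N (int (g (i + 1)) - int N + 1 + int j)))"
  have alt: "alternant N g = det M * jacobi_trudi N g" for g
  proof -
    have "mat N N (\<lambda>(l, i). xvar (l + 1) ^ g (i + 1)) = M * transpose_mat (A g)"
    proof (rule eq_matI)
      fix l i assume "l < dim_row (M * transpose_mat (A g))" "i < dim_col (M * transpose_mat (A g))"
      then have li: "l < N" "i < N" by (auto simp: M_def A_def)
      then have "xvar (l + 1) ^ g (i + 1) = (\<Sum>j\<in>{0..<N}. fps_nth (elem_gf ({1..N} - {l + 1})) (N - 1 - j) *
          complete_hom N (int (g (i + 1)) - int N + 1 + int j))"
        by (intro var_power_via_complete) auto
      then show "mat N N (\<lambda>(l, i). xvar (l + 1) ^ g (i + 1)) $$ (l, i) = (M * transpose_mat (A g)) $$ (l, i)"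
        using li by (simp add: M_def A_def scalar_prod_def)
    qed (auto simp: M_def A_def)
    then have "alternant N g = det M * det (transpose_mat (A g))"
      unfolding alternant_det by (simp add: det_mult[of _ N] M_def A_def)
    also have "det (transpose_mat (A g)) = jacobi_trudi N g"
      by (subst det_transpose[of _ N]) (auto simp: A_def jacobi_trudi_def)
    finally show ?thesis .
  qed
  show ?thesis using alt[of "rho N"] alt[of g] by (simp add: jacobi_trudi_rho mult.commute)
qed

section \<open>Symmetric polynomials acting on Jacobi--Trudi determinants\<close>

abbreviation cst :: "rat \<Rightarrow> rat_mpoly" where
  "cst c \<equiv> Poly_Mapping.single 0 c"

lemma poly_mapping_sum_single:
  "p = (\<Sum>b\<in>Poly_Mapping.keys p. Poly_Mapping.single b (Poly_Mapping.lookup p b))"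
proof (rule poly_mapping_eqI)
  fix k
  have "(\<Sum>b\<in>Poly_Mapping.keys p. Poly_Mapping.lookup (Poly_Mapping.single b (Poly_Mapping.lookup p b)) k) =
     (\<Sum>b\<in>Poly_Mapping.keys p. if b = k then Poly_Mapping.lookup p b else 0)"
    by (rule sum.cong) (auto simp: lookup_single when_def)
  also have "\<dots> = Poly_Mapping.lookup p k"
    by (subst sum.delta) (auto simp: in_keys_iff)
  finally show "Poly_Mapping.lookup p k = Poly_Mapping.lookup (\<Sum>b\<in>Poly_Mapping.keys p. Poly_Mapping.single b (Poly_Mapping.lookup p b)) k"
    by (simp add: lookup_sum)
qed

lemma map_key_permutes_add:
  "w permutes S \<Longrightarrow> Poly_Mapping.map_key w (a + b) = Poly_Mapping.map_key w a + Poly_Mapping.map_key w b"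
  by (simp add: map_key_plus permutes_inj)

lemma map_key_permutes_inv:
  assumes "w permutes S"
  shows "Poly_Mapping.map_key w (Poly_Mapping.map_key (inv_into UNIV w) m) = m"
    "Poly_Mapping.map_key (inv_into UNIV w) (Poly_Mapping.map_key w m) = m"
  using permutes_inj[OF assms] permutes_inj[OF permutes_inv[OF assms]]
  by (auto intro!: poly_mapping_eqI simp: lookup_map_key permutes_inverses[OF assms])

lemma map_key_permutes_eq_iff:
  assumes "w permutes S"
  shows "Poly_Mapping.map_key w a = Poly_Mapping.map_key w b \<longleftrightarrow> a = b"
  using map_key_permutes_inv(2)[OF assms] by metis

lemma symmetric_polysD:
  assumes "p \<in> symmetric_polys N"
  shows "m \<in> Poly_Mapping.keys p \<Longrightarrow> Poly_Mapping.keys m \<subseteq> {1..N}"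
    and "w permutes {1..N} \<Longrightarrow> Poly_Mapping.lookup p (Poly_Mapping.map_key w m) = Poly_Mapping.lookup p m"
  using assms unfolding symmetric_polys_def by auto

lemma bij_betw_map_key_keys:
  assumes "p \<in> symmetric_polys N" "w permutes {1..N}"
  shows "bij_betw (Poly_Mapping.map_key w) (Poly_Mapping.keys p) (Poly_Mapping.keys p)"
proof (rule bij_betw_byWitness[where f' = "Poly_Mapping.map_key (inv_into UNIV w)"])
  show "Poly_Mapping.map_key w ` Poly_Mapping.keys p \<subseteq> Poly_Mapping.keys p"
    using symmetric_polysD(2)[OF assms] by (auto simp: in_keys_iff)
  show "Poly_Mapping.map_key (inv_into UNIV w) ` Poly_Mapping.keys p \<subseteq> Poly_Mapping.keys p"
    using symmetric_polysD(2)[OF assms(1) permutes_inv[OF assms(2)]] by (auto simp: in_keys_iff)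
qed (auto simp: map_key_permutes_inv[OF assms(2)])

lemma sum_keys_symmetric:
  assumes "p \<in> symmetric_polys N" "w permutes {1..N}"
  shows "(\<Sum>b\<in>Poly_Mapping.keys p. f b (Poly_Mapping.lookup p b)) =
    (\<Sum>b\<in>Poly_Mapping.keys p. f (Poly_Mapping.map_key w b) (Poly_Mapping.lookup p b))"
  using sum.reindex_bij_betw[OF bij_betw_map_key_keys[OF assms], of "\<lambda>b. f b (Poly_Mapping.lookup p b)"]
  by (simp add: symmetric_polysD(2)[OF assms])

text \<open>In the summand of a permutation \<open>w\<close> the monomials of \<open>p\<close> may be renamed by \<open>w\<close>, because \<open>p\<close> is
  symmetric; then \<open>w\<close> acts on the sum of the two exponent vectors.\<close>

lemma symmetric_mult_alternant:
  assumes p: "p \<in> symmetric_polys N"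
  shows "p * alternant N g =
    (\<Sum>b\<in>Poly_Mapping.keys p. cst (Poly_Mapping.lookup p b) * alternant N (\<lambda>i. g i + Poly_Mapping.lookup b i))"
proof -
  have *: "p * xpow (expo N (g \<circ> w)) = (\<Sum>b\<in>Poly_Mapping.keys p. cst (Poly_Mapping.lookup p b) *
      xpow (expo N ((\<lambda>i. g i + Poly_Mapping.lookup b i) \<circ> w)))" if w: "w permutes {1..N}" for w
  proof -
    have "p = (\<Sum>b\<in>Poly_Mapping.keys p. Poly_Mapping.single (Poly_Mapping.map_key w b) (Poly_Mapping.lookup p b))"
      using poly_mapping_sum_single[of p] sum_keys_symmetric[OF p w, of Poly_Mapping.single] by simp
    then have "p * xpow (expo N (g \<circ> w)) = (\<Sum>b\<in>Poly_Mapping.keys p.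
        Poly_Mapping.single (Poly_Mapping.map_key w b) (Poly_Mapping.lookup p b)) * xpow (expo N (g \<circ> w))"
      by simp
    also have "\<dots> = (\<Sum>b\<in>Poly_Mapping.keys p. cst (Poly_Mapping.lookup p b) *
      xpow (expo N ((\<lambda>i. g i + Poly_Mapping.lookup b i) \<circ> w)))"
      unfolding sum_distrib_right
    proof (rule sum.cong[OF refl])
      fix b assume "b \<in> Poly_Mapping.keys p"
      then have "b = expo N (Poly_Mapping.lookup b)"
        using expo_lookup symmetric_polysD(1)[OF p] by metis
      then have "Poly_Mapping.map_key w b = expo N (Poly_Mapping.lookup b \<circ> w)"
        using map_key_expo[OF w] by metis
      then have "Poly_Mapping.map_key w b + expo N (g \<circ> w) = expo N ((\<lambda>i. g i + Poly_Mapping.lookup b i) \<circ> w)"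
        by (simp add: expo_add o_def add.commute)
      then show "Poly_Mapping.single (Poly_Mapping.map_key w b) (Poly_Mapping.lookup p b) * xpow (expo N (g \<circ> w)) =
         cst (Poly_Mapping.lookup p b) * xpow (expo N ((\<lambda>i. g i + Poly_Mapping.lookup b i) \<circ> w))"
        by (simp add: mult_single)
    qed
    finally show ?thesis .
  qed
  have "p * alternant N g = (\<Sum>w | w permutes {1..N}. of_int (sign w) * (p * xpow (expo N (g \<circ> w))))"
    by (simp add: alternant_def sum_distrib_left mult_ac)
  also have "\<dots> = (\<Sum>w | w permutes {1..N}. \<Sum>b\<in>Poly_Mapping.keys p. cst (Poly_Mapping.lookup p b) *
      (of_int (sign w) * xpow (expo N ((\<lambda>i. g i + Poly_Mapping.lookup b i) \<circ> w))))"
    by (intro sum.cong refl) (simp add: * sum_distrib_left mult_ac)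
  also have "\<dots> = (\<Sum>b\<in>Poly_Mapping.keys p. cst (Poly_Mapping.lookup p b) * alternant N (\<lambda>i. g i + Poly_Mapping.lookup b i))"
    by (subst sum.swap) (simp add: alternant_def sum_distrib_left)
  finally show ?thesis .
qed

lemma alternant_rho_nonzero: "alternant N (rho N) \<noteq> 0"
proof -
  have "Poly_Mapping.lookup (alternant N (rho N)) (expo N (rho N)) =
      (\<Sum>w | w permutes {1..N}. of_int (sign w) * (1 when expo N (rho N \<circ> w) = expo N (rho N)))"
    unfolding alternant_def lookup_sum
    by (intro sum.cong refl) (simp add: lookup_single mult_single when_def flip: single_of_int)
  also have "\<dots> = (\<Sum>w | w permutes {1..N}. if w = id then 1 else (0 :: rat))"
  proof (intro sum.cong refl)
    fix w assume "w \<in> {w. w permutes {1..N}}"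
    then have w: "w permutes {1..N}" by simp
    have "w = id" if e: "expo N (rho N \<circ> w) = expo N (rho N)"
    proof
      fix i show "w i = id i"
      proof (cases "i \<in> {1..N}")
        case True
        then have "rho N (w i) = rho N i"
          using arg_cong[OF e, of "\<lambda>m. Poly_Mapping.lookup m i"] by (simp add: lookup_expo)
        moreover have "w i \<in> {1..N}" using True w permutes_in_image by metis
        ultimately show ?thesis using True by (auto simp: rho_def)
      qed (use w in \<open>auto simp: permutes_def\<close>)
    qed
    then show "of_int (sign w) * (1 when expo N (rho N \<circ> w) = expo N (rho N)) = (if w = id then 1 else (0::rat))"
      by (auto simp: when_def)
  qed
  also have "\<dots> = 1" by (subst sum.delta) (auto simp: finite_permutations permutes_id)
  finally show ?thesis by auto
qed

text \<open>All Pieri rules below are instances of this identity, before any cancellation of terms.\<close>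

lemma symmetric_mult_jacobi_trudi:
  assumes p: "p \<in> symmetric_polys N"
  shows "p * jacobi_trudi N g =
    (\<Sum>b\<in>Poly_Mapping.keys p. cst (Poly_Mapping.lookup p b) * jacobi_trudi N (\<lambda>i. g i + Poly_Mapping.lookup b i))"
proof -
  have "(p * jacobi_trudi N g) * alternant N (rho N) = p * alternant N g"
    by (simp add: mult.assoc jacobi_trudi_alternant)
  also have "\<dots> = (\<Sum>b\<in>Poly_Mapping.keys p. cst (Poly_Mapping.lookup p b) * jacobi_trudi N (\<lambda>i. g i + Poly_Mapping.lookup b i))
     * alternant N (rho N)"
    by (simp add: symmetric_mult_alternant[OF p] sum_distrib_right mult.assoc jacobi_trudi_alternant)
  finally show ?thesis using alternant_rho_nonzero[of N] by simp
qed

text \<open>In particular every symmetric polynomial is a polynomial in the complete ones.\<close>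

lemma symmetric_expansion:
  assumes p: "p \<in> symmetric_polys N"
  shows "p = (\<Sum>b\<in>Poly_Mapping.keys p. cst (Poly_Mapping.lookup p b) * jacobi_trudi N (\<lambda>i. rho N i + Poly_Mapping.lookup b i))"
  using symmetric_mult_jacobi_trudi[OF p, of "rho N"] by (simp add: jacobi_trudi_rho)

lemma symmetric_0 [simp]: "0 \<in> symmetric_polys N"
  by (simp add: symmetric_polys_def)

lemma symmetric_cst [simp]: "cst c \<in> symmetric_polys N"
proof -
  have "(0 = Poly_Mapping.map_key w m) = (0 = m)" if "w permutes {1..N}" for w and m :: "nat \<Rightarrow>\<^sub>0 nat"
    using map_key_permutes_eq_iff[OF that, of 0 m] by (simp add: permutes_inj[OF that])
  then show ?thesis unfolding symmetric_polys_def by (auto simp: lookup_single)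
qed

lemma symmetric_1 [simp]: "1 \<in> symmetric_polys N"
  using symmetric_cst[of 1] by simp

lemma symmetric_add: "p \<in> symmetric_polys N \<Longrightarrow> q \<in> symmetric_polys N \<Longrightarrow> p + q \<in> symmetric_polys N"
  unfolding symmetric_polys_def using keys_add[of p q]
  by (simp add: lookup_add del: One_nat_def) (meson UnE subsetD)

lemma symmetric_uminus: "p \<in> symmetric_polys N \<Longrightarrow> - p \<in> symmetric_polys N"
  unfolding symmetric_polys_def by (auto simp: in_keys_iff)

lemma symmetric_diff: "p \<in> symmetric_polys N \<Longrightarrow> q \<in> symmetric_polys N \<Longrightarrow> p - q \<in> symmetric_polys N"
  using symmetric_add[of p N "- q"] symmetric_uminus[of q N] by simp

lemma symmetric_mult:
  assumes p: "p \<in> symmetric_polys N" and q: "q \<in> symmetric_polys N"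
  shows "p * q \<in> symmetric_polys N"
proof -
  have look: "Poly_Mapping.lookup (p * q) m = (\<Sum>a\<in>Poly_Mapping.keys p. \<Sum>b\<in>Poly_Mapping.keys q.
      (Poly_Mapping.lookup p a * Poly_Mapping.lookup q b when a + b = m))" for m
  proof -
    have "p * q = (\<Sum>a\<in>Poly_Mapping.keys p. \<Sum>b\<in>Poly_Mapping.keys q.
      Poly_Mapping.single (a + b) (Poly_Mapping.lookup p a * Poly_Mapping.lookup q b))"
      by (subst (1) poly_mapping_sum_single[of p], subst (1) poly_mapping_sum_single[of q])
        (simp add: sum_product mult_single)
    then show ?thesis by (simp add: lookup_sum lookup_single)
  qed
  have "Poly_Mapping.lookup (p * q) (Poly_Mapping.map_key w m) = Poly_Mapping.lookup (p * q) m"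
    if w: "w permutes {1..N}" for w m
  proof -
    have "Poly_Mapping.lookup (p * q) (Poly_Mapping.map_key w m) =
      (\<Sum>a\<in>Poly_Mapping.keys p. \<Sum>b\<in>Poly_Mapping.keys q. (Poly_Mapping.lookup p a * Poly_Mapping.lookup q b
         when Poly_Mapping.map_key w a + Poly_Mapping.map_key w b = Poly_Mapping.map_key w m))"
      unfolding look
      by (subst sum_keys_symmetric[OF p w], subst sum_keys_symmetric[OF q w]) simp
    then show ?thesis
      by (simp add: look map_key_permutes_add[OF w, symmetric] map_key_permutes_eq_iff[OF w])
  qed
  moreover have "Poly_Mapping.keys m \<subseteq> {1..N}" if m: "m \<in> Poly_Mapping.keys (p * q)" for m
  proof -
    obtain a b where "a \<in> Poly_Mapping.keys p" "b \<in> Poly_Mapping.keys q" "m = a + b"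
      using keys_mult[of p q] m by auto
    then show ?thesis
      using keys_add[of a b] symmetric_polysD(1)[OF p] symmetric_polysD(1)[OF q] by blast
  qed
  ultimately show ?thesis unfolding symmetric_polys_def by blast
qed

lemma symmetric_sum: "(\<And>i. i \<in> A \<Longrightarrow> f i \<in> symmetric_polys N) \<Longrightarrow> sum f A \<in> symmetric_polys N"
  by (induction A rule: infinite_finite_induct) (auto intro: symmetric_add)

lemma symmetric_prod: "(\<And>i. i \<in> A \<Longrightarrow> f i \<in> symmetric_polys N) \<Longrightarrow> prod f A \<in> symmetric_polys N"
  by (induction A rule: infinite_finite_induct) (auto intro: symmetric_mult)

lemma symmetric_of_int [simp]: "of_int z \<in> symmetric_polys N"
  using symmetric_cst[of "of_int z" N] by simp

text \<open>Complete and elementary symmetric polynomials are both sums of all monomials with exponent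
  vectors in a permutation-invariant set.\<close>

lemma sum_xpow_symmetric:
  assumes "finite B" "\<And>m. m \<in> B \<Longrightarrow> Poly_Mapping.keys m \<subseteq> {1..N}"
    and "\<And>m w. m \<in> B \<Longrightarrow> w permutes {1..N} \<Longrightarrow> Poly_Mapping.map_key w m \<in> B"
  shows "(\<Sum>m\<in>B. xpow m) \<in> symmetric_polys N"
    and "Poly_Mapping.lookup (\<Sum>m\<in>B. xpow m) b = (if b \<in> B then 1 else 0)"
    and "Poly_Mapping.keys (\<Sum>m\<in>B. xpow m) = B"
proof -
  have look: "Poly_Mapping.lookup (\<Sum>m\<in>B. xpow m) b = (if b \<in> B then 1 else 0)" for b
    using assms(1) by (simp add: lookup_sum lookup_single when_def)
  show "Poly_Mapping.lookup (\<Sum>m\<in>B. xpow m) b = (if b \<in> B then 1 else 0)" by (rule look)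
  show keys: "Poly_Mapping.keys (\<Sum>m\<in>B. xpow m) = B"
    by (auto simp: in_keys_iff look split: if_splits)
  have "Poly_Mapping.map_key w m \<in> B \<longleftrightarrow> m \<in> B" if "w permutes {1..N}" for w m
    using assms(3)[OF _ that, of m] assms(3)[OF _ permutes_inv[OF that], of "Poly_Mapping.map_key w m"]
    by (auto simp: map_key_permutes_inv[OF that])
  then show "(\<Sum>m\<in>B. xpow m) \<in> symmetric_polys N"
    unfolding symmetric_polys_def using assms(2) by (simp add: look keys del: One_nat_def)
qed

lemma keys_map_key_permutes:
  assumes w: "w permutes S" and "Poly_Mapping.keys m \<subseteq> S"
  shows "Poly_Mapping.keys (Poly_Mapping.map_key w m) \<subseteq> S"
  using assms by (auto simp: keys_map_key[OF permutes_inj[OF w]] permutes_in_image)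

lemma sum_lookup_map_key:
  assumes w: "w permutes S"
  shows "(\<Sum>i\<in>S. Poly_Mapping.lookup (Poly_Mapping.map_key w m) i) = (\<Sum>i\<in>S. Poly_Mapping.lookup m i)"
  using sum.permute[OF w, of "Poly_Mapping.lookup m"]
  by (simp add: lookup_map_key[OF permutes_inj[OF w]] o_def)

lemma symmetric_complete_hom: "complete_hom N n \<in> symmetric_polys N"
proof (cases "n < 0")
  case False
  then have "complete_hom N n = (\<Sum>m\<in>exponents {1..N} (nat n). xpow m)"
    using complete_hom_nat[of N "nat n"] by (simp add: complete_def)
  moreover have "\<dots> \<in> symmetric_polys N"
    by (rule sum_xpow_symmetric) 
       (auto simp: exponents_def keys_map_key_permutes sum_lookup_map_key finite_exponents[unfolded exponents_def] simp del: One_nat_def)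
  ultimately show ?thesis by simp
qed (simp add: complete_hom_neg)

lemma symmetric_jacobi_trudi: "jacobi_trudi N g \<in> symmetric_polys N"
  unfolding jacobi_trudi_def det_def
  by (auto intro!: symmetric_sum symmetric_mult symmetric_prod simp: permutes_def)
    (metis atLeastLessThan_iff le0 permutes_def permutes_in_image symmetric_complete_hom)+

definition row_indicator :: "nat set \<Rightarrow> nat \<Rightarrow> nat" where
  "row_indicator R i = (if i \<in> R then 1 else 0)"

lemma elem_sym_eq:
  "elem_sym {1..N} r = (\<Sum>m\<in>(\<lambda>R. expo N (row_indicator R)) ` {R. R \<subseteq> {1..N} \<and> card R = r}. xpow m)"
  and inj_row_indicator: "inj_on (\<lambda>R. expo N (row_indicator R)) {R. R \<subseteq> {1..N} \<and> card R = r}"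
proof -
  show inj: "inj_on (\<lambda>R. expo N (row_indicator R)) {R. R \<subseteq> {1..N} \<and> card R = r}"
  proof (rule inj_onI, clarify)
    fix R R' assume R: "R \<subseteq> {1..N}" "R' \<subseteq> {1..N}" "expo N (row_indicator R) = expo N (row_indicator R')"
    then have "row_indicator R i = row_indicator R' i" if "i \<in> {1..N}" for i
      using that lookup_expo_inside by metis
    then have "i \<in> R \<longleftrightarrow> i \<in> R'" if "i \<in> {1..N}" for i
      using that by (metis row_indicator_def zero_neq_one)
    then show "R = R'" using R(1,2) by blast
  qed
  have "(\<Sum>i\<in>R. Poly_Mapping.single i (Suc 0)) = expo N (row_indicator R)" if "R \<subseteq> {1..N}" for R
  proof -
    have "expo N (row_indicator R) = (\<Sum>i\<in>{1..N}. if i \<in> R then Poly_Mapping.single i (Suc 0) else 0)"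
      unfolding expo_def row_indicator_def by (intro sum.cong) auto
    also have "\<dots> = (\<Sum>i\<in>{1..N} \<inter> R. Poly_Mapping.single i (Suc 0))"
      by (simp add: sum.inter_restrict)
    finally show ?thesis using that by (simp add: Int_absorb1)
  qed
  then show "elem_sym {1..N} r = (\<Sum>m\<in>(\<lambda>R. expo N (row_indicator R)) ` {R. R \<subseteq> {1..N} \<and> card R = r}. xpow m)"
    unfolding elem_sym_def sum.reindex[OF inj] by (intro sum.cong) auto
qed

lemma
  symmetric_elem_sym: "elem_sym {1..N} r \<in> symmetric_polys N" and
  elem_sym_mult_jacobi_trudi: "elem_sym {1..N} r * jacobi_trudi N g =
    (\<Sum>R | R \<subseteq> {1..N} \<and> card R = r. jacobi_trudi N (\<lambda>i. g i + row_indicator R i))"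
proof -
  let ?B = "(\<lambda>R. expo N (row_indicator R)) ` {R. R \<subseteq> {1..N} \<and> card R = r}"
  have fin: "finite {R. R \<subseteq> {1..N} \<and> card R = r}"
    by (rule finite_subset[of _ "Pow {1..N}"]) auto
  have perm: "Poly_Mapping.map_key w m \<in> ?B" if m: "m \<in> ?B" and w: "w permutes {1..N}" for m w
  proof -
    obtain R where R: "R \<subseteq> {1..N}" "card R = r" "m = expo N (row_indicator R)" using m by auto
    have "row_indicator R \<circ> w = row_indicator (w -` R)" by (auto simp: row_indicator_def)
    then have "Poly_Mapping.map_key w m = expo N (row_indicator (w -` R))"
      using map_key_expo[OF w] R(3) by simp
    moreover have "w -` R \<subseteq> {1..N}" using R(1) permutes_in_image[OF w] by blast
    moreover have "card (w -` R) = r"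
      using R(2) card_vimage_inj[OF permutes_inj[OF w], of R] permutes_surj[OF w] by simp
    ultimately show ?thesis by blast
  qed
  note s = sum_xpow_symmetric[of ?B N, folded elem_sym_eq]
  have k: "Poly_Mapping.keys m \<subseteq> {1..N}" if "m \<in> ?B" for m using that keys_expo by auto
  show e: "elem_sym {1..N} r \<in> symmetric_polys N"
    by (rule s(1)) (use fin perm k in auto)
  have keys: "Poly_Mapping.keys (elem_sym {1..N} r) = ?B"
    by (rule s(3)) (use fin perm k in auto)
  have look: "Poly_Mapping.lookup (elem_sym {1..N} r) b = (if b \<in> ?B then 1 else 0)" for b
    by (rule s(2)) (use fin perm k in auto)
  show "elem_sym {1..N} r * jacobi_trudi N g =
    (\<Sum>R | R \<subseteq> {1..N} \<and> card R = r. jacobi_trudi N (\<lambda>i. g i + row_indicator R i))"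
    unfolding symmetric_mult_jacobi_trudi[OF e] keys sum.reindex[OF inj_row_indicator]
    by (intro sum.cong refl) (auto simp: look simp del: One_nat_def intro!: jacobi_trudi_cong)
qed

section \<open>The fusion ideal and the elementary Pieri rule\<close>

lemma cring_sym_ring: "cring (sym_ring N)"
proof (rule cringI)
  show "abelian_group (sym_ring N)"
    by (rule abelian_groupI)
      (auto simp: sym_ring_def symmetric_add algebra_simps intro!: bexI[of _ "- _"] symmetric_uminus)
  show "Group.comm_monoid (sym_ring N)"
    by (rule comm_monoidI) (auto simp: sym_ring_def symmetric_mult algebra_simps)
qed (auto simp: sym_ring_def algebra_simps)

locale fusion =
  fixes N k :: nat
  assumes N2: "N \<ge> 2" and k1: "k \<ge> 1"
begin

abbreviation J where "J \<equiv> fusion_ideal N k"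

lemma schur_symmetric: "schur N \<mu> \<in> symmetric_polys N"
  by (simp add: schur_jacobi_trudi symmetric_jacobi_trudi)

lemma generators_symmetric:
  "insert (schur N (replicate N 1) - 1)
     {schur N \<mu> | \<mu>. length \<mu> = N \<and> sorted_wrt (\<ge>) \<mu> \<and> \<mu> ! 0 = \<mu> ! (N - 1) + (k + 1)} \<subseteq> carrier (sym_ring N)"
  unfolding sym_ring_def using symmetric_diff[OF schur_symmetric symmetric_1] schur_symmetric by auto

lemma ideal_J: "ideal J (sym_ring N)"
  unfolding fusion_ideal_def
  by (rule ring.genideal_ideal[OF cring.axioms(1)[OF cring_sym_ring] generators_symmetric])

lemma generators_J:
  "schur N (replicate N 1) - 1 \<in> J"
  "length \<mu> = N \<Longrightarrow> sorted_wrt (\<ge>) \<mu> \<Longrightarrow> \<mu> ! 0 = \<mu> ! (N - 1) + (k + 1) \<Longrightarrow> schur N \<mu> \<in> J"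
  using ring.genideal_self[OF cring.axioms(1)[OF cring_sym_ring] generators_symmetric]
  unfolding fusion_ideal_def by auto

lemma J_0: "0 \<in> J"
  using additive_subgroup.zero_closed[OF ideal.axioms(1)[OF ideal_J]] by (simp add: sym_ring_def)

lemma J_add: "p \<in> J \<Longrightarrow> q \<in> J \<Longrightarrow> p + q \<in> J"
  using additive_subgroup.a_closed[OF ideal.axioms(1)[OF ideal_J]] by (simp add: sym_ring_def)

lemma J_mult: "p \<in> symmetric_polys N \<Longrightarrow> q \<in> J \<Longrightarrow> p * q \<in> J"
  using ideal.I_l_closed[OF ideal_J] by (simp add: sym_ring_def)

lemma J_uminus: "p \<in> J \<Longrightarrow> - p \<in> J"
  using J_mult[OF symmetric_uminus[OF symmetric_1]] by simp

definition fcong :: "rat_mpoly \<Rightarrow> rat_mpoly \<Rightarrow> bool" (infix \<open>\<doteq>\<close> 50) where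
  "p \<doteq> q \<longleftrightarrow> p - q \<in> J"

lemma fcong_refl [simp, intro]: "p \<doteq> p"
  by (simp add: fcong_def J_0)

lemma fcong_sym: "p \<doteq> q \<Longrightarrow> q \<doteq> p"
  unfolding fcong_def using J_uminus[of "p - q"] by simp

lemma fcong_trans [trans]: "p \<doteq> q \<Longrightarrow> q \<doteq> r \<Longrightarrow> p \<doteq> r"
  unfolding fcong_def using J_add[of "p - q" "q - r"] by simp

lemma fcong_add: "p \<doteq> q \<Longrightarrow> p' \<doteq> q' \<Longrightarrow> p + p' \<doteq> q + q'"
  unfolding fcong_def using J_add[of "p - q" "p' - q'"] by (simp add: algebra_simps)

lemma fcong_sum: "(\<And>i. i \<in> A \<Longrightarrow> f i \<doteq> g i) \<Longrightarrow> sum f A \<doteq> sum g A"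
  by (induction A rule: infinite_finite_induct) (auto intro: fcong_add)

lemma fcong_mult_left: "p \<doteq> q \<Longrightarrow> r \<in> symmetric_polys N \<Longrightarrow> r * p \<doteq> r * q"
  unfolding fcong_def using J_mult[of r "p - q"] by (simp add: algebra_simps)

lemma fcong_0_iff: "p \<doteq> 0 \<longleftrightarrow> p \<in> J"
  by (simp add: fcong_def)

text \<open>Adding a full column multiplies by \<open>e\<^sub>N\<close>, which is the Schur polynomial of \<open>(1\<^sup>N)\<close> and so
  congruent to 1.\<close>

lemma jacobi_trudi_shift: "jacobi_trudi N (\<lambda>i. g i + 1) \<doteq> jacobi_trudi N g"
proof -
  have top: "elem_sym {1..N} N * jacobi_trudi N g = jacobi_trudi N (\<lambda>i. g i + 1)" for g
  proof -
    have "{R. R \<subseteq> {1..N} \<and> card R = N} = {{1..N}}"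
      using card_subset_eq[of "{1..N}"] by auto
    then show ?thesis
      unfolding elem_sym_mult_jacobi_trudi by (simp add: row_indicator_def) (rule jacobi_trudi_cong, simp)
  qed
  have "schur N (replicate N 1) = elem_sym {1..N} N"
    using top[of "rho N"] unfolding schur_jacobi_trudi jacobi_trudi_rho
    by (simp only: mult_1_right) (rule jacobi_trudi_cong, auto)
  then have "(elem_sym {1..N} N - 1) * jacobi_trudi N g \<in> J"
    using J_mult[OF symmetric_jacobi_trudi generators_J(1)] by (simp add: mult.commute)
  then show ?thesis unfolding fcong_def top[symmetric] by (simp add: left_diff_distrib)
qed

text \<open>The bound allows \<open>\<mu>\<close> to increase by one from a row to the next, as it may after adding a vertical
  strip. Then two entries of \<open>\<mu> + \<rho>\<close> agree and the determinant vanishes; otherwise \<open>\<mu>\<close> is a partition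
  and the determinant a generator of the ideal.\<close>

lemma jacobi_trudi_wide:
  assumes "\<mu> 1 = \<mu> N + k + 1" and step: "\<And>i. i \<in> {1..<N} \<Longrightarrow> \<mu> (i + 1) \<le> \<mu> i + (1::nat)"
  shows "jacobi_trudi N (\<lambda>i. \<mu> i + rho N i) \<in> J"
proof (cases "\<exists>i\<in>{1..<N}. \<mu> (i + 1) = \<mu> i + 1")
  case True
  then obtain i where i: "i \<in> {1..<N}" "\<mu> (i + 1) = \<mu> i + 1" by blast
  have "jacobi_trudi N (\<lambda>i. \<mu> i + rho N i) = 0"
    by (rule jacobi_trudi_repeated[of i _ "i + 1"]) (use i in \<open>auto simp: rho_def\<close>)
  then show ?thesis by (simp add: J_0)
next
  case False
  define m where "m = map \<mu> [1..<N + 1]"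
  have nth: "m ! i = \<mu> (i + 1)" if "i < N" for i
    using that by (simp add: m_def nth_append del: upt_Suc)
  have "sorted_wrt (\<ge>) m"
  proof (rule sorted_wrt_iff_nth_Suc_transp[THEN iffD2])
    show "transp (\<lambda>x y. (y::nat) \<le> x)" by (auto simp: transp_def)
    show "\<forall>i. Suc i < length m \<longrightarrow> m ! Suc i \<le> m ! i"
    proof (intro allI impI)
      fix i assume "Suc i < length m"
      then have i: "i + 1 \<in> {1..<N}" using N2 by (simp add: m_def)
      then have "\<mu> (i + 1 + 1) \<le> \<mu> (i + 1)" using step[OF i] False by force
      then show "m ! Suc i \<le> m ! i" using i by (simp add: nth)
    qed
  qed
  moreover have "m ! 0 = m ! (N - 1) + (k + 1)" using assms(1) N2 by (simp add: nth)
  ultimately have "schur N m \<in> J" by (intro generators_J(2)) (simp_all add: m_def)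
  also have "schur N m = jacobi_trudi N (\<lambda>i. \<mu> i + rho N i)"
    unfolding schur_jacobi_trudi by (rule jacobi_trudi_cong) (auto simp: nth)
  finally show ?thesis .
qed

text \<open>The multisets that encode the orbits, that is, the partitions in the \<open>(N - 1) \<times> k\<close> box.\<close>

definition box :: "nat multiset \<Rightarrow> bool" where
  "box A \<longleftrightarrow> size A = k \<and> set_mset A \<subseteq> {..<N}"

text \<open>The \<open>i\<close>-th part of the partition encoded by \<open>A\<close>, for \<open>i \<ge> 1\<close>.\<close>

definition tail_count :: "nat multiset \<Rightarrow> nat \<Rightarrow> nat" where
  "tail_count A i = size (filter_mset (\<lambda>x. i \<le> x) A)"

definition box_schur :: "nat multiset \<Rightarrow> rat_mpoly" where
  "box_schur A = jacobi_trudi N (\<lambda>i. tail_count A i + rho N i)"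

definition rot :: "nat \<Rightarrow> nat multiset \<Rightarrow> nat multiset" where
  "rot t A = image_mset (\<lambda>i. (i + t) mod N) A"

lemma box_schur_symmetric: "box_schur A \<in> symmetric_polys N"
  by (simp add: box_schur_def symmetric_jacobi_trudi)

lemma tail_count_add: "tail_count (A + B) i = tail_count A i + tail_count B i"
  by (simp add: tail_count_def)

lemma tail_count_N: "set_mset A \<subseteq> {..<N} \<Longrightarrow> tail_count A N = 0"
  by (auto simp: tail_count_def subset_iff dest!: multi_member_split)

lemma tail_count_Suc: "tail_count A i = tail_count A (Suc i) + count A i"
proof -
  have "filter_mset (\<lambda>x. i \<le> x) A = filter_mset (\<lambda>x. Suc i \<le> x) A + filter_mset (\<lambda>x. x = i) A"
    by (rule multiset_eqI) auto
  then show ?thesis by (simp add: tail_count_def filter_eq_replicate_mset)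
qed

lemma tail_count_0: "tail_count A 0 = size A"
  by (simp add: tail_count_def)

lemma tail_count_mset_set: "finite R \<Longrightarrow> tail_count (mset_set R) i = card {x\<in>R. i \<le> x}"
  by (simp add: tail_count_def)

lemma size_rot [simp]: "size (rot t A) = size A"
  by (simp add: rot_def)

lemma rot_add: "rot t (A + B) = rot t A + rot t B"
  by (simp add: rot_def)

lemma set_rot: "set_mset (rot t A) \<subseteq> {..<N}"
  using N2 by (auto simp: rot_def)

lemma tail_count_rot_mset_set:
  assumes R: "R \<subseteq> {..<N}" and i: "i \<in> {1..N}"
  shows "tail_count (rot 1 (mset_set R)) i + row_indicator R (N - 1) = tail_count (mset_set R) i + row_indicator R (i - 1)"
proof -
  have fin: "finite R" using R finite_subset by blast
  have "tail_count (rot 1 (mset_set R)) i = card {x\<in>R. i \<le> (x + 1) mod N}"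
    using fin by (simp add: tail_count_def rot_def filter_mset_image_mset)
  also have "{x\<in>R. i \<le> (x + 1) mod N} = {x\<in>R. i \<le> x + 1} - {N - 1}"
  proof -
    have "i \<le> (x + 1) mod N \<longleftrightarrow> i \<le> x + 1 \<and> x \<noteq> N - 1" if "x \<in> R" for x
    proof (cases "x = N - 1")
      case False
      then have "x + 1 < N" using that R by auto
      then show ?thesis using False by simp
    qed (use i N2 in auto)
    then show ?thesis by blast
  qed
  finally have 1: "tail_count (rot 1 (mset_set R)) i + row_indicator R (N - 1) = card {x\<in>R. i \<le> x + 1}"
  proof (cases "N - 1 \<in> R")
    case True
    then have "N - 1 \<in> {x\<in>R. i \<le> x + 1}" using i by auto
    then have "card {x\<in>R. i \<le> x + 1} = Suc (card ({x\<in>R. i \<le> x + 1} - {N - 1}))"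
      using fin by (intro card.remove) auto
    then show ?thesis if "tail_count (rot 1 (mset_set R)) i = card ({x\<in>R. i \<le> x + 1} - {N - 1})"
      using that True by (simp add: row_indicator_def)
  qed (simp add: row_indicator_def)
  have "card {x\<in>R. i \<le> x + 1} = card {x\<in>R. i \<le> x} + row_indicator R (i - 1)"
  proof (cases "i - 1 \<in> R")
    case True
    then have "{x\<in>R. i \<le> x + 1} = insert (i - 1) {x\<in>R. i \<le> x}" using i by auto
    moreover have "i - 1 \<notin> {x\<in>R. i \<le> x}" using i by auto
    ultimately show ?thesis using True fin by (simp add: row_indicator_def)
  next
    case False
    then have "x \<noteq> i - 1" if "x \<in> R" for x using that by auto
    then have "{x\<in>R. i \<le> x + 1} = {x\<in>R. i \<le> x}" by fastforce
    then show ?thesis using False by (simp add: row_indicator_def)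
  qed
  then show ?thesis using 1 by (simp add: tail_count_mset_set[OF fin])
qed

text \<open>The Schur polynomial after raising the elements of \<open>d\<close> by one modulo \<open>N\<close>. Elements may
  enter and leave a class at the same time, hence the condition is not \<open>d \<subseteq># A\<close>.\<close>

definition move :: "nat multiset \<Rightarrow> nat multiset \<Rightarrow> rat_mpoly" where
  "move A d = (if d \<subseteq># A + rot 1 d then box_schur (A + rot 1 d - d) else 0)"

text \<open>A new box in row \<open>i + 1\<close> of the partition moves one coordinate from \<open>i\<close> to \<open>i + 1\<close>; in
  row \<open>N\<close> it completes a column, whose removal moves a coordinate from \<open>N - 1\<close> to \<open>0\<close>. If a coordinate
  would leave an empty class that receives nothing, then two neighbouring entries of the exponent vector
  become equal, or, for the class of \<open>0\<close>, the first row gets longer than the last one by \<open>k + 1\<close>.\<close>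

lemma elementary_step:
  assumes A: "box A" and R: "R \<subseteq> {..<N}"
  shows "jacobi_trudi N (\<lambda>i. tail_count A i + rho N i + row_indicator (Suc ` R) i) \<doteq> move A (mset_set R)"
proof (cases "mset_set R \<subseteq># A + rot 1 (mset_set R)")
  case True
  define A' where "A' = A + rot 1 (mset_set R) - mset_set R"
  have ind: "row_indicator (Suc ` R) i = row_indicator R (i - 1)" if "i \<in> {1..N}" for i
    using that by (cases i) (auto simp: row_indicator_def)
  have "A' + mset_set R = A + rot 1 (mset_set R)" using True by (simp add: A'_def)
  then have eq: "tail_count A' i + tail_count (mset_set R) i = tail_count A i + tail_count (rot 1 (mset_set R)) i" for i
    by (simp add: tail_count_add[symmetric])
  then have "tail_count A i + row_indicator R (i - 1) = tail_count A' i + row_indicator R (N - 1)" if "i \<in> {1..N}" for i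
    using tail_count_rot_mset_set[OF R that] eq[of i] by linarith
  then have "jacobi_trudi N (\<lambda>i. tail_count A i + rho N i + row_indicator (Suc ` R) i) =
      jacobi_trudi N (\<lambda>i. tail_count A' i + rho N i + row_indicator R (N - 1))"
    by (intro jacobi_trudi_cong) (simp add: ind del: atLeastAtMost_iff)
  also have "\<dots> \<doteq> box_schur A'"
    using jacobi_trudi_shift[of "\<lambda>i. tail_count A' i + rho N i"] by (auto simp: row_indicator_def box_schur_def)
  finally show ?thesis using True by (simp add: move_def A'_def)
next
  case False
  then obtain i where "count (mset_set R) i > count (A + rot 1 (mset_set R)) i"
    by (auto simp: subseteq_mset_def not_le)
  moreover have fin: "finite R" using R finite_subset by blast
  ultimately have i: "i \<in> R" "count A i = 0" "i \<notin># rot 1 (mset_set R)"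
    by (auto simp: count_mset_set' not_in_iff split: if_splits)
  have iN: "i < N" using i R by auto
  have pred: "x \<notin> R" if "(x + 1) mod N = i" for x
    using i(3) that fin by (auto simp: rot_def)
  have "jacobi_trudi N (\<lambda>i. tail_count A i + rho N i + row_indicator (Suc ` R) i) \<in> J"
  proof (cases "i = 0")
    case False
    then have "i - 1 \<notin> R" using pred[of "i - 1"] iN by simp
    then have "jacobi_trudi N (\<lambda>i. tail_count A i + rho N i + row_indicator (Suc ` R) i) = 0"
      by (intro jacobi_trudi_repeated[of i _ "Suc i"])
        (use False i iN tail_count_Suc[of A i] in \<open>auto simp: rho_def row_indicator_def\<close>)
    then show ?thesis by (simp add: J_0)
  next
    case True
    then have last: "N - 1 \<notin> R" using pred[of "N - 1"] N2 by simp
    have "jacobi_trudi N (\<lambda>i. (tail_count A i + row_indicator (Suc ` R) i) + rho N i) \<in> J"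
    proof (rule jacobi_trudi_wide)
      have "tail_count A (Suc 0) = k" using tail_count_Suc[of A 0] tail_count_0[of A] True i(2) A by (simp add: box_def)
      moreover have "tail_count A N = 0" using A by (simp add: box_def tail_count_N)
      moreover have "row_indicator (Suc ` R) N = 0" using last N2 by (auto simp: row_indicator_def)
      ultimately show "tail_count A 1 + row_indicator (Suc ` R) 1 = tail_count A N + row_indicator (Suc ` R) N + k + 1"
        using i(1) True by (simp add: row_indicator_def)
    next
      fix j show "tail_count A (j + 1) + row_indicator (Suc ` R) (j + 1) \<le> tail_count A j + row_indicator (Suc ` R) j + 1"
        using tail_count_Suc[of A j] by (simp add: row_indicator_def)
    qed
    then show ?thesis by (simp add: add_ac)
  qed
  then show ?thesis using False by (simp add: move_def fcong_0_iff)
qed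

lemma elementary_pieri:
  assumes A: "box A"
  shows "elem_sym {1..N} r * box_schur A \<doteq> (\<Sum>R | R \<subseteq> {..<N} \<and> card R = r. move A (mset_set R))"
proof -
  have "elem_sym {1..N} r * box_schur A =
    (\<Sum>Q | Q \<subseteq> {1..N} \<and> card Q = r. jacobi_trudi N (\<lambda>i. tail_count A i + rho N i + row_indicator Q i))"
    by (simp only: box_schur_def elem_sym_mult_jacobi_trudi)
  also have "\<dots> = (\<Sum>R | R \<subseteq> {..<N} \<and> card R = r. jacobi_trudi N (\<lambda>i. tail_count A i + rho N i + row_indicator (Suc ` R) i))"
  proof (rule sum.reindex_bij_witness[where i = "\<lambda>R. Suc ` R" and j = "\<lambda>Q. (\<lambda>i. i - 1) ` Q"])
    fix Q assume Q: "Q \<in> {Q. Q \<subseteq> {1..N} \<and> card Q = r}"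
    show *: "Suc ` (\<lambda>i. i - 1) ` Q = Q"
      using Q by (force simp: image_image)
    have "card ((\<lambda>i. i - 1) ` Q) = card Q"
      using * by (metis card_image inj_Suc inj_on_subset subset_UNIV)
    moreover have "(\<lambda>i. i - 1) ` Q \<subseteq> {..<N}" using Q by force
    ultimately show "(\<lambda>i. i - 1) ` Q \<in> {R. R \<subseteq> {..<N} \<and> card R = r}" using Q by simp
    show "jacobi_trudi N (\<lambda>i. tail_count A i + rho N i + row_indicator (Suc ` (\<lambda>i. i - 1) ` Q) i) =
      jacobi_trudi N (\<lambda>i. tail_count A i + rho N i + row_indicator Q i)" by (simp only: *)
  qed (auto simp: card_image image_image)
  also have "\<dots> \<doteq> (\<Sum>R | R \<subseteq> {..<N} \<and> card R = r. move A (mset_set R))"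
    by (rule fcong_sum) (use elementary_step[OF A] in auto)
  finally show ?thesis .
qed

end

section \<open>The complete Pieri rule\<close>

lemma finite_submultisets: "finite {D. D \<subseteq># A \<and> size D = m}"
proof (rule finite_subset)
  show "{D. D \<subseteq># A \<and> size D = m} \<subseteq> mset ` {xs. set xs \<subseteq> set_mset A \<and> length xs = m}"
  proof
    fix D assume D: "D \<in> {D. D \<subseteq># A \<and> size D = m}"
    obtain xs where xs: "mset xs = D" using ex_mset by blast
    then have "set xs \<subseteq> set_mset A" "length xs = m"
      using D set_mset_mono[of D A] by auto
    then show "D \<in> mset ` {xs. set xs \<subseteq> set_mset A \<and> length xs = m}" using xs by blast
  qed
  show "finite (mset ` {xs. set xs \<subseteq> set_mset A \<and> length xs = m})"
    by (simp add: finite_lists_length_eq)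
qed

context fusion
begin

definition toggle :: "nat \<Rightarrow> nat multiset \<times> nat set \<Rightarrow> nat multiset \<times> nat set" where
  "toggle i = (\<lambda>(D, R). if i \<in> R then (add_mset i D, R - {i}) else (D - {#i#}, insert i R))"

text \<open>Otherwise every class met by \<open>d\<close> loses more elements than \<open>A\<close> has there, so it must receive some,
  and \<open>d\<close> meets the preceding class as well. Going round the circle, \<open>d\<close> has at least
  \<open>count A i + 1\<close> elements in each of the \<open>N\<close> classes, hence at least \<open>N + k\<close> in total.\<close>

lemma exists_movable_class:
  assumes A: "box A" and d: "d \<subseteq># A + rot 1 d" "set_mset d \<subseteq> {..<N}" and size: "0 < size d" "size d < N + k"
  shows "\<exists>i<N. 0 < count d i \<and> count d i \<le> count A i"
proof (rule ccontr)
  assume no: "\<not> ?thesis"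
  have pred: "\<exists>x\<in>#d. (x + 1) mod N = i" if i: "i \<in># d" for i
  proof -
    have "i < N" using i d(2) by auto
    then have "count A i < count d i" using no i by (auto simp: not_le)
    also have "count d i \<le> count A i + count (rot 1 d) i"
      using d(1) by (simp add: subseteq_mset_def)
    finally have "i \<in># rot 1 d" by (metis add_0_right count_eq_zero_iff less_irrefl)
    then show ?thesis by (auto simp: rot_def)
  qed
  obtain j where j: "j \<in># d" using size(1) by (metis gr_implies_not_zero multiset_nonemptyE size_empty)
  have pred_Suc: "i \<in># d" if Suc: "Suc i \<in># d" for i
  proof -
    obtain x where x: "x \<in># d" "(x + 1) mod N = Suc i" using pred[OF Suc] by auto
    moreover have "x < N" using x d(2) by auto
    ultimately have "x = i" by (cases "x + 1 = N") auto
    then show ?thesis using x by simp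
  qed
  have down: "i - t \<in># d" if i: "i \<in># d" for i t
  proof (induction t)
    case (Suc t)
    show ?case
    proof (cases "i - t = 0")
      case False
      then have "i - t = Suc (i - Suc t)" by simp
      then show ?thesis using Suc pred_Suc by simp
    qed (use Suc in simp)
  qed (use i in simp)
  have "0 \<in># d" using down[OF j, of j] by simp
  then obtain x where x: "x \<in># d" "(x + 1) mod N = 0" using pred[of 0] by auto
  moreover have "x < N" using x d(2) by auto
  ultimately have "x = N - 1" by (cases "x + 1 = N") auto
  then have all: "i \<in># d" if "i < N" for i
    using down[OF x(1), of "N - 1 - i"] that by simp
  have sz: "size B = (\<Sum>i<N. count B i)" if "set_mset B \<subseteq> {..<N}" for B
    unfolding size_multiset_overloaded_eq using that
    by (intro sum.mono_neutral_left) (auto simp: not_in_iff)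
  have "N + k = (\<Sum>i<N. count A i + 1)"
    unfolding sum.distrib using A sz[of A] by (simp add: box_def)
  also have "\<dots> \<le> (\<Sum>i<N. count d i)"
    using no all by (intro sum_mono) (auto simp: not_le Suc_le_eq)
  finally show False using size sz[OF d(2)] by simp
qed

text \<open>The weight of a pair \<open>(D, R)\<close> depends, up to sign, only on the sum \<open>d\<close> of \<open>D\<close> and \<open>R\<close>. If \<open>d\<close> meets
  class \<open>i\<close> in at least one and at most \<open>count A i\<close> elements, then one of these can be taken
  either from \<open>R\<close> or from \<open>D\<close>. If the weight is not zero, such a class exists by
  \<open>exists_movable_class\<close>; choosing the least such \<open>i\<close>, which depends on \<open>d\<close> only, makes this
  exchange a sign-reversing involution.\<close>

lemma alternating_moves_cancel:
  assumes A: "box A" and m: "0 < m" "m < N + k"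
  shows "(\<Sum>(D, R) | D \<subseteq># A \<and> R \<subseteq> {..<N} \<and> size D + card R = m.
    (- 1) ^ card R * move A (D + mset_set R)) = 0"
proof -
  define P where "P = {(D, R). D \<subseteq># A \<and> R \<subseteq> {..<N} \<and> size D + card R = m}"
  define tot where "tot = (\<lambda>(D :: nat multiset, R). D + mset_set R)"
  define P' where "P' = {x\<in>P. tot x \<subseteq># A + rot 1 (tot x)}"
  define w where "w = (\<lambda>x :: nat multiset \<times> nat set. (- 1) ^ card (snd x) * move A (tot x))"
  define pick where "pick = (\<lambda>x. LEAST i. i < N \<and> 0 < count (tot x) i \<and> count (tot x) i \<le> count A i)"
  define t where "t = (\<lambda>x. toggle (pick x) x)"
  have t_eq: "t x = toggle (pick x) x" for x by (simp add: t_def)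
  have "P \<subseteq> (\<Union>j\<le>m. {D. D \<subseteq># A \<and> size D = j}) \<times> Pow {..<N}" by (auto simp: P_def)
  then have finP: "finite P" by (rule finite_subset) (auto simp: finite_submultisets)
  have pick: "pick x < N" "0 < count (tot x) (pick x)" "count (tot x) (pick x) \<le> count A (pick x)" if "x \<in> P'" for x
  proof -
    obtain D R where x: "x = (D, R)" by force
    have DR: "D \<subseteq># A" "R \<subseteq> {..<N}" "size D + card R = m" "tot x \<subseteq># A + rot 1 (tot x)"
      using that by (auto simp: P'_def P_def x)
    have fin: "finite R" using DR(2) finite_subset by blast
    have "set_mset (tot x) \<subseteq> {..<N}"
      using DR(2) set_mset_mono[OF DR(1)] A fin by (auto simp: tot_def x box_def)
    moreover have "size (tot x) = m" using DR(3) fin by (simp add: tot_def x)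
    ultimately have "\<exists>i<N. 0 < count (tot x) i \<and> count (tot x) i \<le> count A i"
      using exists_movable_class[OF A DR(4)] m by auto
    then have "\<exists>i. i < N \<and> 0 < count (tot x) i \<and> count (tot x) i \<le> count A i" by auto
    from LeastI_ex[OF this]
    show "pick x < N" "0 < count (tot x) (pick x)" "count (tot x) (pick x) \<le> count A (pick x)"
      unfolding pick_def by blast+
  qed
  have tog: "t x \<in> P' \<and> t (t x) = x \<and> w (t x) = - w x" if xP: "x \<in> P'" for x
  proof -
    obtain D R where x: "x = (D, R)" by force
    have DR: "D \<subseteq># A" "R \<subseteq> {..<N}" "size D + card R = m" "tot x \<subseteq># A + rot 1 (tot x)"
      using that by (auto simp: P'_def P_def x)
    have fin: "finite R" using DR(2) finite_subset by blast
    define i where "i = pick x"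
    have i: "i < N" "0 < count (tot x) i" "count (tot x) i \<le> count A i"
      using pick[OF xP] by (auto simp: i_def)
    show ?thesis
    proof (cases "i \<in> R")
      case True
      have c: "count (tot x) i = Suc (count D i)" using True fin by (simp add: tot_def x)
      have tx: "t x = (add_mset i D, R - {i})" using True by (simp add: t_def toggle_def x flip: i_def[unfolded x])
      have "mset_set R = add_mset i (mset_set (R - {i}))"
        using True fin by (simp add: mset_set.remove)
      then have tot: "tot (t x) = tot x" by (simp add: tx) (simp add: tot_def x)
      have "add_mset i D \<subseteq># A"
        using DR(1) i(3) c by (auto simp: subseteq_mset_def)
      moreover have cR: "card R = Suc (card (R - {i}))" using True fin by (metis card_Suc_Diff1)
      ultimately have "t x \<in> P'" using DR tot by (auto simp: P'_def P_def tx)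
      moreover have "t (t x) = x"
      proof -
        have "pick (t x) = i" using tot by (simp add: pick_def i_def)
        then have "t (t x) = toggle i (t x)" using t_eq[of "t x"] by simp
        also have "toggle i (t x) = x" unfolding tx using True by (auto simp: toggle_def x)
        finally show ?thesis .
      qed
      moreover have "w (t x) = - w x" unfolding w_def tot unfolding tx unfolding x snd_conv cR by simp
      ultimately show ?thesis by blast
    next
      case False
      have c: "count (tot x) i = count D i" using False fin by (simp add: tot_def x)
      then have iD: "i \<in># D" using i(2) by (simp add: count_greater_zero_iff)
      have tx: "t x = (D - {#i#}, insert i R)" using False by (simp add: t_def toggle_def x flip: i_def[unfolded x])
      have tot: "tot (t x) = tot x" using False fin iD by (simp add: tx) (simp add: tot_def x)
      have "D - {#i#} \<subseteq># A" using DR(1) by (meson diff_subset_eq_self subset_mset.order_trans)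
      moreover have cR: "card (insert i R) = Suc (card R)" using False fin by simp
      moreover have "size D = Suc (size (D - {#i#}))" using iD by (metis size_Suc_Diff1)
      ultimately have "t x \<in> P'" using DR tot i(1) by (auto simp: P'_def P_def tx)
      moreover have "t (t x) = x"
      proof -
        have "pick (t x) = i" using tot by (simp add: pick_def i_def)
        then have "t (t x) = toggle i (t x)" using t_eq[of "t x"] by simp
        also have "toggle i (t x) = x" unfolding tx using False iD by (auto simp: toggle_def x)
        finally show ?thesis .
      qed
      moreover have "w (t x) = - w x" unfolding w_def tot unfolding tx unfolding x snd_conv cR by simp
      ultimately show ?thesis by blast
    qed
  qed
  have "(\<Sum>x\<in>P'. w x) = (\<Sum>x\<in>P'. - w x)"
    by (rule sum.reindex_bij_witness[where i = t and j = t]) (use tog in auto)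
  then have "2 * (\<Sum>x\<in>P'. w x) = 0" by (simp add: sum_negf)
  then have "(\<Sum>x\<in>P'. w x) = 0" by simp
  moreover have "(\<Sum>x\<in>P'. w x) = (\<Sum>x\<in>P. w x)"
    by (rule sum.mono_neutral_left) (auto simp: finP P'_def w_def move_def)
  ultimately have "(\<Sum>x\<in>P. w x) = 0" by simp
  then show ?thesis by (simp add: P_def w_def tot_def case_prod_beta)
qed

text \<open>The partition of \<open>strip A D\<close> is that of \<open>A\<close> with a horizontal strip added, and with full columns
  removed.\<close>

definition strip :: "nat multiset \<Rightarrow> nat multiset \<Rightarrow> nat multiset" where
  "strip A D = rot 1 D + (A - D)"

lemma box_strip:
  assumes A: "box A" and D: "D \<subseteq># A"
  shows "box (strip A D)"
proof -
  obtain B where "A = D + B" using D by (metis subset_mset.le_iff_add)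
  then show ?thesis using A set_rot[of 1 D] by (auto simp: box_def strip_def)
qed

lemma move_strip:
  assumes D: "D \<subseteq># A"
  shows "move (strip A D) d = move A (D + d)"
proof -
  obtain B where A: "A = D + B" using D by (metis subset_mset.le_iff_add)
  have eq: "A + rot 1 (D + d) = D + (strip A D + rot 1 d)"
    by (simp add: A strip_def rot_add add_ac)
  show ?thesis by (simp add: move_def eq del: One_nat_def)
qed

lemma finite_subsets_card: "finite {R. R \<subseteq> {..<N} \<and> card R = r}"
  by (rule finite_subset[of _ "Pow {..<N}"]) auto

text \<open>Induction on \<open>m\<close>, solving the alternating relation between elementary and complete symmetric
  polynomials for \<open>h\<^sub>m\<close>: the right-hand sides satisfy the same recursion by
  \<open>alternating_moves_cancel\<close>.\<close>

lemma complete_pieri: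
  assumes "box A" "m < N + k"
  shows "complete_hom N (int m) * box_schur A \<doteq> (\<Sum>D | D \<subseteq># A \<and> size D = m. box_schur (strip A D))"
  using assms
proof (induction m rule: less_induct)
  case (less m)
  note A = less.prems(1)
  \<comment> \<open>the value that the induction hypothesis and the elementary rule give for \<open>e\<^sub>r h\<^sub>m\<^sub>-\<^sub>r\<close> times the polynomial of \<open>A\<close>\<close>
  define F where "F = (\<lambda>r. \<Sum>D | D \<subseteq># A \<and> size D = m - r. \<Sum>R | R \<subseteq> {..<N} \<and> card R = r. move A (D + mset_set R))"
  show ?case
  proof (cases "m = 0")
    case True
    have "{D. D \<subseteq># A \<and> size D = 0} = {{#}}" by auto
    then show ?thesis using True by (simp add: complete_hom_0 strip_def rot_def)
  next
    case False
    have step: "elem_sym {1..N} r * (complete_hom N (int m - int r) * box_schur A) \<doteq> F r"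
      if r: "r \<in> {1..m}" for r
    proof -
      have "complete_hom N (int m - int r) * box_schur A \<doteq> (\<Sum>D | D \<subseteq># A \<and> size D = m - r. box_schur (strip A D))"
        using less.IH[of "m - r"] r less.prems by (simp add: of_nat_diff)
      then have "elem_sym {1..N} r * (complete_hom N (int m - int r) * box_schur A) \<doteq>
          elem_sym {1..N} r * (\<Sum>D | D \<subseteq># A \<and> size D = m - r. box_schur (strip A D))"
        by (rule fcong_mult_left) (rule symmetric_elem_sym)
      also have "\<dots> = (\<Sum>D | D \<subseteq># A \<and> size D = m - r. elem_sym {1..N} r * box_schur (strip A D))"
        by (simp add: sum_distrib_left)
      also have "\<dots> \<doteq> F r"
        unfolding F_def
      proof (rule fcong_sum)
        fix D assume "D \<in> {D. D \<subseteq># A \<and> size D = m - r}"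
        then have D: "D \<subseteq># A" by simp
        show "elem_sym {1..N} r * box_schur (strip A D) \<doteq>
            (\<Sum>R | R \<subseteq> {..<N} \<and> card R = r. move A (D + mset_set R))"
          using elementary_pieri[OF box_strip[OF A D], of r] by (simp add: move_strip[OF D])
      qed
      finally show ?thesis .
    qed
    have "0 = (\<Sum>r=0..m. (- 1) ^ r * F r)"
    proof -
      define P where "P = (\<lambda>r. {D. D \<subseteq># A \<and> size D = m - r} \<times> {R. R \<subseteq> {..<N} \<and> card R = r})"
      have un: "{(D, R). D \<subseteq># A \<and> R \<subseteq> {..<N} \<and> size D + card R = m} = (\<Union>r\<in>{0..m}. P r)"
        by (auto simp: P_def)
      have "0 = (\<Sum>(D, R)\<in>(\<Union>r\<in>{0..m}. P r). (- 1) ^ card R * move A (D + mset_set R))"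
        using alternating_moves_cancel[OF A, of m] False less.prems(2) by (simp add: un)
      also have "\<dots> = (\<Sum>r=0..m. \<Sum>(D, R)\<in>P r. (- 1) ^ card R * move A (D + mset_set R))"
        by (rule sum.UNION_disjoint) (auto simp: P_def finite_submultisets finite_subsets_card)
      also have "\<dots> = (\<Sum>r=0..m. (- 1) ^ r * F r)"
      proof (rule sum.cong[OF refl])
        fix r
        have "(\<Sum>(D, R)\<in>P r. (- 1) ^ card R * move A (D + mset_set R)) =
            (\<Sum>(D, R)\<in>P r. (- 1) ^ r * move A (D + mset_set R))"
          by (rule sum.cong) (auto simp: P_def)
        then show "(\<Sum>(D, R)\<in>P r. (- 1) ^ card R * move A (D + mset_set R)) = (- 1) ^ r * F r"
          by (simp add: F_def P_def sum.cartesian_product[symmetric] sum_distrib_left)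
      qed
      finally show ?thesis .
    qed
    also have "\<dots> = F 0 + (\<Sum>r\<in>{1..m}. (- 1) ^ r * F r)"
      by (subst sum.atLeast_Suc_atMost) auto
    finally have F0: "F 0 = - (\<Sum>r\<in>{1..m}. (- 1) ^ r * F r)" by (simp add: eq_neg_iff_add_eq_0)
    have "0 = (\<Sum>r=0..m. (- 1) ^ r * elem_sym {1..N} r * complete_hom N (int m - int r)) * box_schur A"
      using elem_complete_alternating[of m N] False by simp
    also have "\<dots> = complete_hom N (int m) * box_schur A +
        (\<Sum>r\<in>{1..m}. (- 1) ^ r * (elem_sym {1..N} r * (complete_hom N (int m - int r) * box_schur A)))"
      by (subst sum.atLeast_Suc_atMost) (auto simp: elem_sym_0 distrib_right sum_distrib_right mult.assoc)
    finally have "complete_hom N (int m) * box_schur A =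
        - (\<Sum>r\<in>{1..m}. (- 1) ^ r * (elem_sym {1..N} r * (complete_hom N (int m - int r) * box_schur A)))"
      by (simp add: eq_neg_iff_add_eq_0)
    also have "\<dots> = (\<Sum>r\<in>{1..m}. - ((- 1) ^ r) * (elem_sym {1..N} r * (complete_hom N (int m - int r) * box_schur A)))"
      by (simp add: sum_negf)
    also have "\<dots> \<doteq> (\<Sum>r\<in>{1..m}. - ((- 1) ^ r) * F r)"
    proof (rule fcong_sum, rule fcong_mult_left)
      fix r
      show "- ((- 1) ^ r) \<in> symmetric_polys N"
        using symmetric_of_int[of "- ((- 1) ^ r)" N] by simp
    qed (rule step)
    also have "\<dots> = F 0" by (simp add: F0 sum_negf)
    also have "F 0 = (\<Sum>D | D \<subseteq># A \<and> size D = m. box_schur (strip A D))"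
    proof -
      have "{R. R \<subseteq> {..<N} \<and> card R = 0} = {{}}" using finite_subset by fastforce
      then have "F 0 = (\<Sum>D | D \<subseteq># A \<and> size D = m. move A D)" by (simp add: F_def)
      also have "\<dots> = (\<Sum>D | D \<subseteq># A \<and> size D = m. box_schur (strip A D))"
      proof (intro sum.cong refl)
        fix D assume "D \<in> {D. D \<subseteq># A \<and> size D = m}"
        then have "D \<subseteq># A" by simp
        then have "move A D = move (strip A D) {#}" using move_strip[of D A "{#}"] by simp
        then show "move A D = box_schur (strip A D)" by (simp add: move_def rot_def)
      qed
      finally show ?thesis .
    qed
    finally show ?thesis .
  qed
qed

lemma box_rot: "box A \<Longrightarrow> box (rot t A)"
  using set_rot by (simp add: box_def)

definition vacuum :: "nat multiset" where
  "vacuum = replicate_mset k 0"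

lemma box_vacuum: "box vacuum"
  using N2 by (auto simp: box_def vacuum_def)

lemma box_schur_vacuum: "box_schur vacuum = 1"
proof -
  have "box_schur vacuum = jacobi_trudi N (rho N)"
    unfolding box_schur_def by (rule jacobi_trudi_cong) (auto simp: tail_count_def vacuum_def filter_mset_eq_conv)
  then show ?thesis by (simp add: jacobi_trudi_rho)
qed

text \<open>A multiset of \<open>k\<close> elements has no part with \<open>m > k\<close> elements, so the sum in the Pieri rule
  is empty.\<close>

lemma complete_hom_J:
  assumes "k < m" "m < N + k"
  shows "complete_hom N (int m) \<in> J"
proof -
  have no: "{D. D \<subseteq># vacuum \<and> size D = m} = {}"
    using assms size_mset_mono[of _ vacuum] by (force simp: vacuum_def)
  then show ?thesis
    using complete_pieri[OF box_vacuum assms(2)] unfolding box_schur_vacuum no by (simp add: fcong_0_iff)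
qed

lemma box_schur_rot_1:
  assumes A: "box A"
  shows "box_schur (rot 1 A) \<doteq> complete_hom N (int k) * box_schur A"
proof -
  have "D = A" if "D \<subseteq># A" "size D = k" for D
    using that A mset_subset_size[of D A] by (auto simp: box_def subset_mset.less_le)
  then have "{D. D \<subseteq># A \<and> size D = k} = {A}" using A by (auto simp: box_def)
  moreover have "strip A A = rot 1 A" by (simp add: strip_def)
  ultimately have "complete_hom N (int k) * box_schur A \<doteq> box_schur (rot 1 A)"
    using complete_pieri[OF A, of k] N2 by (simp del: One_nat_def)
  then show ?thesis by (rule fcong_sym)
qed

lemma rot_rot: "rot s (rot t A) = rot (s + t) A"
  by (simp add: rot_def image_mset.compositionality o_def mod_add_left_eq add.assoc add.commute[of s])

lemma rot_0: "set_mset A \<subseteq> {..<N} \<Longrightarrow> rot 0 A = A"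
  unfolding rot_def by (induction A) auto

lemma symmetric_power: "p \<in> symmetric_polys N \<Longrightarrow> p ^ t \<in> symmetric_polys N"
  by (induction t) (auto intro: symmetric_mult)

lemma box_schur_rot:
  assumes A: "box A"
  shows "box_schur (rot t A) \<doteq> complete_hom N (int k) ^ t * box_schur A"
proof (induction t)
  case 0
  then show ?case using A by (simp add: rot_0 box_def)
next
  case (Suc t)
  have "box_schur (rot (Suc t) A) \<doteq> complete_hom N (int k) * box_schur (rot t A)"
    using box_schur_rot_1[OF box_rot[OF A, of t]] by (simp add: rot_rot)
  also have "\<dots> \<doteq> complete_hom N (int k) * (complete_hom N (int k) ^ t * box_schur A)"
    by (rule fcong_mult_left[OF Suc symmetric_complete_hom])
  finally show ?case by (simp add: mult.assoc)
qed

text \<open>All special orbits are translates of \<open>[1\<^sup>m 0\<^sup>k\<^sup>-\<^sup>m]\<close> by a constant vector, the last family with translation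
  by \<open>N - 1\<close>. Translation by one is multiplication by \<open>h\<^sub>k\<close>, so both sides are congruent to
  \<open>h\<^sub>k\<^sup>t h\<^sub>m\<close> times the polynomial of \<open>A\<close>.\<close>

lemma two_valued_pieri:
  assumes A: "box A" and m: "m \<le> k"
  shows "(\<Sum>D | D \<subseteq># A \<and> size D = m. box_schur (rot (t + 1) D + rot t (A - D))) \<doteq>
    box_schur A * box_schur (replicate_mset m ((t + 1) mod N) + replicate_mset (k - m) (t mod N))"
proof -
  have key: "(\<Sum>D | D \<subseteq># A \<and> size D = m. box_schur (rot (t + 1) D + rot t (A - D))) \<doteq>
     complete_hom N (int k) ^ t * (complete_hom N (int m) * box_schur A)" if A: "box A" for A
  proof -
    have "(\<Sum>D | D \<subseteq># A \<and> size D = m. box_schur (rot (t + 1) D + rot t (A - D))) =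
        (\<Sum>D | D \<subseteq># A \<and> size D = m. box_schur (rot t (strip A D)))"
      unfolding strip_def rot_add rot_rot by simp
    also have "\<dots> \<doteq> (\<Sum>D | D \<subseteq># A \<and> size D = m. complete_hom N (int k) ^ t * box_schur (strip A D))"
      by (rule fcong_sum) (use box_schur_rot box_strip[OF A] in auto)
    also have "\<dots> = complete_hom N (int k) ^ t * (\<Sum>D | D \<subseteq># A \<and> size D = m. box_schur (strip A D))"
      by (simp add: sum_distrib_left)
    also have "\<dots> \<doteq> complete_hom N (int k) ^ t * (complete_hom N (int m) * box_schur A)"
      by (rule fcong_mult_left, rule fcong_sym, rule complete_pieri[OF A])
        (use m N2 in \<open>auto intro: symmetric_power symmetric_complete_hom\<close>)
    finally show ?thesis .
  qed
  have single: "{D. D \<subseteq># vacuum \<and> size D = m} = {replicate_mset m 0}"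
  proof -
    have 1: "D = replicate_mset m 0" if "D \<subseteq># vacuum" "size D = m" for D
      using that by (metis msubseteq_replicate_msetE size_replicate_mset vacuum_def)
    have 2: "replicate_mset m 0 \<subseteq># vacuum"
      using m by (auto simp: vacuum_def subseteq_mset_def)
    show ?thesis
    proof (intro equalityI subsetI)
      fix D assume "D \<in> {D. D \<subseteq># vacuum \<and> size D = m}"
      then show "D \<in> {replicate_mset m 0}" using 1 by blast
    next
      fix D assume "D \<in> {replicate_mset m (0::nat)}"
      then show "D \<in> {D. D \<subseteq># vacuum \<and> size D = m}" using 2 by simp
    qed
  qed
  have rest: "vacuum - replicate_mset m 0 = replicate_mset (k - m) 0"
    by (rule multiset_eqI) (auto simp: vacuum_def count_replicate_mset)
  have rot_replicate: "rot s (replicate_mset j 0) = replicate_mset j (s mod N)" for s j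
    by (simp add: rot_def)
  have "complete_hom N (int k) ^ t * complete_hom N (int m) \<doteq>
     box_schur (replicate_mset m ((t + 1) mod N) + replicate_mset (k - m) (t mod N))"
  proof -
    have "(\<Sum>D | D \<subseteq># vacuum \<and> size D = m. box_schur (rot (t + 1) D + rot t (vacuum - D))) =
        box_schur (replicate_mset m ((t + 1) mod N) + replicate_mset (k - m) (t mod N))"
      unfolding single by (simp add: rest rot_replicate)
    then show ?thesis using fcong_sym[OF key[OF box_vacuum]] by (simp only: box_schur_vacuum mult_1_right)
  qed
  then have "box_schur A * (complete_hom N (int k) ^ t * complete_hom N (int m)) \<doteq>
     box_schur A * box_schur (replicate_mset m ((t + 1) mod N) + replicate_mset (k - m) (t mod N))"
    by (intro fcong_mult_left box_schur_symmetric)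
  then show ?thesis using fcong_trans[OF key[OF A]] by (simp add: mult_ac)
qed

section \<open>Spanning\<close>

inductive_set fspan :: "rat_mpoly set" where
  box_schur: "box A \<Longrightarrow> cst c * box_schur A \<in> fspan"
| zero: "0 \<in> fspan"
| add: "p \<in> fspan \<Longrightarrow> q \<in> fspan \<Longrightarrow> p + q \<in> fspan"

lemma fspan_cst: "p \<in> fspan \<Longrightarrow> cst c * p \<in> fspan"
proof (induction rule: fspan.induct)
  case (box_schur A d)
  then show ?case using fspan.box_schur[of A "c * d"] by (simp add: mult.assoc[symmetric] mult_single)
qed (auto intro: fspan.intros simp: distrib_left)

definition spanned :: "rat_mpoly \<Rightarrow> bool" where
  "spanned p \<longleftrightarrow> (\<exists>q\<in>fspan. p \<doteq> q)"

lemma spanned_add: "spanned p \<Longrightarrow> spanned q \<Longrightarrow> spanned (p + q)"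
  unfolding spanned_def by (blast intro: fcong_add fspan.add)

lemma spanned_0: "spanned 0"
  using fspan.zero fcong_refl unfolding spanned_def by blast

lemma spanned_sum: "(\<And>i. i \<in> I \<Longrightarrow> spanned (f i)) \<Longrightarrow> spanned (sum f I)"
  by (induction I rule: infinite_finite_induct)
    (auto intro: spanned_add spanned_0)

lemma spanned_cst: "spanned p \<Longrightarrow> spanned (cst c * p)"
  unfolding spanned_def by (blast intro: fcong_mult_left fspan_cst symmetric_cst)

lemma spanned_cong: "p \<doteq> q \<Longrightarrow> spanned q \<Longrightarrow> spanned p"
  unfolding spanned_def by (blast intro: fcong_trans)

lemma spanned_box_schur: "box A \<Longrightarrow> spanned (box_schur A)"
  using fspan.box_schur[of A 1] fcong_refl[of "box_schur A"] unfolding spanned_def by auto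

lemma spanned_move:
  assumes A: "box A" and d: "set_mset d \<subseteq> {..<N}"
  shows "spanned (move A d)"
proof (cases "d \<subseteq># A + rot 1 d")
  case True
  have "size (A + rot 1 d - d) = k"
    using A True by (simp add: size_Diff_submset box_def del: One_nat_def)
  moreover have "set_mset (A + rot 1 d - d) \<subseteq> {..<N}"
    using A set_rot[of 1 d] set_mset_mono[OF diff_subset_eq_self[of "A + rot 1 d" d]]
    by (auto simp: box_def)
  ultimately show ?thesis using True by (simp add: move_def box_def spanned_box_schur)
next
  case False
  then show ?thesis by (simp add: move_def spanned_0)
qed

lemma spanned_elem_sym_mult:
  assumes "spanned p"
  shows "spanned (elem_sym {1..N} r * p)"
proof -
  obtain q where q: "q \<in> fspan" "p \<doteq> q" using assms by (auto simp: spanned_def)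
  have "spanned (elem_sym {1..N} r * q)"
    using q(1)
  proof (induction rule: fspan.induct)
    case (box_schur A c)
    have "spanned (\<Sum>R | R \<subseteq> {..<N} \<and> card R = r. move A (mset_set R))"
      by (rule spanned_sum, rule spanned_move[OF box_schur]) (auto simp: finite_subset[OF _ finite_lessThan])
    then have "spanned (elem_sym {1..N} r * box_schur A)" using elementary_pieri[OF box_schur] spanned_cong by blast
    then show ?case using spanned_cst[of "elem_sym {1..N} r * box_schur A" c] by (simp add: mult_ac)
  next
    case zero
    then show ?case by (simp add: spanned_0)
  qed (auto simp: distrib_left spanned_add)
  then show ?thesis using spanned_cong fcong_mult_left[OF q(2) symmetric_elem_sym] by blast
qed

text \<open>Multipliers that preserve the span modulo the ideal. They form a subalgebra, so it suffices to
  find the elementary symmetric polynomials in it.\<close>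

definition stable :: "rat_mpoly \<Rightarrow> bool" where
  "stable q \<longleftrightarrow> (\<forall>p. spanned p \<longrightarrow> spanned (q * p))"

lemma stable_mult: "stable p \<Longrightarrow> stable q \<Longrightarrow> stable (p * q)"
  by (simp add: stable_def mult.assoc)

lemma stable_cst: "stable (cst c)"
  by (simp add: stable_def spanned_cst)

lemma stable_sum: "(\<And>i. i \<in> I \<Longrightarrow> stable (f i)) \<Longrightarrow> stable (sum f I)"
  by (simp add: stable_def sum_distrib_right spanned_sum)

lemma stable_prod: "(\<And>i. i \<in> I \<Longrightarrow> stable (f i)) \<Longrightarrow> stable (prod f I)"
  using stable_cst[of 1] by (induction I rule: infinite_finite_induct) (auto intro: stable_mult)

lemma stable_of_int: "stable (of_int z)"
  using stable_cst[of "of_int z"] by simp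

lemma stable_complete_hom: "stable (complete_hom N n)"
proof (cases "n < 0")
  case True
  then show ?thesis using stable_cst[of 0] by (simp add: complete_hom_neg)
next
  case False
  have "stable (complete_hom N (int m))" for m
  proof (induction m rule: less_induct)
    case (less m)
    show ?case
    proof (cases "m = 0")
      case True
      then show ?thesis using stable_cst[of 1] by (simp add: complete_hom_0)
    next
      case False
      have "0 = (\<Sum>r=0..m. (- 1) ^ r * elem_sym {1..N} r * complete_hom N (int m - int r))"
        using elem_complete_alternating[of m N] False by simp
      also have "\<dots> = complete_hom N (int m) + (\<Sum>r\<in>{1..m}. (- 1) ^ r * elem_sym {1..N} r * complete_hom N (int m - int r))"
        by (subst sum.atLeast_Suc_atMost) (auto simp: elem_sym_0)
      finally have "complete_hom N (int m) = - (\<Sum>r\<in>{1..m}. (- 1) ^ r * elem_sym {1..N} r * complete_hom N (int m - int r))"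
        by (simp add: eq_neg_iff_add_eq_0)
      also have "\<dots> = of_int (- 1) * (\<Sum>r\<in>{1..m}. of_int ((- 1) ^ r) * elem_sym {1..N} r * complete_hom N (int (m - r)))"
        by (auto simp: of_nat_diff intro!: sum.cong)
      also have "stable \<dots>"
      proof (intro stable_mult stable_of_int stable_sum)
        fix r assume r: "r \<in> {1..m}"
        show "stable (elem_sym {1..N} r)" by (simp add: stable_def spanned_elem_sym_mult del: One_nat_def)
        show "stable (complete_hom N (int (m - r)))" by (rule less.IH) (use r in auto)
      qed
      finally show ?thesis .
    qed
  qed
  from this[of "nat n"] show ?thesis using False by simp
qed

lemma stable_jacobi_trudi: "stable (jacobi_trudi N g)"
proof -
  have "jacobi_trudi N g = (\<Sum>w | w permutes {1..N}. of_int (sign w) *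
      (\<Prod>i\<in>{1..N}. complete_hom N (int (g i) - int N + int (w i))))"
    using det_eq_sum_permutations_from_1[of N "\<lambda>i j. complete_hom N (int (g i) - int N + int j)"]
    unfolding jacobi_trudi_def by (simp add: add_ac)
  then show ?thesis
    by (auto intro!: stable_sum stable_mult stable_of_int stable_prod stable_complete_hom)
qed

lemma symmetric_spanned:
  assumes p: "p \<in> symmetric_polys N"
  shows "spanned p"
proof -
  have "stable p"
    by (subst symmetric_expansion[OF p]) (intro stable_sum stable_mult stable_cst stable_jacobi_trudi)
  then have "spanned (p * 1)"
    unfolding stable_def using spanned_box_schur[OF box_vacuum] by (metis box_schur_vacuum)
  then show ?thesis by simp
qed

section \<open>Linear independence\<close>

text \<open>Equivalence under translations only: the translations by \<open>N + k\<close> times a vector with coordinate sum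
  zero, and the diagonal ones by \<open>c\<close>. The condition on the sums, which is not implied by the
  congruences, fixes the coordinate sum of the multiples of \<open>N + k\<close>. Permutations are added in
  the next definition, with their signs.\<close>

definition affine :: "(nat \<Rightarrow> nat) \<Rightarrow> (nat \<Rightarrow> nat) \<Rightarrow> bool" where
  "affine g d \<longleftrightarrow> (\<exists>c. (\<Sum>i\<in>{1..N}. int (g i)) = (\<Sum>i\<in>{1..N}. int (d i)) + int N * c \<and>
      (\<forall>i\<in>{1..N}. int (N + k) dvd int (g i) - (int (d i) + c)))"

lemma affine_sym:
  assumes "affine g d"
  shows "affine d g"
proof -
  obtain c where c: "(\<Sum>i\<in>{1..N}. int (g i)) = (\<Sum>i\<in>{1..N}. int (d i)) + int N * c"
    "\<And>i. i \<in> {1..N} \<Longrightarrow> int (N + k) dvd int (g i) - (int (d i) + c)"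
    using assms unfolding affine_def by blast
  have "int (N + k) dvd int (d i) - (int (g i) + - c)" if "i \<in> {1..N}" for i
    using c(2)[OF that] by (subst dvd_minus_iff[symmetric]) (simp add: algebra_simps)
  then show ?thesis unfolding affine_def using c(1) by (intro exI[of _ "- c"]) auto
qed

lemma affine_trans:
  assumes "affine g d" "affine d e"
  shows "affine g e"
proof -
  obtain c where c: "(\<Sum>i\<in>{1..N}. int (g i)) = (\<Sum>i\<in>{1..N}. int (d i)) + int N * c"
    "\<And>i. i \<in> {1..N} \<Longrightarrow> int (N + k) dvd int (g i) - (int (d i) + c)"
    using assms(1) unfolding affine_def by blast
  obtain c' where c': "(\<Sum>i\<in>{1..N}. int (d i)) = (\<Sum>i\<in>{1..N}. int (e i)) + int N * c'"
    "\<And>i. i \<in> {1..N} \<Longrightarrow> int (N + k) dvd int (d i) - (int (e i) + c')"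
    using assms(2) unfolding affine_def by blast
  have "int (N + k) dvd int (g i) - (int (e i) + (c' + c))" if "i \<in> {1..N}" for i
    using dvd_add[OF c(2)[OF that] c'(2)[OF that]] by (simp add: algebra_simps)
  then show ?thesis unfolding affine_def using c(1) c'(1)
    by (intro exI[of _ "c' + c"]) (auto simp: algebra_simps)
qed

lemma affine_add:
  assumes "affine g d"
  shows "affine (\<lambda>i. b i + g i) (\<lambda>i. b i + d i)"
proof -
  obtain c where c: "(\<Sum>i\<in>{1..N}. int (g i)) = (\<Sum>i\<in>{1..N}. int (d i)) + int N * c"
    "\<And>i. i \<in> {1..N} \<Longrightarrow> int (N + k) dvd int (g i) - (int (d i) + c)"
    using assms unfolding affine_def by blast
  have "int (N + k) dvd int (b i + g i) - (int (b i + d i) + c)" if "i \<in> {1..N}" for i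
    using c(2)[OF that] by (simp add: algebra_simps)
  then show ?thesis unfolding affine_def using c(1)
    by (intro exI[of _ c]) (auto simp: sum.distrib)
qed

lemma affine_permute:
  assumes "affine g d" and w: "w permutes {1..N}"
  shows "affine (g \<circ> w) (d \<circ> w)"
proof -
  obtain c where c: "(\<Sum>i\<in>{1..N}. int (g i)) = (\<Sum>i\<in>{1..N}. int (d i)) + int N * c"
    "\<And>i. i \<in> {1..N} \<Longrightarrow> int (N + k) dvd int (g i) - (int (d i) + c)"
    using assms unfolding affine_def by blast
  have "(\<Sum>i\<in>{1..N}. int ((h \<circ> w) i)) = (\<Sum>i\<in>{1..N}. int (h i))" for h
    using sum.permute[OF w, of "\<lambda>i. int (h i)"] by (simp add: o_def)
  moreover have "int (N + k) dvd int ((g \<circ> w) i) - (int ((d \<circ> w) i) + c)" if "i \<in> {1..N}" for i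
    using c(2)[of "w i"] permutes_in_image[OF w, of i] that by simp
  ultimately show ?thesis unfolding affine_def using c(1) by (intro exI[of _ c]) auto
qed

definition chi :: "(nat \<Rightarrow> nat) \<Rightarrow> (nat \<Rightarrow> nat) \<Rightarrow> rat" where
  "chi d g = (\<Sum>w | w permutes {1..N}. of_int (sign w) * (if affine (g \<circ> w) d then 1 else 0))"

lemma chi_affine:
  assumes "affine g g'"
  shows "chi d g = chi d g'"
  unfolding chi_def
proof (intro sum.cong refl arg_cong2[where f = "(*)"] if_cong)
  fix w assume "w \<in> {w. w permutes {1..N}}"
  then have "affine (g \<circ> w) (g' \<circ> w)" using affine_permute[OF assms] by simp
  then show "affine (g \<circ> w) d \<longleftrightarrow> affine (g' \<circ> w) d"
    using affine_trans affine_sym by blast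
qed

lemma chi_permute:
  assumes s: "s permutes {1..N}"
  shows "chi d (g \<circ> s) = of_int (sign s) * chi d g"
proof -
  have perm: "permutation s" using s permutation_permutes by blast
  have "chi d g = (\<Sum>w | w permutes {1..N}. of_int (sign (s \<circ> w)) * (if affine (g \<circ> (s \<circ> w)) d then 1 else 0))"
    unfolding chi_def
    by (rule sum.reindex_bij_witness[where i = "\<lambda>w. s \<circ> w" and j = "\<lambda>w. inv_into UNIV s \<circ> w"])
      (auto simp: o_assoc permutes_inv_o[OF s] simp del: One_nat_def intro!: permutes_compose permutes_inv s)
  also have "\<dots> = (\<Sum>w | w permutes {1..N}. of_int (sign s) * (of_int (sign w) * (if affine ((g \<circ> s) \<circ> w) d then 1 else 0)))"
  proof (intro sum.cong refl)
    fix w assume "w \<in> {w. w permutes {1..N}}"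
    then have "permutation w" using permutation_permutes by blast
    then show "of_int (sign (s \<circ> w)) * (if affine (g \<circ> (s \<circ> w)) d then 1 else 0) =
      (of_int (sign s) * (of_int (sign w) * (if affine ((g \<circ> s) \<circ> w) d then 1 else 0)) :: rat)"
      using perm by (simp add: sign_compose o_assoc)
  qed
  also have "\<dots> = of_int (sign s) * chi d (g \<circ> s)"
    by (simp add: chi_def sum_distrib_left)
  finally have "of_int (sign s) * chi d g = (of_int (sign s) * of_int (sign s)) * chi d (g \<circ> s)"
    by simp
  moreover have "of_int (sign s) * of_int (sign s) = (1 :: rat)" by (simp add: sign_def)
  ultimately show ?thesis by simp
qed

text \<open>On alternants this functional evaluates \<open>chi d\<close> at the exponent vector, up to the factor \<open>N!\<close>.\<close>

definition pairing :: "(nat \<Rightarrow> nat) \<Rightarrow> rat_mpoly \<Rightarrow> rat" where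
  "pairing d f = (\<Sum>m\<in>Poly_Mapping.keys f. Poly_Mapping.lookup f m * chi d (Poly_Mapping.lookup m))"

lemma pairing_superset:
  assumes "finite S" "Poly_Mapping.keys f \<subseteq> S"
  shows "pairing d f = (\<Sum>m\<in>S. Poly_Mapping.lookup f m * chi d (Poly_Mapping.lookup m))"
  unfolding pairing_def by (rule sum.mono_neutral_left) (use assms in \<open>auto simp: in_keys_iff\<close>)

lemma pairing_add: "pairing d (f + g) = pairing d f + pairing d g"
proof -
  let ?S = "Poly_Mapping.keys f \<union> Poly_Mapping.keys g"
  show ?thesis using keys_add[of f g]
    by (simp add: pairing_superset[of ?S] lookup_add distrib_right sum.distrib)
qed

lemma pairing_0 [simp]: "pairing d 0 = 0"
  by (simp add: pairing_def)

lemma pairing_sum: "pairing d (sum f I) = (\<Sum>i\<in>I. pairing d (f i))"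
  by (induction I rule: infinite_finite_induct) (simp_all add: pairing_add)

lemma chi_cong: "(\<And>i. i \<in> {1..N} \<Longrightarrow> g i = g' i) \<Longrightarrow> chi d g = chi d g'"
  by (rule chi_affine) (auto simp: affine_def intro!: exI[of _ 0])

lemma pairing_single: "pairing d (Poly_Mapping.single m c) = c * chi d (Poly_Mapping.lookup m)"
  by (simp add: pairing_def)

lemma pairing_cst_alternant: "pairing d (cst c * alternant N g) = c * fact N * chi d g"
proof -
  have "pairing d (cst c * alternant N g) =
      (\<Sum>w | w permutes {1..N}. c * (of_int (sign w) * chi d (g \<circ> w)))"
  proof -
    have "cst c * alternant N g = (\<Sum>w | w permutes {1..N}. Poly_Mapping.single (expo N (g \<circ> w)) (c * of_int (sign w)))"
      by (simp add: alternant_def sum_distrib_left mult_single flip: single_of_int)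
    moreover have "chi d (Poly_Mapping.lookup (expo N h)) = chi d h" for h
      by (rule chi_cong) simp
    ultimately show ?thesis by (simp add: pairing_sum pairing_single mult.assoc)
  qed
  also have "\<dots> = (\<Sum>w | w permutes {1..N}. c * chi d g)"
  proof (intro sum.cong refl)
    fix w assume "w \<in> {w. w permutes {1..N}}"
    then have "chi d (g \<circ> w) = of_int (sign w) * chi d g"
      by (intro chi_permute) simp
    then show "c * (of_int (sign w) * chi d (g \<circ> w)) = c * chi d g" by (simp add: sign_def)
  qed
  finally show ?thesis by (simp add: card_permutations)
qed

text \<open>The largest ideal on which the functional vanishes after multiplication with the Vandermonde
  alternant.\<close>

definition annihilated :: "(nat \<Rightarrow> nat) \<Rightarrow> rat_mpoly set" where
  "annihilated d = {p \<in> symmetric_polys N. \<forall>q\<in>symmetric_polys N. pairing d (q * p * alternant N (rho N)) = 0}"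

lemma pairing_symmetric_mult_alternant:
  assumes q: "q \<in> symmetric_polys N"
  shows "pairing d (q * alternant N g) = fact N * (\<Sum>b\<in>Poly_Mapping.keys q. Poly_Mapping.lookup q b * chi d (\<lambda>i. Poly_Mapping.lookup b i + g i))"
  by (simp add: symmetric_mult_alternant[OF q] pairing_sum pairing_cst_alternant sum_distrib_left mult_ac add.commute)

text \<open>Exchanging the first and the last entry of \<open>g\<close> is a translation of \<open>g\<close>. Hence the terms of
  the expansion belonging to a monomial of \<open>q\<close> and to its image under this transposition cancel.\<close>

lemma annihilated_wide:
  assumes g: "g 1 = g N + (N + k)"
  shows "jacobi_trudi N g \<in> annihilated d"
proof -
  let ?s = "Transposition.transpose 1 N"
  have s: "?s permutes {1..N}" using N2 by (intro permutes_swap_id) auto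
  have sgn: "sign ?s = -1" using N2 by (simp add: sign_swap_id)
  have aff: "affine (g \<circ> ?s) g"
  proof -
    have "(\<Sum>i\<in>{1..N}. int ((g \<circ> ?s) i)) = (\<Sum>i\<in>{1..N}. int (g i))"
      using sum.permute[OF s, of "\<lambda>i. int (g i)"] by (simp add: o_def)
    moreover have "int (N + k) dvd int ((g \<circ> ?s) i) - (int (g i) + 0)" for i
    proof -
      consider "i = 1" | "i = N" | "i \<noteq> 1" "i \<noteq> N" by blast
      then show ?thesis
      proof cases
        case 1
        then have "int ((g \<circ> ?s) i) - (int (g i) + 0) = - int (N + k)" by (simp add: g[simplified])
        then show ?thesis by (metis dvd_minus_iff dvd_refl)
      next
        case 2
        then have "int ((g \<circ> ?s) i) - (int (g i) + 0) = int (N + k)" by (simp add: g[simplified])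
        then show ?thesis by (metis dvd_refl)
      next
        case 3
        then show ?thesis by (simp add: transpose_apply_other)
      qed
    qed
    ultimately show ?thesis unfolding affine_def by (intro exI[of _ 0]) auto
  qed
  have "pairing d (q * jacobi_trudi N g * alternant N (rho N)) = 0" if q: "q \<in> symmetric_polys N" for q
  proof -
    let ?F = "\<lambda>b. chi d (\<lambda>i. Poly_Mapping.lookup b i + g i)"
    have neg: "?F (Poly_Mapping.map_key ?s b) = - ?F b" for b
    proof -
      have "?F (Poly_Mapping.map_key ?s b) = chi d (\<lambda>i. Poly_Mapping.lookup b (?s i) + g i)"
        by (simp only: lookup_map_key[OF permutes_inj[OF s]])
      also have "\<dots> = chi d (\<lambda>i. Poly_Mapping.lookup b (?s i) + (g \<circ> ?s) i)"
        by (rule chi_affine[OF affine_sym]) (rule affine_add[OF aff])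
      also have "\<dots> = chi d ((\<lambda>i. Poly_Mapping.lookup b i + g i) \<circ> ?s)" by (simp add: o_def)
      also have "\<dots> = - ?F b" unfolding chi_permute[OF s] sgn by simp
      finally show ?thesis .
    qed
    have "(\<Sum>b\<in>Poly_Mapping.keys q. Poly_Mapping.lookup q b * ?F b) =
        (\<Sum>b\<in>Poly_Mapping.keys q. Poly_Mapping.lookup q b * ?F (Poly_Mapping.map_key ?s b))"
      using sum_keys_symmetric[OF q s, of "\<lambda>b c. c * ?F b"] .
    also have "\<dots> = - (\<Sum>b\<in>Poly_Mapping.keys q. Poly_Mapping.lookup q b * ?F b)"
      unfolding neg by (simp add: sum_negf)
    finally have "(\<Sum>b\<in>Poly_Mapping.keys q. Poly_Mapping.lookup q b * ?F b) = 0" by simp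
    then show ?thesis
      by (simp add: mult.assoc jacobi_trudi_alternant pairing_symmetric_mult_alternant[OF q])
  qed
  then show ?thesis by (simp add: annihilated_def symmetric_jacobi_trudi)
qed

lemma pairing_diff: "pairing d (f - g) = pairing d f - pairing d g"
  using pairing_add[of d "f - g" g] by simp

lemma ideal_annihilated: "ideal (annihilated d) (sym_ring N)"
proof (rule idealI)
  show ring: "ring (sym_ring N)" by (rule cring.axioms(1)[OF cring_sym_ring])
  have uminus: "- x \<in> annihilated d" if "x \<in> annihilated d" for x
    using that pairing_diff[of d 0] symmetric_uminus
    by (auto simp: annihilated_def)
  show "subgroup (annihilated d) (add_monoid (sym_ring N))"
  proof (rule group.subgroupI)
    show "Group.group (add_monoid (sym_ring N))"
      by (rule abelian_group.a_group[OF ring.is_abelian_group[OF ring]])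
    show "annihilated d \<subseteq> carrier (add_monoid (sym_ring N))"
      by (auto simp: annihilated_def sym_ring_def)
    show "annihilated d \<noteq> {}" using symmetric_0 by (auto simp: annihilated_def intro!: exI[of _ 0])
    fix a b assume a: "a \<in> annihilated d" and b: "b \<in> annihilated d"
    show "a \<otimes>\<^bsub>add_monoid (sym_ring N)\<^esub> b \<in> annihilated d"
      using a b by (auto simp: annihilated_def sym_ring_def symmetric_add distrib_left distrib_right pairing_add)
    have "inv\<^bsub>add_monoid (sym_ring N)\<^esub> a = - a"
      by (rule comm_monoid.comm_inv_char[OF abelian_monoid.a_comm_monoid[OF abelian_group.axioms(1)[OF ring.is_abelian_group[OF ring]]]])
        (use a in \<open>auto simp: annihilated_def sym_ring_def symmetric_uminus\<close>)
    then show "inv\<^bsub>add_monoid (sym_ring N)\<^esub> a \<in> annihilated d" using uminus[OF a] by simp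
  qed
  fix a x assume a: "a \<in> annihilated d" and x: "x \<in> carrier (sym_ring N)"
  have "pairing d (q * (x * a) * alternant N (rho N)) = 0" if "q \<in> symmetric_polys N" for q
    using a x that symmetric_mult[of q N x] by (simp add: annihilated_def sym_ring_def mult.assoc[symmetric])
  then show "x \<otimes>\<^bsub>sym_ring N\<^esub> a \<in> annihilated d" "a \<otimes>\<^bsub>sym_ring N\<^esub> x \<in> annihilated d"
    using a x by (auto simp: annihilated_def sym_ring_def symmetric_mult mult.commute[of a x])
qed

text \<open>For the first generator the expansions of the two terms agree, because their exponent vectors differ by
  the diagonal translation; the other generators are covered by \<open>annihilated_wide\<close>.\<close>

lemma J_annihilated: "J \<subseteq> annihilated d"
  unfolding fusion_ideal_def
proof (rule ring.genideal_minimal[OF cring.axioms(1)[OF cring_sym_ring] ideal_annihilated])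
  have one: "schur N (replicate N 1) - 1 \<in> annihilated d"
  proof -
    have S: "schur N (replicate N 1) = jacobi_trudi N (\<lambda>i. 1 + rho N i)"
      unfolding schur_jacobi_trudi by (rule jacobi_trudi_cong) auto
    have aff: "affine (\<lambda>i. Poly_Mapping.lookup b i + (1 + rho N i)) (\<lambda>i. Poly_Mapping.lookup b i + rho N i)" for b
      by (rule affine_add) (auto simp: affine_def sum.distrib intro!: exI[of _ 1])
    have "pairing d (q * (schur N (replicate N 1) - 1) * alternant N (rho N)) = 0"
      if q: "q \<in> symmetric_polys N" for q
    proof -
      have "q * (schur N (replicate N 1) - 1) * alternant N (rho N) =
          q * alternant N (\<lambda>i. 1 + rho N i) - q * alternant N (rho N)"
      proof -
        have "q * (schur N (replicate N 1) - 1) * alternant N (rho N) =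
            q * (schur N (replicate N 1) * alternant N (rho N)) - q * alternant N (rho N)"
          by (simp only: left_diff_distrib right_diff_distrib mult_1_right mult.assoc)
        then show ?thesis by (simp only: S jacobi_trudi_alternant)
      qed
      then show ?thesis
        by (simp only: pairing_diff pairing_symmetric_mult_alternant[OF q] chi_affine[OF aff] diff_self)
    qed
    then show ?thesis using generators_symmetric by (simp add: annihilated_def sym_ring_def)
  qed
  have "schur N \<mu> \<in> annihilated d" if "length \<mu> = N" "\<mu> ! 0 = \<mu> ! (N - 1) + (k + 1)" for \<mu>
    unfolding schur_jacobi_trudi by (rule annihilated_wide) (use that N2 in \<open>auto simp: rho_def\<close>)
  then show "insert (schur N (replicate N 1) - 1)
     {schur N \<mu> | \<mu>. length \<mu> = N \<and> sorted_wrt (\<ge>) \<mu> \<and> \<mu> ! 0 = \<mu> ! (N - 1) + (k + 1)} \<subseteq> annihilated d"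
    using one by auto
qed

definition shifted :: "nat multiset \<Rightarrow> nat \<Rightarrow> nat" where
  "shifted A i = tail_count A i + rho N i"

lemma pairing_box_schur: "pairing d (cst c * box_schur A * alternant N (rho N)) = c * fact N * chi d (shifted A)"
  unfolding box_schur_def shifted_def[abs_def] by (simp add: mult.assoc jacobi_trudi_alternant pairing_cst_alternant)

lemma tail_count_antimono: "i \<le> j \<Longrightarrow> tail_count A j \<le> tail_count A i"
  unfolding tail_count_def by (rule size_mset_mono) (auto intro!: multiset_filter_mono simp: subseteq_mset_def)

lemma shifted_less: "i \<in> {1..N} \<Longrightarrow> j \<in> {1..N} \<Longrightarrow> i < j \<Longrightarrow> shifted A j < shifted A i"
  using tail_count_antimono[of i j A] by (auto simp: shifted_def rho_def)

lemma shifted_bound: "box A \<Longrightarrow> i \<in> {1..N} \<Longrightarrow> shifted A i < N + k"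
  using tail_count_antimono[of 0 i A] by (auto simp: shifted_def rho_def tail_count_0 box_def)

lemma shifted_N: "box A \<Longrightarrow> shifted A N = 0"
  by (simp add: shifted_def rho_def box_def tail_count_N)

lemma strict_anti_permutes_id:
  assumes w: "w permutes {1..N}" and mono: "\<And>i j. i \<in> {1..N} \<Longrightarrow> j \<in> {1..N} \<Longrightarrow> i < j \<Longrightarrow> w i < w j"
  shows "w = id"
proof -
  \<comment> \<open>a point \<open>i\<close> whose predecessors are fixed can neither be the image of a larger point nor be mapped below itself\<close>
  have "w i = i" if "i \<in> {1..N}" for i
    using that
  proof (induction i rule: less_induct)
    case (less i)
    obtain j where j: "w j = i" "j \<in> {1..N}" using w less.prems permutes_image[OF w] by (metis imageE)
    have wi: "w i \<in> {1..N}" using less.prems permutes_in_image[OF w] by blast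
    have "\<not> j < i" using less.IH[of j] j by auto
    moreover have "\<not> i < j"
    proof
      assume "i < j"
      then have "w i < i" using mono[of i j] less.prems j by auto
      then have "w (w i) = w i" using less.IH[of "w i"] wi by auto
      then have "w i = i" using permutes_inj[OF w] by (auto dest: injD)
      then show False using \<open>w i < i\<close> by simp
    qed
    ultimately show ?case using j by (metis linorder_neqE_nat)
  qed
  then show ?thesis using w by (auto simp: permutes_def fun_eq_iff)
qed

text \<open>Both vectors are strictly decreasing from below \<open>N + k\<close> to \<open>0\<close>. So the multiples \<open>t i\<close> of \<open>N + k\<close> differ by at
  most one; as they add up to zero, they all vanish, and comparing minima shows \<open>c = 0\<close>.\<close>

lemma affine_shifted:
  assumes A: "box A" and B: "box B" and w: "w permutes {1..N}" and aff: "affine (shifted B \<circ> w) (shifted A)"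
  shows "w = id \<and> A = B"
proof -
  obtain c where c: "(\<Sum>i\<in>{1..N}. int (shifted B (w i))) = (\<Sum>i\<in>{1..N}. int (shifted A i)) + int N * c"
    "\<And>i. i \<in> {1..N} \<Longrightarrow> int (N + k) dvd int (shifted B (w i)) - (int (shifted A i) + c)"
    using aff unfolding affine_def o_apply by blast
  have "\<exists>t. \<forall>i\<in>{1..N}. int (shifted B (w i)) = int (shifted A i) + c + int (N + k) * t i"
  proof (rule bchoice, rule ballI)
    fix i assume "i \<in> {1..N}"
    then show "\<exists>t. int (shifted B (w i)) = int (shifted A i) + c + int (N + k) * t"
      using c(2)[of i] by (auto simp: dvd_def algebra_simps)
  qed
  then obtain t where t: "\<And>i. i \<in> {1..N} \<Longrightarrow> int (shifted B (w i)) = int (shifted A i) + c + int (N + k) * t i"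
    by blast
  have "(\<Sum>i\<in>{1..N}. int (shifted B (w i))) = (\<Sum>i\<in>{1..N}. int (shifted A i) + c + int (N + k) * t i)"
    by (rule sum.cong) (simp_all add: t)
  also have "\<dots> = (\<Sum>i\<in>{1..N}. int (shifted A i)) + int N * c + int (N + k) * (\<Sum>i\<in>{1..N}. t i)"
    by (simp add: sum.distrib sum_distrib_left)
  finally have "int (N + k) * (\<Sum>i\<in>{1..N}. t i) = 0" using c(1) by simp
  then have t0: "(\<Sum>i\<in>{1..N}. t i) = 0" using N2 by simp
  have wB: "shifted B (w i) < N + k" if "i \<in> {1..N}" for i
    using shifted_bound[OF B] permutes_in_image[OF w] that by blast
  have diff: "t i - t j < 2" if ij: "i \<in> {1..N}" "j \<in> {1..N}" for i j
  proof (rule ccontr)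
    assume "\<not> t i - t j < 2"
    then have "int (N + k) * 2 \<le> int (N + k) * (t i - t j)" by (intro mult_left_mono) auto
    moreover have "int (shifted B (w i)) - int (shifted B (w j)) = int (shifted A i) - int (shifted A j) + int (N + k) * (t i - t j)"
      using t[OF ij(1)] t[OF ij(2)] by (simp add: algebra_simps)
    ultimately show False using wB[OF ij(1)] shifted_bound[OF A ij(2)] by (simp add: algebra_simps)
  qed
  have t_zero: "t i = 0" if i: "i \<in> {1..N}" for i
  proof (cases "\<exists>j\<in>{1..N}. t j > 0")
    case True
    then obtain j where j: "j \<in> {1..N}" "t j > 0" by blast
    have nonneg: "\<forall>l\<in>{1..N}. 0 \<le> t l" using diff[OF j(1)] j(2) by fastforce
    then have "t j = 0" using sum_nonneg_eq_0_iff[of "{1..N}" t] t0 j(1) by auto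
    then show ?thesis using j by simp
  next
    case False
    then have "\<forall>l\<in>{1..N}. 0 \<le> - t l" by force
    moreover have "(\<Sum>l\<in>{1..N}. - t l) = 0" using t0 by (simp add: sum_negf)
    ultimately have "- t i = 0" using sum_nonneg_eq_0_iff[of "{1..N}" "\<lambda>l. - t l"] i by auto
    then show ?thesis by simp
  qed
  have eqc: "int (shifted B (w i)) = int (shifted A i) + c" if "i \<in> {1..N}" for i
    using t[OF that] t_zero[OF that] by simp
  have NN: "N \<in> {1..N}" using N2 by simp
  have "c = 0"
  proof (rule antisym)
    obtain j where j: "w j = N" "j \<in> {1..N}" using permutes_image[OF w] NN by (metis imageE)
    show "c \<le> 0" using eqc[OF j(2)] shifted_N[OF B] j(1) by simp
    show "0 \<le> c" using eqc[OF NN] shifted_N[OF A] by simp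
  qed
  then have eq: "shifted B (w i) = shifted A i" if "i \<in> {1..N}" for i using eqc[OF that] by simp
  have "w i < w j" if ij: "i \<in> {1..N}" "j \<in> {1..N}" "i < j" for i j
  proof (rule ccontr)
    assume "\<not> w i < w j"
    moreover have "w i \<noteq> w j" using permutes_inj[OF w] ij(3) by (auto dest: injD)
    ultimately have "w j < w i" by simp
    then have "shifted B (w i) < shifted B (w j)" using shifted_less permutes_in_image[OF w] ij by blast
    then show False using shifted_less[OF ij, of A] eq[OF ij(1)] eq[OF ij(2)] by simp
  qed
  then have w_id: "w = id" by (rule strict_anti_permutes_id[OF w])
  have tail_count_eq: "tail_count A i = tail_count B i" if "i \<le> N" for i
  proof (cases "i = 0")
    case False
    then show ?thesis using eq[of i] that by (simp add: w_id shifted_def)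
  qed (use A B in \<open>simp add: tail_count_0 box_def\<close>)
  have "A = B"
  proof (rule multiset_eqI)
    fix i show "count A i = count B i"
    proof (cases "i < N")
      case True
      then show ?thesis using tail_count_Suc[of A i] tail_count_Suc[of B i] tail_count_eq[of i] tail_count_eq[of "Suc i"] by simp
    next
      case False
      then show ?thesis using A B by (metis box_def count_inI lessThan_iff subsetD)
    qed
  qed
  then show ?thesis using w_id by simp
qed

lemma chi_shifted:
  assumes A: "box A" and B: "box B"
  shows "chi (shifted A) (shifted B) = (if A = B then 1 else 0)"
proof -
  have aff: "affine (shifted A \<circ> id) (shifted A)" by (auto simp: affine_def intro!: exI[of _ 0])
  have "chi (shifted A) (shifted B) = (\<Sum>w | w permutes {1..N}. if w = id then (if A = B then 1 else 0) else 0)"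
    unfolding chi_def
  proof (intro sum.cong refl)
    fix w assume "w \<in> {w. w permutes {1..N}}"
    then have w: "w permutes {1..N}" by simp
    have "affine (shifted B \<circ> w) (shifted A) \<longleftrightarrow> w = id \<and> A = B"
      using affine_shifted[OF A B w] \<open>affine (shifted A \<circ> id) (shifted A)\<close> by auto
    then show "of_int (sign w) * (if affine (shifted B \<circ> w) (shifted A) then 1 else 0) =
        (if w = id then (if A = B then 1 else 0) else (0::rat))" by auto
  qed
  also have "\<dots> = (if A = B then 1 else 0)"
    by (subst sum.delta) (auto simp: finite_permutations permutes_id)
  finally show ?thesis .
qed

text \<open>The functional attached to \<open>A\<close> picks out the coefficient of \<open>A\<close>, up to the factor \<open>N!\<close>.\<close>

lemma box_schur_independent:
  assumes fin: "finite S" and box: "\<And>A. A \<in> S \<Longrightarrow> box A"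
    and J: "(\<Sum>A\<in>S. cst (c A) * box_schur A) \<in> J" and A: "A \<in> S"
  shows "c A = 0"
proof -
  have "pairing (shifted A) (1 * (\<Sum>B\<in>S. cst (c B) * box_schur B) * alternant N (rho N)) = 0"
    using J J_annihilated[of "shifted A"] symmetric_1 unfolding annihilated_def by blast
  then have "(\<Sum>B\<in>S. c B * fact N * chi (shifted A) (shifted B)) = 0"
    by (simp add: sum_distrib_right pairing_sum pairing_box_schur)
  also have "(\<Sum>B\<in>S. c B * fact N * chi (shifted A) (shifted B)) = (\<Sum>B\<in>S. if B = A then c B * fact N else 0)"
    by (rule sum.cong) (auto simp: chi_shifted box A)
  also have "\<dots> = c A * fact N" using fin A by simp
  finally show ?thesis by simp
qed

end

section \<open>Orbits as multisets\<close>

definition orb :: "nat multiset \<Rightarrow> nat list set" where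
  "orb M = {x. mset x = M}"

lemma perm_orbit_eq: "perm_orbit x = orb (mset x)"
proof (intro equalityI subsetI)
  fix y assume "y \<in> perm_orbit x"
  then show "y \<in> orb (mset x)" by (auto simp: perm_orbit_def orb_def)
next
  fix y assume "y \<in> orb (mset x)"
  then have "mset y = mset x" by (simp add: orb_def)
  then obtain p where "p permutes {..<length x}" "permute_list p x = y" by (rule mset_eq_permutation)
  then show "y \<in> perm_orbit x" by (auto simp: perm_orbit_def)
qed

lemma orb_inject [simp]: "orb M = orb M' \<longleftrightarrow> M = M'"
proof
  assume eq: "orb M = orb M'"
  obtain x where "mset x = M" using ex_mset by blast
  then have "x \<in> orb M'" using eq by (auto simp: orb_def)
  then show "M = M'" using \<open>mset x = M\<close> by (simp add: orb_def)
qed simp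

lemma count_standard_form: "count (mset (standard_form N e)) j = (if j < N then e j else 0)"
  unfolding standard_form_def by (induction N) (auto simp: less_Suc_eq)

lemma orbit_rep_orb:
  assumes M: "set_mset M \<subseteq> {..<N}"
  shows "mset (orbit_rep N (orb M)) = M"
proof -
  have M_eq: "mset (standard_form N (count M)) = M"
    using M by (intro multiset_eqI) (auto simp: count_standard_form not_in_iff[symmetric])
  have "orbit_rep N (orb M) = standard_form N (count M)"
    unfolding orbit_rep_def
  proof (rule the_equality)
    show "standard_form N (count M) \<in> orb M \<and> (\<exists>e. standard_form N (count M) = standard_form N e)"
      using M_eq by (auto simp: orb_def)
  next
    fix x assume "x \<in> orb M \<and> (\<exists>e. x = standard_form N e)"
    then obtain e where e: "x = standard_form N e" "mset x = M" by (auto simp: orb_def)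
    have "e i = count M i" if "i < N" for i
      using that count_standard_form[of N e i] e by simp
    then show "x = standard_form N (count M)"
      unfolding e(1) standard_form_def by (intro arg_cong[where f = concat] map_cong) auto
  qed
  then show ?thesis using M_eq by simp
qed

lemma sum_triples_zip:
  "length x = length y \<Longrightarrow> mset (zip x (zip y (vec_plus N x y))) =
     image_mset (\<lambda>(i, j). (i, j, (i + j) mod N)) (mset (zip x y))"
  unfolding vec_plus_def by (induction x y rule: list_induct2) auto

lemma mset_vec_plus: "mset (vec_plus N x y) = image_mset (\<lambda>(i, j). (i + j) mod N) (mset (zip x y))"
  unfolding vec_plus_def by (simp flip: mset_map)

lemma triple_orbit_eq:
  assumes len: "length x = k" "length y = k" "length z = k"
  shows "triple_orbit k (x, y, z) = {(x', y', z'). length x' = k \<and> length y' = k \<and> length z' = k \<and>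
    mset (zip x' (zip y' z')) = mset (zip x (zip y z))}" (is "?L = ?R")
proof (intro equalityI subsetI)
  fix t assume "t \<in> ?L"
  then obtain p where p: "p permutes {..<k}" "t = (permute_list p x, permute_list p y, permute_list p z)"
    by (auto simp: triple_orbit_def)
  have "zip (permute_list p x) (zip (permute_list p y) (permute_list p z)) = permute_list p (zip x (zip y z))"
    using p(1) len by (simp add: permute_list_zip[OF p(1)])
  then show "t \<in> ?R" using p len by simp
next
  fix t assume "t \<in> ?R"
  then obtain x' y' z' where t: "t = (x', y', z')" and len': "length x' = k" "length y' = k" "length z' = k"
    and eq: "mset (zip x' (zip y' z')) = mset (zip x (zip y z))" by auto
  obtain p where p: "p permutes {..<length (zip x (zip y z))}" "permute_list p (zip x (zip y z)) = zip x' (zip y' z')"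
    using mset_eq_permutation[OF eq] .
  have p': "p permutes {..<k}" using p(1) len by simp
  have z: "zip (permute_list p x) (zip (permute_list p y) (permute_list p z)) = zip x' (zip y' z')"
    using p(2) p' len by (simp add: permute_list_zip[OF p'])
  have "permute_list p x = x'" using arg_cong[OF z, of "map fst"] len len' by simp
  moreover have "permute_list p y = y'" using arg_cong[OF z, of "\<lambda>l. map fst (map snd l)"] len len' by (simp del: map_map)
  moreover have "permute_list p z = z'" using arg_cong[OF z, of "\<lambda>l. map snd (map snd l)"] len len' by (simp del: map_map)
  ultimately show "t \<in> ?L" using p' t by (auto simp: triple_orbit_def)
qed

lemma card_image_eq_kernel:
  assumes "\<And>s t. s \<in> T \<Longrightarrow> t \<in> T \<Longrightarrow> f s = f t \<longleftrightarrow> g s = g t"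
  shows "card (f ` T) = card (g ` T)"
proof -
  define h where "h = (\<lambda>a. f (inv_into T g a))"
  have hg: "h (g t) = f t" if "t \<in> T" for t
    using assms[of "inv_into T g (g t)" t] that by (simp add: h_def inv_into_into f_inv_into_f)
  have "f ` T = h ` g ` T" using hg by (force simp: image_image)
  moreover have "inj_on h (g ` T)" using assms hg by (auto simp: inj_on_def)
  ultimately show ?thesis by (simp add: card_image)
qed

text \<open>A triple in \<open>[a] \<times> [b] \<times> [c]\<close> with \<open>x + y = z\<close> is determined up to simultaneous permutation by the multiset
  of pairs \<open>(x\<^sub>i, y\<^sub>i)\<close>. As \<open>y\<close> has only two values, this multiset is determined by the multiset \<open>D\<close> of those
  \<open>x\<^sub>i\<close> with \<open>y\<^sub>i = u\<close>, which can be any \<open>m\<close> elements of \<open>A\<close>.\<close>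

lemma struct_const_two_valued:
  assumes A: "size A = k" and uv: "u \<noteq> v" and m: "m \<le> k"
  shows "struct_const N k (orb A) (orb (replicate_mset m u + replicate_mset (k - m) v)) (orb C) =
    card {D. D \<subseteq># A \<and> size D = m \<and>
      image_mset (\<lambda>i. (i + u) mod N) D + image_mset (\<lambda>i. (i + v) mod N) (A - D) = C}"
proof -
  define B where "B = replicate_mset m u + replicate_mset (k - m) v"
  define T where "T = sum_triples N (orb A) (orb B) (orb C)"
  define g where "g = (\<lambda>(x :: nat list, y :: nat list, z :: nat list). image_mset fst (filter_mset (\<lambda>p. snd p = u) (mset (zip x y))))"
  define res where "res = (\<lambda>D. image_mset (\<lambda>i. (i + u) mod N) D + image_mset (\<lambda>i. (i + v) mod N) (A - D))"
  have T: "mset x = A \<and> mset y = B \<and> mset z = C \<and> z = vec_plus N x y \<and> length x = k \<and> length y = k \<and> length z = k"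
    if "(x, y, z) \<in> T" for x y z
  proof -
    have "mset x = A" "mset y = B" "mset z = C" "z = vec_plus N x y"
      using that by (auto simp: T_def sum_triples_def orb_def)
    moreover from this have "length x = k" "length y = k"
      using A m by (auto simp: B_def simp flip: size_mset)
    ultimately show ?thesis by (simp add: vec_plus_def)
  qed
  have zip: "mset (zip x y) = image_mset (\<lambda>i. (i, u)) (g (x, y, z)) + image_mset (\<lambda>i. (i, v)) (A - g (x, y, z))
      \<and> g (x, y, z) \<subseteq># A \<and> size (g (x, y, z)) = m"
    if t: "(x, y, z) \<in> T" for x y z
  proof -
    let ?Z = "mset (zip x y)"
    let ?Zu = "filter_mset (\<lambda>p. snd p = u) ?Z" and ?Zv = "filter_mset (\<lambda>p. snd p \<noteq> u) ?Z"
    have split: "?Z = ?Zu + ?Zv" by (rule multiset_partition)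
    have fst: "image_mset fst ?Z = A" and snd: "image_mset snd ?Z = B"
      using T[OF t] by (simp_all flip: mset_map)
    have fst': "image_mset fst ?Zu + image_mset fst ?Zv = A"
      using fst split by (metis image_mset_union)
    then have gA: "g (x, y, z) \<subseteq># A" "A - g (x, y, z) = image_mset fst ?Zv"
      unfolding g_def by auto
    have snd_uv: "snd p = v" if "p \<in># ?Zv" for p
    proof -
      have "snd p \<in># B" using that by (auto simp flip: snd)
      then show ?thesis using that by (auto simp: B_def split: if_splits)
    qed
    have "image_mset (\<lambda>i. (i, u)) (image_mset fst ?Zu) = image_mset (\<lambda>p. p) ?Zu"
      unfolding image_mset.compositionality o_def by (rule image_mset_cong) auto
    moreover have "image_mset (\<lambda>i. (i, v)) (image_mset fst ?Zv) = image_mset (\<lambda>p. p) ?Zv"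
      unfolding image_mset.compositionality o_def by (rule image_mset_cong) (use snd_uv in force)
    ultimately have "?Z = image_mset (\<lambda>i. (i, u)) (g (x, y, z)) + image_mset (\<lambda>i. (i, v)) (A - g (x, y, z))"
      using split gA(2) by (simp add: g_def)
    moreover have "size (g (x, y, z)) = m"
    proof -
      have "image_mset snd ?Zu = filter_mset (\<lambda>j. j = u) B"
        by (simp add: filter_mset_image_mset flip: snd)
      then have "size ?Zu = size (filter_mset (\<lambda>j. j = u) B)" by (metis size_image_mset)
      also have "\<dots> = m" using uv by (simp add: B_def filter_eq_replicate_mset)
      finally show ?thesis by (simp add: g_def)
    qed
    ultimately show ?thesis using gA(1) by blast
  qed
  have "triple_orbit k s = triple_orbit k t \<longleftrightarrow> g s = g t" if s: "s \<in> T" and t: "t \<in> T" for s t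
  proof -
    obtain x y z where s': "s = (x, y, z)" by (cases s) auto
    obtain x' y' z' where t': "t = (x', y', z')" by (cases t) auto
    note S = T[OF s[unfolded s']] and T' = T[OF t[unfolded t']]
    have len: "length x = k" "length y = k" "length z = k" "length x' = k" "length y' = k" "length z' = k"
      using S T' by auto
    note orbs = triple_orbit_eq[OF len(1-3)] triple_orbit_eq[OF len(4-6)]
    have "triple_orbit k s = triple_orbit k t \<longleftrightarrow> mset (zip x (zip y z)) = mset (zip x' (zip y' z'))"
    proof
      assume eq: "triple_orbit k s = triple_orbit k t"
      have "s \<in> triple_orbit k s" unfolding s' orbs by (simp add: len)
      then have "s \<in> triple_orbit k t" using eq by simp
      then show "mset (zip x (zip y z)) = mset (zip x' (zip y' z'))"
        unfolding s' t' orbs by simp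
    qed (simp add: s' t' orbs)
    also have "\<dots> \<longleftrightarrow> mset (zip x y) = mset (zip x' y')"
    proof
      assume "mset (zip x (zip y z)) = mset (zip x' (zip y' z'))"
      then have "image_mset (\<lambda>(i, j, l). (i, j)) (mset (zip x (zip y z))) =
          image_mset (\<lambda>(i, j, l). (i, j)) (mset (zip x' (zip y' z')))" by simp
      moreover have "z = vec_plus N x y" "z' = vec_plus N x' y'" "length x = length y" "length x' = length y'"
        using S T' by auto
      ultimately show "mset (zip x y) = mset (zip x' y')"
        by (simp add: sum_triples_zip image_mset.compositionality o_def case_prod_beta)
    qed (use S T' in \<open>simp add: sum_triples_zip\<close>)
    also have "\<dots> \<longleftrightarrow> g s = g t"
    proof
      assume "g s = g t"
      then have gg: "g (x, y, z) = g (x', y', z')" by (simp only: s' t')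
      show "mset (zip x y) = mset (zip x' y')"
        using zip[OF s[unfolded s']] zip[OF t[unfolded t']] unfolding gg by argo
    qed (simp add: g_def s' t')
    finally show ?thesis .
  qed
  then have "card (triple_orbit k ` T) = card (g ` T)" by (rule card_image_eq_kernel)
  also have "g ` T = {D. D \<subseteq># A \<and> size D = m \<and> res D = C}"
  proof (intro equalityI subsetI)
    fix D assume "D \<in> g ` T"
    then obtain x y z where t: "(x, y, z) \<in> T" "D = g (x, y, z)" by auto
    have "C = image_mset (\<lambda>(i, j). (i + j) mod N) (mset (zip x y))"
      using T[OF t(1)] by (metis mset_vec_plus)
    also have "\<dots> = res D"
      using zip[OF t(1)] by (simp add: t(2) res_def image_mset.compositionality o_def)
    finally show "D \<in> {D. D \<subseteq># A \<and> size D = m \<and> res D = C}" using zip[OF t(1)] t(2) by simp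
  next
    fix D assume "D \<in> {D. D \<subseteq># A \<and> size D = m \<and> res D = C}"
    then have D: "D \<subseteq># A" "size D = m" "res D = C" by auto
    obtain xs where xs: "mset xs = D" using ex_mset by blast
    obtain ys where ys: "mset ys = A - D" using ex_mset by blast
    have len: "length xs = m" "length ys = k - m"
      using D A by (simp_all add: size_Diff_submset flip: size_mset add: xs ys)
    let ?x = "xs @ ys" and ?y = "replicate m u @ replicate (k - m) v"
    have zz: "mset (zip ?x ?y) = image_mset (\<lambda>i. (i, u)) D + image_mset (\<lambda>i. (i, v)) (A - D)"
      using len xs ys by (simp add: zip_replicate2)
    have "mset (vec_plus N ?x ?y) = C"
      using D(3) unfolding mset_vec_plus zz by (simp add: res_def image_mset.compositionality o_def)
    moreover have "mset ?x = A" using D(1) by (simp add: xs ys)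
    ultimately have "(?x, ?y, vec_plus N ?x ?y) \<in> T"
      by (simp add: T_def sum_triples_def orb_def B_def)
    moreover have "g (?x, ?y, vec_plus N ?x ?y) = D"
      using uv by (simp add: g_def zz[simplified] filter_mset_image_mset image_mset.compositionality o_def)
    ultimately show "D \<in> g ` T" by (metis image_eqI)
  qed
  finally show ?thesis by (simp add: struct_const_def T_def B_def res_def)
qed

lemma lookup_orbit_scale: "Poly_Mapping.lookup (orbit_scale r v) b = r * Poly_Mapping.lookup v b"
  unfolding orbit_scale_def by (simp add: Poly_Mapping.map.rep_eq when_def)

lemma orbit_scale_single: "orbit_scale r (Poly_Mapping.single b c) = Poly_Mapping.single b (r * c)"
  by (rule poly_mapping_eqI) (simp add: lookup_orbit_scale lookup_single when_def)

context fusion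
begin

lemma finite_box: "finite {M. box M}"
proof (rule finite_subset)
  show "{M. box M} \<subseteq> mset ` {xs. set xs \<subseteq> {..<N} \<and> length xs = k}"
  proof
    fix M assume "M \<in> {M. box M}"
    moreover obtain xs where "mset xs = M" using ex_mset by blast
    ultimately show "M \<in> mset ` {xs. set xs \<subseteq> {..<N} \<and> length xs = k}"
      by (intro image_eqI[of _ _ xs]) (auto simp: box_def)
  qed
qed (simp add: finite_lists_length_eq)

lemma orbits_eq: "orbits N k = orb ` {M. box M}"
proof -
  have "mset ` vectors N k = {M. box M}"
  proof (intro equalityI subsetI)
    fix M assume "M \<in> {M. box M}"
    moreover obtain xs where "mset xs = M" using ex_mset by blast
    ultimately show "M \<in> mset ` vectors N k"
      by (intro image_eqI[of _ _ xs]) (auto simp: box_def vectors_def)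
  qed (auto simp: vectors_def box_def)
  then show ?thesis unfolding orbits_def perm_orbit_eq by (metis image_image)
qed

lemma cross_basis_two_valued:
  assumes A: "box A" and m: "m \<le> k"
  shows "cross_basis N k (orb A) (orb (replicate_mset m ((t + 1) mod N) + replicate_mset (k - m) (t mod N))) =
    (\<Sum>D | D \<subseteq># A \<and> size D = m. orbit_basis (orb (rot (t + 1) D + rot t (A - D))))"
proof -
  let ?u = "(t + 1) mod N" and ?v = "t mod N"
  let ?S = "{D. D \<subseteq># A \<and> size D = m}" and ?res = "\<lambda>D. rot (t + 1) D + rot t (A - D)"
  have uv: "?u \<noteq> ?v"
  proof
    assume "?u = ?v"
    then have "int N dvd int (t + 1) - int t"
      by (metis mod_eq_dvd_iff zmod_int)
    then show False using N2 by simp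
  qed
  have res: "image_mset (\<lambda>i. (i + ?u) mod N) D + image_mset (\<lambda>i. (i + ?v) mod N) (A - D) = ?res D" for D
    by (simp add: rot_def mod_add_right_eq)
  have box: "box (?res D)" if "D \<in> ?S" for D
  proof -
    have "D \<subseteq># A" using that by simp
    then obtain B where "A = D + B" by (metis subset_mset.le_iff_add)
    then show ?thesis using A set_rot[of "t + 1" D] set_rot[of t B] by (auto simp: box_def)
  qed
  have "cross_basis N k (orb A) (orb (replicate_mset m ?u + replicate_mset (k - m) ?v)) =
    (\<Sum>C | box C. Poly_Mapping.single (orb C) (of_nat (card {D. D \<subseteq># A \<and> size D = m \<and> ?res D = C})))"
    unfolding cross_basis_def orbits_eq
    by (subst sum.reindex) (use A uv m in \<open>auto simp: inj_on_def box_def struct_const_two_valued orbit_scale_single res[simplified]\<close>)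
  also have "\<dots> = (\<Sum>C | box C. \<Sum>D\<in>{D\<in>?S. ?res D = C}. orbit_basis (orb (?res D)))"
  proof (rule sum.cong[OF refl])
    fix C
    have scale: "(\<Sum>D\<in>I. orbit_basis b) = Poly_Mapping.single b (of_nat (card I))" if "finite I" for I :: "nat multiset set" and b
      using that by (induction rule: finite_induct) (simp_all add: single_add[symmetric])
    have "(\<Sum>D\<in>{D\<in>?S. ?res D = C}. orbit_basis (orb (?res D))) = (\<Sum>D\<in>{D\<in>?S. ?res D = C}. orbit_basis (orb C))"
      by (rule sum.cong) auto
    also have "\<dots> = Poly_Mapping.single (orb C) (of_nat (card {D\<in>?S. ?res D = C}))"
      by (rule scale, rule finite_subset[OF _ finite_submultisets[of A m]]) auto
    finally show "Poly_Mapping.single (orb C) (of_nat (card {D. D \<subseteq># A \<and> size D = m \<and> ?res D = C})) =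
      (\<Sum>D\<in>{D\<in>?S. ?res D = C}. orbit_basis (orb (?res D)))" by (simp add: conj_assoc)
  qed
  also have "\<dots> = (\<Sum>D\<in>?S. orbit_basis (orb (?res D)))"
    by (rule sum.group) (use finite_submultisets finite_box box in auto)
  finally show ?thesis .
qed

section \<open>The isomorphism\<close>

definition orbit_space :: "orbit_vec set" where
  "orbit_space = {v. Poly_Mapping.keys v \<subseteq> orbits N k}"

definition schur_lift :: "orbit_vec \<Rightarrow> rat_mpoly" where
  "schur_lift v = (\<Sum>M | box M. cst (Poly_Mapping.lookup v (orb M)) * box_schur M)"

lemma orbit_space_add: "u \<in> orbit_space \<Longrightarrow> v \<in> orbit_space \<Longrightarrow> u + v \<in> orbit_space"
  unfolding orbit_space_def using keys_add[of u v] by blast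

lemma orbit_space_0: "0 \<in> orbit_space"
  by (simp add: orbit_space_def)

lemma orbit_space_uminus: "v \<in> orbit_space \<Longrightarrow> - v \<in> orbit_space"
  unfolding orbit_space_def by (auto simp: in_keys_iff)

lemma orbit_space_diff: "u \<in> orbit_space \<Longrightarrow> v \<in> orbit_space \<Longrightarrow> u - v \<in> orbit_space"
  using orbit_space_add[of u "- v"] orbit_space_uminus[of v] by simp

lemma orbit_space_scale: "v \<in> orbit_space \<Longrightarrow> orbit_scale r v \<in> orbit_space"
  unfolding orbit_space_def by (auto simp: in_keys_iff lookup_orbit_scale)

lemma orbit_space_sum: "(\<And>i. i \<in> I \<Longrightarrow> f i \<in> orbit_space) \<Longrightarrow> sum f I \<in> orbit_space"
  by (induction I rule: infinite_finite_induct) (auto intro: orbit_space_0 orbit_space_add)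

lemma orbit_space_basis: "a \<in> orbits N k \<Longrightarrow> orbit_basis a \<in> orbit_space"
  by (simp add: orbit_space_def)

lemma orbit_space_bilinear:
  assumes "\<And>a b. a \<in> Poly_Mapping.keys u \<Longrightarrow> b \<in> Poly_Mapping.keys v \<Longrightarrow> f a b \<in> orbit_space"
  shows "bilinear_ext f u v \<in> orbit_space"
  unfolding bilinear_ext_def using assms by (intro orbit_space_sum orbit_space_scale) auto

lemma schur_lift_symmetric: "schur_lift v \<in> symmetric_polys N"
  unfolding schur_lift_def by (intro symmetric_sum symmetric_mult symmetric_cst box_schur_symmetric)

lemma schur_lift_add: "schur_lift (u + v) = schur_lift u + schur_lift v"
  by (simp add: schur_lift_def lookup_add single_add distrib_right sum.distrib)

lemma schur_lift_0: "schur_lift 0 = 0"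
  by (simp add: schur_lift_def)

lemma schur_lift_diff: "schur_lift (u - v) = schur_lift u - schur_lift v"
  using schur_lift_add[of "u - v" v] by simp

lemma schur_lift_sum: "schur_lift (sum f I) = (\<Sum>i\<in>I. schur_lift (f i))"
  by (induction I rule: infinite_finite_induct) (simp_all add: schur_lift_0 schur_lift_add)

lemma schur_lift_scale: "schur_lift (orbit_scale r v) = cst r * schur_lift v"
  by (simp add: schur_lift_def lookup_orbit_scale sum_distrib_left mult.assoc[symmetric] mult_single)

lemma schur_lift_basis: "box M \<Longrightarrow> schur_lift (orbit_basis (orb M)) = box_schur M"
proof -
  assume M: "box M"
  have "schur_lift (orbit_basis (orb M)) = (\<Sum>M' | box M'. if M' = M then box_schur M else 0)"
    unfolding schur_lift_def by (rule sum.cong) (auto simp: lookup_single when_def)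
  then show ?thesis using M finite_box by (simp add: sum.delta)
qed

lemma schur_lift_expand: "schur_lift u = (\<Sum>a\<in>Poly_Mapping.keys u. cst (Poly_Mapping.lookup u a) * schur_lift (orbit_basis a))"
proof -
  have "u = (\<Sum>a\<in>Poly_Mapping.keys u. orbit_scale (Poly_Mapping.lookup u a) (orbit_basis a))"
    using poly_mapping_sum_single[of u] by (simp add: orbit_scale_single)
  then have "schur_lift u = schur_lift (\<Sum>a\<in>Poly_Mapping.keys u. orbit_scale (Poly_Mapping.lookup u a) (orbit_basis a))" by simp
  then show ?thesis by (simp add: schur_lift_sum schur_lift_scale)
qed

lemma schur_lift_bilinear:
  assumes "\<And>a b. a \<in> Poly_Mapping.keys u \<Longrightarrow> b \<in> Poly_Mapping.keys v \<Longrightarrow>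
    schur_lift (f a b) \<doteq> schur_lift (orbit_basis a) * schur_lift (orbit_basis b)"
  shows "schur_lift (bilinear_ext f u v) \<doteq> schur_lift u * schur_lift v"
proof -
  have "schur_lift (bilinear_ext f u v) = (\<Sum>a\<in>Poly_Mapping.keys u. \<Sum>b\<in>Poly_Mapping.keys v.
      cst (Poly_Mapping.lookup u a * Poly_Mapping.lookup v b) * schur_lift (f a b))"
    by (simp add: bilinear_ext_def schur_lift_sum schur_lift_scale)
  also have "\<dots> \<doteq> (\<Sum>a\<in>Poly_Mapping.keys u. \<Sum>b\<in>Poly_Mapping.keys v.
      cst (Poly_Mapping.lookup u a * Poly_Mapping.lookup v b) * (schur_lift (orbit_basis a) * schur_lift (orbit_basis b)))"
    by (intro fcong_sum fcong_mult_left symmetric_cst assms)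
  also have "\<dots> = (\<Sum>a\<in>Poly_Mapping.keys u. \<Sum>b\<in>Poly_Mapping.keys v.
      (cst (Poly_Mapping.lookup u a) * schur_lift (orbit_basis a)) * (cst (Poly_Mapping.lookup v b) * schur_lift (orbit_basis b)))"
    by (intro sum.cong refl) (simp add: mult_ac flip: mult_single[of 0 _ 0, simplified])
  also have "\<dots> = schur_lift u * schur_lift v"
    by (subst (3) schur_lift_expand, subst (3) schur_lift_expand) (simp add: sum_product)
  finally show ?thesis .
qed

lemma schur_lift_inj:
  assumes u: "u \<in> orbit_space" and v: "v \<in> orbit_space" and eq: "schur_lift u \<doteq> schur_lift v"
  shows "u = v"
proof -
  have "schur_lift (u - v) \<in> J" using eq by (simp add: fcong_def schur_lift_diff)
  then have zero: "Poly_Mapping.lookup (u - v) (orb M) = 0" if "box M" for M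
    using box_schur_independent[OF finite_box, of "\<lambda>M. Poly_Mapping.lookup (u - v) (orb M)" M] that
    by (simp add: schur_lift_def)
  have "u - v = 0"
  proof (rule poly_mapping_eqI)
    fix a show "Poly_Mapping.lookup (u - v) a = Poly_Mapping.lookup 0 a"
    proof (cases "a \<in> orbits N k")
      case True
      then show ?thesis using zero by (auto simp: orbits_eq)
    next
      case False
      then have "a \<notin> Poly_Mapping.keys (u - v)" using orbit_space_diff[OF u v] by (auto simp: orbit_space_def)
      then show ?thesis by (simp add: in_keys_iff)
    qed
  qed
  then show ?thesis by simp
qed

lemma schur_lift_surj:
  assumes "p \<in> symmetric_polys N"
  shows "\<exists>v\<in>orbit_space. p \<doteq> schur_lift v"
proof -
  have "\<exists>v\<in>orbit_space. q = schur_lift v" if "q \<in> fspan" for q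
    using that
  proof (induction rule: fspan.induct)
    case (box_schur A c)
    then show ?case
      by (intro bexI[of _ "orbit_scale c (orbit_basis (orb A))"])
        (auto simp: schur_lift_scale schur_lift_basis orbits_eq intro!: orbit_space_scale orbit_space_basis)
  next
    case zero
    then show ?case using orbit_space_0 by (intro bexI[of _ 0]) (auto simp: schur_lift_0)
  next
    case (add p q)
    then show ?case by (metis schur_lift_add orbit_space_add)
  qed
  then show ?thesis using symmetric_spanned[OF assms] by (auto simp: spanned_def)
qed

lemma special_form:
  assumes "b \<in> special_orbits N k"
  shows "\<exists>t m. m \<le> k \<and> b = orb (replicate_mset m ((t + 1) mod N) + replicate_mset (k - m) (t mod N))"
proof -
  consider t m where "t + 2 \<le> N" "m \<le> k" "b = perm_orbit (replicate m (t + 1) @ replicate (k - m) t)"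
    | m where "m \<le> k" "b = perm_orbit (replicate (k - m) (N - 1) @ replicate m 0)"
    using assms unfolding special_orbits_def by auto
  then show ?thesis
  proof cases
    case 1
    then show ?thesis by (intro exI[of _ t] exI[of _ m]) (simp add: perm_orbit_eq)
  next
    case 2
    then show ?thesis using N2 by (intro exI[of _ "N - 1"] exI[of _ m]) (simp add: perm_orbit_eq)
  qed
qed

lemma box_two_valued: "m \<le> k \<Longrightarrow> box (replicate_mset m ((t + 1) mod N) + replicate_mset (k - m) (t mod N))"
  using N2 by (auto simp: box_def)

lemma schur_lift_cross_basis:
  assumes a: "a \<in> orbits N k" and b: "b \<in> special_orbits N k"
  shows "schur_lift (cross_basis N k a b) \<doteq> schur_lift (orbit_basis a) * schur_lift (orbit_basis b)"
proof -
  obtain A where A: "box A" "a = orb A" using a by (auto simp: orbits_eq)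
  obtain t m where b': "m \<le> k" "b = orb (replicate_mset m ((t + 1) mod N) + replicate_mset (k - m) (t mod N))"
    using special_form[OF b] by blast
  have "schur_lift (cross_basis N k a b) = (\<Sum>D | D \<subseteq># A \<and> size D = m. schur_lift (orbit_basis (orb (rot (t + 1) D + rot t (A - D)))))"
    unfolding A(2) b'(2) cross_basis_two_valued[OF A(1) b'(1)] schur_lift_sum ..
  also have "\<dots> = (\<Sum>D | D \<subseteq># A \<and> size D = m. box_schur (rot (t + 1) D + rot t (A - D)))"
  proof (rule sum.cong[OF refl], rule schur_lift_basis)
    fix D assume "D \<in> {D. D \<subseteq># A \<and> size D = m}"
    then obtain B where "A = D + B" by (auto simp: subset_mset.le_iff_add)
    then show "box (rot (t + 1) D + rot t (A - D))"
      using A(1) set_rot[of "t + 1" D] set_rot[of t B] by (auto simp: box_def)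
  qed
  also have "\<dots> \<doteq> box_schur A * box_schur (replicate_mset m ((t + 1) mod N) + replicate_mset (k - m) (t mod N))"
    by (rule two_valued_pieri[OF A(1) b'(1)])
  finally show ?thesis by (simp only: A(2) b'(2) schur_lift_basis[OF A(1)] schur_lift_basis[OF box_two_valued[OF b'(1)]])
qed

lemma cross_orbit_space: "cross N k u v \<in> orbit_space"
  unfolding cross_def cross_basis_def by (intro orbit_space_bilinear orbit_space_sum orbit_space_scale orbit_space_basis)

lemma schur_lift_cross:
  assumes "u \<in> orbit_space" "Poly_Mapping.keys v \<subseteq> special_orbits N k"
  shows "schur_lift (cross N k u v) \<doteq> schur_lift u * schur_lift v"
  unfolding cross_def by (rule schur_lift_bilinear, rule schur_lift_cross_basis) (use assms in \<open>auto simp: orbit_space_def\<close>)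

lemma h_orbit_eq:
  assumes "m \<le> k"
  shows "h_orbit k (int m) = orbit_basis (orb (replicate_mset m ((0 + 1) mod N) + replicate_mset (k - m) (0 mod N)))"
  using assms N2 by (simp add: h_orbit_def perm_orbit_eq)

lemma keys_h_orbit: "Poly_Mapping.keys (h_orbit k z) \<subseteq> special_orbits N k"
proof -
  have "perm_orbit (replicate m 1 @ replicate (k - m) 0) \<in> special_orbits N k" if "m \<le> k" for m
    unfolding special_orbits_def using that N2
    by (intro UnI1 CollectI exI[of _ 0] exI[of _ m]) simp
  from this[of "nat z"] show ?thesis by (auto simp: h_orbit_def)
qed

text \<open>The bound covers all indices in the determinant, where \<open>z \<le> k - 1 + (N - 1)\<close>. Outside of \<open>0, \<dots>, k\<close>
  both sides are congruent to zero.\<close>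

lemma schur_lift_h_orbit:
  assumes z: "z < int (N + k)"
  shows "schur_lift (h_orbit k z) \<doteq> complete_hom N z"
proof -
  consider "z < 0" | "z > int k" | m where "z = int m" "m \<le> k"
    by (metis nat_eq_iff2 not_less zle_int)
  then show ?thesis
  proof cases
    case 1
    then show ?thesis by (simp add: h_orbit_def schur_lift_0 complete_hom_neg)
  next
    case 2
    then have "complete_hom N (int (nat z)) \<in> J" by (intro complete_hom_J) (use z in auto)
    then have "schur_lift (h_orbit k z) - complete_hom N z \<in> J"
      using 2 J_uminus by (simp add: h_orbit_def schur_lift_0)
    then show ?thesis by (simp add: fcong_def)
  next
    case 3
    have "complete_hom N (int m) * box_schur vacuum \<doteq> (\<Sum>D | D \<subseteq># vacuum \<and> size D = m. box_schur (strip vacuum D))"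
      using complete_pieri[OF box_vacuum, of m] 3(2) N2 by simp
    also have "\<dots> = (\<Sum>D | D \<subseteq># vacuum \<and> size D = m. box_schur (rot (0 + 1) D + rot 0 (vacuum - D)))"
    proof (rule sum.cong[OF refl])
      fix D
      have "set_mset (vacuum - D) \<subseteq> {..<N}"
        using box_vacuum set_mset_mono[OF diff_subset_eq_self[of vacuum D]] by (auto simp: box_def)
      then show "box_schur (strip vacuum D) = box_schur (rot (0 + 1) D + rot 0 (vacuum - D))"
        by (simp add: strip_def rot_0)
    qed
    also have "\<dots> \<doteq> box_schur vacuum * box_schur (replicate_mset m ((0 + 1) mod N) + replicate_mset (k - m) (0 mod N))"
      by (rule two_valued_pieri[OF box_vacuum 3(2)])
    finally have "complete_hom N z \<doteq> schur_lift (h_orbit k z)"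
      unfolding 3(1) h_orbit_eq[OF 3(2)] schur_lift_basis[OF box_two_valued[OF 3(2)]] by (simp only: box_schur_vacuum mult_1_left mult_1_right)
    then show ?thesis by (rule fcong_sym)
  qed
qed

lemma schur_lift_foldl_cross:
  assumes "u \<in> orbit_space" "\<And>i. i \<in> set xs \<Longrightarrow> z i < int (N + k)"
  shows "foldl (\<lambda>u i. cross N k u (h_orbit k (z i))) u xs \<in> orbit_space \<and>
    schur_lift (foldl (\<lambda>u i. cross N k u (h_orbit k (z i))) u xs) \<doteq> schur_lift u * (\<Prod>i\<leftarrow>xs. complete_hom N (z i))"
  using assms
proof (induction xs arbitrary: u)
  case (Cons i xs)
  let ?u = "cross N k u (h_orbit k (z i))"
  have prod: "(\<Prod>i\<leftarrow>xs. complete_hom N (z i)) \<in> symmetric_polys N" for xs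
    by (induction xs) (auto intro: symmetric_mult symmetric_complete_hom)
  have "schur_lift ?u \<doteq> schur_lift u * schur_lift (h_orbit k (z i))" by (rule schur_lift_cross[OF Cons.prems(1) keys_h_orbit])
  also have "\<dots> \<doteq> schur_lift u * complete_hom N (z i)"
    by (rule fcong_mult_left[OF schur_lift_h_orbit schur_lift_symmetric]) (rule Cons.prems(2), simp)
  finally have step: "schur_lift ?u \<doteq> schur_lift u * complete_hom N (z i)" .
  have IH: "foldl (\<lambda>u i. cross N k u (h_orbit k (z i))) ?u xs \<in> orbit_space \<and>
    schur_lift (foldl (\<lambda>u i. cross N k u (h_orbit k (z i))) ?u xs) \<doteq> schur_lift ?u * (\<Prod>i\<leftarrow>xs. complete_hom N (z i))"
    by (rule Cons.IH[OF cross_orbit_space]) (rule Cons.prems(2), simp)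
  then have "schur_lift (foldl (\<lambda>u i. cross N k u (h_orbit k (z i))) ?u xs) \<doteq> schur_lift ?u * (\<Prod>i\<leftarrow>xs. complete_hom N (z i))" by blast
  also have "\<dots> \<doteq> (schur_lift u * complete_hom N (z i)) * (\<Prod>i\<leftarrow>xs. complete_hom N (z i))"
    using fcong_mult_left[OF step prod[of xs]] by (simp add: mult.commute)
  finally show ?case using IH by (simp add: mult.assoc)
qed simp

lemma tail_count_sum_count:
  assumes "set_mset M \<subseteq> {..<N}"
  shows "tail_count M i = (\<Sum>j\<in>{i..<N}. count M j)"
proof -
  have "tail_count M i = (\<Sum>j\<in>set_mset (filter_mset (\<lambda>x. i \<le> x) M). count (filter_mset (\<lambda>x. i \<le> x) M) j)"
    by (simp only: tail_count_def size_multiset_overloaded_eq)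
  also have "\<dots> = (\<Sum>j\<in>{i..<N}. count (filter_mset (\<lambda>x. i \<le> x) M) j)"
    by (rule sum.mono_neutral_left) (use assms in \<open>auto simp: not_in_iff\<close>)
  also have "\<dots> = (\<Sum>j\<in>{i..<N}. count M j)" by (rule sum.cong) auto
  finally show ?thesis .
qed

lemma conj_part_eq:
  assumes "box M"
  shows "conj_part N (orb M) i = tail_count M i"
proof -
  have M: "set_mset M \<subseteq> {..<N}" using assms by (simp add: box_def)
  show ?thesis
    unfolding conj_part_def tail_count_sum_count[OF M]
    by (simp add: orbit_rep_orb[OF M] flip: count_mset)
qed

text \<open>The last part is zero, so the last row of the Jacobi--Trudi matrix is \<open>(0, \<dots>, 0, 1)\<close> and the
  determinant reduces to the one of size \<open>N - 1\<close> in the definition of the new product.\<close>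

lemma box_schur_det:
  assumes B: "box B"
  shows "box_schur B = (\<Sum>\<sigma> | \<sigma> permutes {1..N - 1}. of_int (sign \<sigma>) *
    (\<Prod>i\<in>{1..<N}. complete_hom N (int (tail_count B i) - int i + int (\<sigma> i))))"
proof -
  define h where "h = (\<lambda>i j. complete_hom N (int (tail_count B i) - int i + int j))"
  have lamN: "tail_count B N = 0" using B by (simp add: box_def tail_count_N)
  have hN: "h N j = (if j = N then 1 else 0)" if "j \<le> N" for j
    using that by (auto simp: h_def lamN complete_hom_0 complete_hom_neg)
  have "box_schur B = det (mat N N (\<lambda>(i, j). h (i + 1) (j + 1)))"
    unfolding box_schur_def jacobi_trudi_def
    by (intro arg_cong[where f = det] cong_mat) (auto simp: h_def rho_def of_nat_diff algebra_simps)
  also have "\<dots> = (\<Sum>w | w permutes {1..N}. of_int (sign w) * (\<Prod>i\<in>{1..N}. h i (w i)))"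
    by (rule det_eq_sum_permutations_from_1)
  also have "\<dots> = (\<Sum>w | w permutes {1..N - 1}. of_int (sign w) * (\<Prod>i\<in>{1..N}. h i (w i)))"
  proof (rule sum.mono_neutral_right)
    show "finite {w. w permutes {1..N}}" by (simp add: finite_permutations)
    show "{w. w permutes {1..N - 1}} \<subseteq> {w. w permutes {1..N}}"
      using permutes_subset[of _ "{1..N - 1}" "{1..N}"] by auto
    show "\<forall>w\<in>{w. w permutes {1..N}} - {w. w permutes {1..N - 1}}. of_int (sign w) * (\<Prod>i\<in>{1..N}. h i (w i)) = 0"
    proof
      fix w assume "w \<in> {w. w permutes {1..N}} - {w. w permutes {1..N - 1}}"
      then have w: "w permutes {1..N}" "\<not> w permutes {1..N - 1}" by auto
      have NN: "N \<in> {1..N}" using N2 by simp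
      \<comment> \<open>the last row of the matrix then contributes a zero\<close>
      have "w N \<noteq> N"
      proof
        assume "w N = N"
        have "w permutes {1..N - 1}"
        proof (rule permutes_superset[OF w(1)])
          fix x assume "x \<in> {1..N} - {1..N - 1}"
          then have "x = N" by auto
          then show "w x = x" using \<open>w N = N\<close> by simp
        qed
        then show False using w(2) by simp
      qed
      moreover have "w N \<le> N" using permutes_in_image[OF w(1), of N] NN by auto
      ultimately have "h N (w N) = 0" using hN by simp
      then have "(\<Prod>i\<in>{1..N}. h i (w i)) = 0" using NN by (intro prod_zero) auto
      then show "of_int (sign w) * (\<Prod>i\<in>{1..N}. h i (w i)) = 0" by simp
    qed
  qed
  also have "\<dots> = (\<Sum>w | w permutes {1..N - 1}. of_int (sign w) * (\<Prod>i\<in>{1..<N}. h i (w i)))"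
  proof (intro sum.cong refl arg_cong2[where f = "(*)"])
    fix w assume "w \<in> {w. w permutes {1..N - 1}}"
    then have "w N = N" using N2 by (auto simp: permutes_def)
    moreover have "{1..N} = insert N {1..<N}" using N2 by auto
    ultimately show "(\<Prod>i\<in>{1..N}. h i (w i)) = (\<Prod>i\<in>{1..<N}. h i (w i))"
      using hN[of N] by simp
  qed
  finally show ?thesis by (simp add: h_def)
qed

lemma schur_lift_dot_basis:
  assumes a: "a \<in> orbits N k" and b: "b \<in> orbits N k"
  shows "dot_basis N k a b \<in> orbit_space \<and> schur_lift (dot_basis N k a b) \<doteq> schur_lift (orbit_basis a) * schur_lift (orbit_basis b)"
proof (cases "b \<in> special_orbits N k")
  case True
  moreover have "cross_basis N k a b \<in> orbit_space"
    unfolding cross_basis_def by (intro orbit_space_sum orbit_space_scale orbit_space_basis)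
  ultimately show ?thesis using schur_lift_cross_basis[OF a True] by (simp add: dot_basis_def)
next
  case False
  obtain B where B: "box B" "b = orb B" using b by (auto simp: orbits_eq)
  define z where "z = (\<lambda>\<sigma> :: nat \<Rightarrow> nat. \<lambda>i. int (conj_part N b i) - int i + int (\<sigma> i))"
  have z_eq: "z \<sigma> i = int (tail_count B i) - int i + int (\<sigma> i)" for \<sigma> i
    by (simp add: z_def B(2) conj_part_eq[OF B(1)])
  define P where "P = (\<lambda>\<sigma>. foldl (\<lambda>u i. cross N k u (h_orbit k (z \<sigma> i))) (orbit_basis a) [1..<N])"
  have dot: "dot_basis N k a b = (\<Sum>\<sigma> | \<sigma> permutes {1..N - 1}. orbit_scale (of_int (sign \<sigma>)) (P \<sigma>))"
    using False by (simp add: dot_basis_def P_def z_def)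
  have P: "P \<sigma> \<in> orbit_space \<and> schur_lift (P \<sigma>) \<doteq> schur_lift (orbit_basis a) * (\<Prod>i\<in>{1..<N}. complete_hom N (z \<sigma> i))"
    if s: "\<sigma> permutes {1..N - 1}" for \<sigma>
  proof -
    have "z \<sigma> i < int (N + k)" if i: "i \<in> set [1..<N]" for i
    proof -
      have "\<sigma> i \<in> {1..N - 1}" using permutes_in_image[OF s, of i] i by auto
      moreover have "tail_count B i \<le> k" using tail_count_antimono[of 0 i B] B(1) by (simp add: tail_count_0 box_def)
      moreover have "1 \<le> i" using i by simp
      ultimately have "tail_count B i + \<sigma> i < N + k + i" by auto
      then show ?thesis by (simp add: z_def B(2) conj_part_eq[OF B(1)])
    qed
    moreover have "(\<Prod>i\<leftarrow>[1..<N]. complete_hom N (z \<sigma> i)) = (\<Prod>i\<in>{1..<N}. complete_hom N (z \<sigma> i))"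
      using prod.distinct_set_conv_list[of "[1..<N]" "\<lambda>i. complete_hom N (z \<sigma> i)"] by simp
    ultimately show ?thesis
      using schur_lift_foldl_cross[OF orbit_space_basis[OF a], of "[1..<N]" "z \<sigma>"] by (simp add: P_def)
  qed
  have "dot_basis N k a b \<in> orbit_space" unfolding dot by (intro orbit_space_sum orbit_space_scale) (use P in auto)
  moreover have "schur_lift (dot_basis N k a b) \<doteq> schur_lift (orbit_basis a) * schur_lift (orbit_basis b)"
  proof -
    have 1: "schur_lift (dot_basis N k a b) = (\<Sum>\<sigma> | \<sigma> permutes {1..N - 1}. of_int (sign \<sigma>) * schur_lift (P \<sigma>))"
      by (simp add: dot schur_lift_sum schur_lift_scale)
    have 2: "(\<Sum>\<sigma> | \<sigma> permutes {1..N - 1}. of_int (sign \<sigma>) * schur_lift (P \<sigma>)) \<doteq>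
      (\<Sum>\<sigma> | \<sigma> permutes {1..N - 1}. of_int (sign \<sigma>) *
        (schur_lift (orbit_basis a) * (\<Prod>i\<in>{1..<N}. complete_hom N (z \<sigma> i))))"
      by (intro fcong_sum fcong_mult_left symmetric_of_int) (use P in auto)
    have 3: "(\<Sum>\<sigma> | \<sigma> permutes {1..N - 1}. of_int (sign \<sigma>) *
        (schur_lift (orbit_basis a) * (\<Prod>i\<in>{1..<N}. complete_hom N (z \<sigma> i)))) = schur_lift (orbit_basis a) * box_schur B"
      unfolding box_schur_det[OF B(1)] sum_distrib_left z_eq by (rule sum.cong[OF refl]) (rule mult.left_commute)
    have "schur_lift (orbit_basis b) = box_schur B" by (simp add: B(2) schur_lift_basis[OF B(1)])
    then show ?thesis using 2 by (simp only: 1 3)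
  qed
  ultimately show ?thesis by blast
qed

lemma dot_orbit_space: "u \<in> orbit_space \<Longrightarrow> v \<in> orbit_space \<Longrightarrow> dot N k u v \<in> orbit_space"
  unfolding dot_def
  by (rule orbit_space_bilinear, rule schur_lift_dot_basis[THEN conjunct1]) (auto simp: orbit_space_def)

lemma schur_lift_dot: "u \<in> orbit_space \<Longrightarrow> v \<in> orbit_space \<Longrightarrow> schur_lift (dot N k u v) \<doteq> schur_lift u * schur_lift v"
  unfolding dot_def
  by (rule schur_lift_bilinear, rule schur_lift_dot_basis[THEN conjunct2]) (auto simp: orbit_space_def)

lemma unit_orbit: "perm_orbit (replicate k 0) = orb vacuum"
  by (simp add: perm_orbit_eq vacuum_def)

lemma unit_orbit_space: "orbit_basis (orb vacuum) \<in> orbit_space"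
  by (rule orbit_space_basis) (auto simp: orbits_eq box_vacuum)

lemma schur_lift_unit: "schur_lift (orbit_basis (orb vacuum)) = 1"
  by (simp add: schur_lift_basis[OF box_vacuum] box_schur_vacuum)

text \<open>All laws of the new product are pulled back from the quotient ring by this rule.\<close>

lemma dot_eqI:
  assumes "u \<in> orbit_space" "v \<in> orbit_space" "schur_lift u \<doteq> p" "schur_lift v \<doteq> p"
  shows "u = v"
  using schur_lift_inj[OF assms(1,2)] fcong_trans[OF assms(3) fcong_sym[OF assms(4)]] by blast

lemma algebra_orbit_algebra: "algebra (ring_of_type_algebra :: rat ring) (orbit_algebra N k)"
proof -
  note defs = orbit_algebra_def orbit_space_def[symmetric]
  have dot_unit: "dot N k (orbit_basis (orb vacuum)) u = u" if u: "u \<in> orbit_space" for u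
    using schur_lift_dot[OF unit_orbit_space u] by (intro dot_eqI[OF dot_orbit_space[OF unit_orbit_space u] u]) (auto simp: schur_lift_unit)
  have dot_comm: "dot N k u v = dot N k v u" if uv: "u \<in> orbit_space" "v \<in> orbit_space" for u v
    by (rule dot_eqI[OF dot_orbit_space dot_orbit_space schur_lift_dot]) (use uv schur_lift_dot[OF uv(2,1)] in \<open>simp_all add: mult.commute\<close>)
  have dot_assoc: "dot N k (dot N k u v) w = dot N k u (dot N k v w)" if uvw: "u \<in> orbit_space" "v \<in> orbit_space" "w \<in> orbit_space" for u v w
  proof (rule dot_eqI)
    show "schur_lift (dot N k (dot N k u v) w) \<doteq> schur_lift u * schur_lift v * schur_lift w"
      using fcong_trans[OF schur_lift_dot[OF dot_orbit_space[OF uvw(1,2)] uvw(3)]]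
        fcong_mult_left[OF schur_lift_dot[OF uvw(1,2)] schur_lift_symmetric[of w]] by (simp add: mult_ac)
    show "schur_lift (dot N k u (dot N k v w)) \<doteq> schur_lift u * schur_lift v * schur_lift w"
      using fcong_trans[OF schur_lift_dot[OF uvw(1) dot_orbit_space[OF uvw(2,3)]]]
        fcong_mult_left[OF schur_lift_dot[OF uvw(2,3)] schur_lift_symmetric[of u]] by (simp add: mult_ac)
  qed (use uvw in \<open>auto intro: dot_orbit_space\<close>)
  have dot_distrib: "dot N k (u + v) w = dot N k u w + dot N k v w" if uvw: "u \<in> orbit_space" "v \<in> orbit_space" "w \<in> orbit_space" for u v w
  proof (rule dot_eqI)
    show "schur_lift (dot N k (u + v) w) \<doteq> schur_lift u * schur_lift w + schur_lift v * schur_lift w"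
      using schur_lift_dot[OF orbit_space_add[OF uvw(1,2)] uvw(3)] by (simp add: schur_lift_add distrib_right)
    show "schur_lift (dot N k u w + dot N k v w) \<doteq> schur_lift u * schur_lift w + schur_lift v * schur_lift w"
      unfolding schur_lift_add by (intro fcong_add schur_lift_dot uvw)
  qed (use uvw in \<open>auto intro: dot_orbit_space orbit_space_add\<close>)
  have dot_scale: "dot N k (orbit_scale r u) v = orbit_scale r (dot N k u v)" if uv: "u \<in> orbit_space" "v \<in> orbit_space" for r u v
  proof (rule dot_eqI)
    show "schur_lift (dot N k (orbit_scale r u) v) \<doteq> cst r * (schur_lift u * schur_lift v)"
      using schur_lift_dot[OF orbit_space_scale[OF uv(1)] uv(2)] by (simp add: schur_lift_scale mult.assoc)
    show "schur_lift (orbit_scale r (dot N k u v)) \<doteq> cst r * (schur_lift u * schur_lift v)"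
      unfolding schur_lift_scale by (intro fcong_mult_left schur_lift_dot uv symmetric_cst)
  qed (use uv in \<open>auto intro: dot_orbit_space orbit_space_scale\<close>)
  have scale: "orbit_scale (r + s) u = orbit_scale r u + orbit_scale s u"
    "orbit_scale r (u + v) = orbit_scale r u + orbit_scale r v"
    "orbit_scale (r * s) u = orbit_scale r (orbit_scale s u)" "orbit_scale 1 u = u" for r s u v
    by (auto intro!: poly_mapping_eqI simp: lookup_orbit_scale lookup_add algebra_simps)
  have cring: "cring (orbit_algebra N k)"
  proof (rule cringI)
    show "abelian_group (orbit_algebra N k)"
    proof (rule abelian_groupI)
      fix x assume "x \<in> carrier (orbit_algebra N k)"
      then show "\<exists>y\<in>carrier (orbit_algebra N k). y \<oplus>\<^bsub>orbit_algebra N k\<^esub> x = \<zero>\<^bsub>orbit_algebra N k\<^esub>"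
        by (intro bexI[of _ "- x"]) (auto simp: defs orbit_space_uminus)
    qed (auto simp: defs orbit_space_add orbit_space_0 algebra_simps)
    show "Group.comm_monoid (orbit_algebra N k)"
      by (rule comm_monoidI)
        (auto simp: defs unit_orbit dot_orbit_space unit_orbit_space dot_unit dot_assoc intro: dot_comm)
  qed (auto simp: defs dot_distrib)
  show ?thesis
    by (rule algebraI[OF cring_from_type_algebra cring])
      (auto simp: ring_of_type_algebra_def defs orbit_space_scale scale dot_scale)
qed

lemma fusion_class_eq: "fusion_class N k p = (\<lambda>h. h + p) ` J"
  unfolding fusion_class_def a_r_coset_def' by (auto simp: sym_ring_def)

lemma fusion_class_eq_iff: "fusion_class N k p = fusion_class N k q \<longleftrightarrow> p \<doteq> q"
proof
  assume "fusion_class N k p = fusion_class N k q"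
  moreover have "p \<in> fusion_class N k p" using J_0 by (force simp: fusion_class_eq)
  ultimately show "p \<doteq> q" by (auto simp: fusion_class_eq fcong_def)
next
  have sub: "fusion_class N k p \<subseteq> fusion_class N k q" if "p \<doteq> q" for p q
  proof
    fix x assume "x \<in> fusion_class N k p"
    then obtain h where "h \<in> J" "x = h + p" by (auto simp: fusion_class_eq)
    then have "h + (p - q) \<in> J" "x = (h + (p - q)) + q" using that J_add by (auto simp: fcong_def)
    then show "x \<in> fusion_class N k q" unfolding fusion_class_eq by blast
  qed
  assume "p \<doteq> q"
  then show "fusion_class N k p = fusion_class N k q" using sub fcong_sym by blast
qed

lemma fusion_class_hom: "fusion_class N k \<in> Ring.ring_hom (sym_ring N) (fusion_algebra N k)"
proof -
  have "(+>\<^bsub>sym_ring N\<^esub>) J \<in> Ring.ring_hom (sym_ring N) (sym_ring N Quot J)"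
    by (rule ideal.rcos_ring_hom[OF ideal_J])
  then show ?thesis
    unfolding Ring.ring_hom_def fusion_algebra_def fusion_class_def
    by (simp add: ring.defs)
qed

lemma carrier_fusion_algebra: "carrier (fusion_algebra N k) = fusion_class N k ` symmetric_polys N"
  by (auto simp: fusion_algebra_def ring.defs FactRing_def A_RCOSETS_def' fusion_class_def sym_ring_def)

text \<open>The union in the definition of the scalar multiplication ranges over the representatives of one
  class, whose multiples all lie in the same class.\<close>

lemma smult_fusion_class:
  assumes p: "p \<in> symmetric_polys N"
  shows "r \<odot>\<^bsub>fusion_algebra N k\<^esub> fusion_class N k p = fusion_class N k (cst r * p)"
proof -
  have "r \<odot>\<^bsub>fusion_algebra N k\<^esub> fusion_class N k p = (\<Union>q\<in>fusion_class N k p. fusion_class N k (cst r * q))"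
    by (simp add: fusion_algebra_def ring.defs module.defs sym_ring_def)
  also have "\<dots> = (\<Union>q\<in>fusion_class N k p. fusion_class N k (cst r * p))"
  proof (rule SUP_cong[OF refl])
    fix q assume "q \<in> fusion_class N k p"
    then have "q \<doteq> p" by (auto simp: fusion_class_eq fcong_def)
    then show "fusion_class N k (cst r * q) = fusion_class N k (cst r * p)"
      unfolding fusion_class_eq_iff by (rule fcong_mult_left) simp
  qed
  also have "\<dots> = fusion_class N k (cst r * p)"
    using J_0 by (auto simp: fusion_class_eq)
  finally show ?thesis .
qed

lemma box_schur_schur:
  assumes "(\<Sum>i<N. a i) = k"
  shows "perm_orbit (standard_form N a) = orb (mset (standard_form N a))"
    and "box (mset (standard_form N a))"
    and "box_schur (mset (standard_form N a)) = schur N (map (\<lambda>i. \<Sum>j\<in>{i..<N}. a j) [1..<N] @ [0])"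
proof -
  let ?M = "mset (standard_form N a)"
  show "perm_orbit (standard_form N a) = orb ?M" by (rule perm_orbit_eq)
  have set: "set_mset ?M \<subseteq> {..<N}"
    using count_standard_form[of N a] by (metis count_inI lessThan_iff not_in_iff subsetI)
  have tail_count: "tail_count ?M i = (\<Sum>j\<in>{i..<N}. a j)" for i
    unfolding tail_count_sum_count[OF set] by (rule sum.cong) (auto simp: count_standard_form)
  show "box ?M" using set tail_count[of 0] assms tail_count_0[of ?M] by (simp add: box_def lessThan_atLeast0)
  show "box_schur ?M = schur N (map (\<lambda>i. \<Sum>j\<in>{i..<N}. a j) [1..<N] @ [0])"
    unfolding box_schur_def schur_jacobi_trudi
  proof (rule jacobi_trudi_cong)
    fix i assume i: "i \<in> {1..N}"
    show "tail_count ?M i + rho N i = (map (\<lambda>i. \<Sum>j\<in>{i..<N}. a j) [1..<N] @ [0]) ! (i - 1) + rho N i"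
      using i by (cases "i = N") (auto simp: tail_count nth_append)
  qed
qed

end

theorem mainTheorem3:
  fixes N k :: nat
  assumes "N \<ge> 2" and "k \<ge> 1"
  shows "algebra (ring_of_type_algebra :: rat ring) (orbit_algebra N k) \<and>
    (\<exists>\<phi>. \<phi> \<in> ring_iso (orbit_algebra N k) (fusion_algebra N k) \<and>
       (\<forall>r. \<forall>u\<in>carrier (orbit_algebra N k).
          \<phi> (r \<odot>\<^bsub>orbit_algebra N k\<^esub> u) = r \<odot>\<^bsub>fusion_algebra N k\<^esub> \<phi> u) \<and>
       (\<forall>a :: nat \<Rightarrow> nat. (\<Sum>i<N. a i) = k \<longrightarrow>
          \<phi> (orbit_basis (perm_orbit (standard_form N a))) =
          fusion_class N k (schur N (map (\<lambda>i. \<Sum>j\<in>{i..<N}. a j) [1..<N] @ [0]))))"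
proof -
  interpret fusion N k using assms by unfold_locales
  define \<phi> where "\<phi> = (\<lambda>u. fusion_class N k (schur_lift u))"
  note defs = orbit_algebra_def orbit_space_def[symmetric]
  have hom: "fusion_class N k (p * q) = fusion_class N k p \<otimes>\<^bsub>fusion_algebra N k\<^esub> fusion_class N k q"
    "fusion_class N k (p + q) = fusion_class N k p \<oplus>\<^bsub>fusion_algebra N k\<^esub> fusion_class N k q"
    if "p \<in> symmetric_polys N" "q \<in> symmetric_polys N" for p q
    using ring_hom_mult[OF fusion_class_hom, of p q] ring_hom_add[OF fusion_class_hom, of p q] that
    by (simp_all add: sym_ring_def)
  have "\<phi> \<in> ring_iso (orbit_algebra N k) (fusion_algebra N k)"
    unfolding ring_iso_def
  proof (intro CollectI conjI)
    show "\<phi> \<in> Ring.ring_hom (orbit_algebra N k) (fusion_algebra N k)"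
    proof (rule ring_hom_memI)
      fix u v assume uv: "u \<in> carrier (orbit_algebra N k)" "v \<in> carrier (orbit_algebra N k)"
      then have orbit_space: "u \<in> orbit_space" "v \<in> orbit_space" by (auto simp: defs)
      show "\<phi> u \<in> carrier (fusion_algebra N k)"
        by (auto simp: \<phi>_def carrier_fusion_algebra schur_lift_symmetric)
      have "\<phi> (dot N k u v) = fusion_class N k (schur_lift u * schur_lift v)"
        unfolding \<phi>_def fusion_class_eq_iff by (rule schur_lift_dot[OF orbit_space])
      then show "\<phi> (u \<otimes>\<^bsub>orbit_algebra N k\<^esub> v) = \<phi> u \<otimes>\<^bsub>fusion_algebra N k\<^esub> \<phi> v"
        by (simp add: defs hom schur_lift_symmetric \<phi>_def)
      show "\<phi> (u \<oplus>\<^bsub>orbit_algebra N k\<^esub> v) = \<phi> u \<oplus>\<^bsub>fusion_algebra N k\<^esub> \<phi> v"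
        by (simp add: defs hom schur_lift_symmetric schur_lift_add \<phi>_def)
    next
      show "\<phi> \<one>\<^bsub>orbit_algebra N k\<^esub> = \<one>\<^bsub>fusion_algebra N k\<^esub>"
        using ring_hom_one[OF fusion_class_hom] by (simp add: \<phi>_def defs unit_orbit schur_lift_unit sym_ring_def)
    qed
    show "bij_betw \<phi> (carrier (orbit_algebra N k)) (carrier (fusion_algebra N k))"
    proof (rule bij_betw_imageI)
      show "inj_on \<phi> (carrier (orbit_algebra N k))"
        by (auto simp: inj_on_def \<phi>_def fusion_class_eq_iff defs intro: schur_lift_inj)
      have "fusion_class N k p \<in> \<phi> ` orbit_space" if "p \<in> symmetric_polys N" for p
        using schur_lift_surj[OF that] by (auto simp: \<phi>_def fusion_class_eq_iff)
      then show "\<phi> ` carrier (orbit_algebra N k) = carrier (fusion_algebra N k)"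
        by (auto simp: carrier_fusion_algebra defs \<phi>_def schur_lift_symmetric)
    qed
  qed
  moreover have "\<phi> (r \<odot>\<^bsub>orbit_algebra N k\<^esub> u) = r \<odot>\<^bsub>fusion_algebra N k\<^esub> \<phi> u" for r u
    by (simp add: \<phi>_def smult_fusion_class schur_lift_symmetric schur_lift_scale defs)
  moreover have "\<phi> (orbit_basis (perm_orbit (standard_form N a))) =
      fusion_class N k (schur N (map (\<lambda>i. \<Sum>j\<in>{i..<N}. a j) [1..<N] @ [0]))" if "(\<Sum>i<N. a i) = k" for a
    using box_schur_schur[OF that] by (simp add: \<phi>_def schur_lift_basis)
  ultimately show ?thesis using algebra_orbit_algebra by blast
qed

end
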